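(* Let $r>1$. For every $\beta$ with $0<\beta<1$ there is a constant $c(\beta)$ such that for every $\rho>0$ and every $f\in C_0^\infty(D_r)$ with $\|f\|_{H^\beta(\mathbb{R}^2)}\le\rho$, $$\|f\|_{L^2(\mathbb{R}^2)}\le c(\beta)\,\rho^{\frac{3/2}{\beta+3/2}}\,\|\mathcal{D}f\|_{L^2([-1,1]\times S^1)}^{\frac{\beta}{\beta+3/2}}.$$
   Context: Functions are real valued. $D_r=\{(x,y)\in\mathbb{R}^2: x^2+(y-(r+1)/2)^2<(r-1)^2/4\}$. $C_0^\infty(\Omega)$ denotes the smooth functions with compact support contained in the open set $\Omega\subseteq\mathbb{R}^2$, extended by zero to $\mathbb{R}^2$. $Z=\mathbb{R}\times S^1$, with $\phi\in S^1$ regarded as an angle modulo $2\pi$. With $\hat f(\xi)=(2\pi)^{-1}\int_{\mathbb{R}^2}f(x)e^{-ix\cdot\xi}\,\mathrm{d}x$, the Sobolev norm is $\|f\|^2_{H^\alpha(\mathbb{R}^2)}=\int_{\mathbb{R}^2}(1+|\xi|^2)^\alpha|\hat f(\xi)|^2\,\mathrm{d}\xi$. Also $\|g\|^2_{L^2([-1,1]\times S^1)}=\int_{S^1}\int_{-1}^1|g(p,\phi)|^2\,\mathrm{d}p\,\mathrm{d}\phi$. Disc transform. For $q>0$, $D_{q,\phi}$ is the disc of diameter $q$ whose centre has polar coordinates $(q/2,\phi)$ (so its boundary passes through the origin). For $f\in C_0^\infty(\mathbb{R}^2)$ and $p>0$ put $\mathcal{D}_1f(p,\phi)=\iint_{D_{1/p,\phi}}f\,\mathrm{d}A$,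 and let $\mathcal{D}_1f(0^+,\phi)=\lim_{p\to0^+}\mathcal{D}_1f(p,\phi)$. Define $\mathcal{D}_2f$ on $Z$ by $\mathcal{D}_2f(p,\phi)=\mathcal{D}_1f(p,\phi)$ for $p>0$, $\mathcal{D}_2f(p,\phi)=\mathcal{D}_1f(-p,\phi+\pi)$ for $p<0$, and $\mathcal{D}_2f(0,\phi)=\frac{1}{2}\left(\mathcal{D}_1f(0^+,\phi)+\mathcal{D}_1f(0^+,\phi+\pi)\right)$. Let $c(\phi)=\frac{1}{2}\left(\mathcal{D}_1f(0^+,\phi+\pi)-\mathcal{D}_1f(0^+,\phi)\right)$ and $\mathcal{D}f(p,\phi)=\mathcal{D}_2f(p,\phi)+c(\phi)\,\mathrm{sgn}(p)$, with $\mathrm{sgn}(0)=0$. (The function $c(\phi)$ here is unrelated to the constant $c(\beta)$.) The number $r$ is fixed, and the constant $c(\beta)$ may depend on $r$ as well as on $\beta$, but not on $f$ or $\rho$. *)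

theory Defs
  imports "HOL-Analysis.Analysis"
begin

text \<open>
  The plane is the Euclidean space \<^typ>\<open>real \<times> real\<close>; its library norm and inner product are
  the Euclidean ones. Functions on the cylinder \<open>\<real> \<times> S\<^sup>1\<close> are curried functions \<open>g p \<phi>\<close>
  that are \<open>2\<pi>\<close>-periodic in the angle \<open>\<phi>\<close>.
\<close>

text \<open>Continuous differentiability of order \<open>k\<close> on the whole space, by way of directional derivatives.\<close>

primrec Ck :: "nat \<Rightarrow> ('a::euclidean_space \<Rightarrow> real) \<Rightarrow> bool" where
  "Ck 0 f \<longleftrightarrow> continuous_on UNIV f"
| "Ck (Suc k) f \<longleftrightarrow>
     (\<forall>x. f differentiable (at x)) \<and> (\<forall>v. Ck k (\<lambda>x. frechet_derivative f (at x) v))"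

definition smooth :: "('a::euclidean_space \<Rightarrow> real) \<Rightarrow> bool" where
  "smooth f \<longleftrightarrow> (\<forall>k. Ck k f)"

text \<open>Elements are already extended by zero, hence total functions on the whole space.\<close>

definition C0_infty :: "'a::euclidean_space set \<Rightarrow> ('a \<Rightarrow> real) set" where
  "C0_infty \<Omega> = {f. smooth f \<and> compact (closure {x. f x \<noteq> 0}) \<and> closure {x. f x \<noteq> 0} \<subseteq> \<Omega>}"

definition disc_Dr :: "real \<Rightarrow> (real \<times> real) set" where
  "disc_Dr r = {(x, y). x\<^sup>2 + (y - (r + 1) / 2)\<^sup>2 < (r - 1)\<^sup>2 / 4}"

definition fourier2 :: "(real \<times> real \<Rightarrow> real) \<Rightarrow> real \<times> real \<Rightarrow> complex" where
  "fourier2 f \<xi> =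
     complex_of_real (1 / (2 * pi)) * (LINT x|lborel. complex_of_real (f x) * exp (- (\<i> * complex_of_real (x \<bullet> \<xi>))))"

definition sobolev_norm :: "real \<Rightarrow> (real \<times> real \<Rightarrow> real) \<Rightarrow> real" where
  "sobolev_norm \<alpha> f = sqrt (LINT \<xi>|lborel. (1 + (norm \<xi>)\<^sup>2) powr \<alpha> * (cmod (fourier2 f \<xi>))\<^sup>2)"

definition L2_norm_plane :: "(real \<times> real \<Rightarrow> real) \<Rightarrow> real" where
  "L2_norm_plane f = sqrt (LINT x|lborel. (f x)\<^sup>2)"

definition L2_norm_cyl :: "(real \<Rightarrow> real \<Rightarrow> real) \<Rightarrow> real" where
  "L2_norm_cyl g = sqrt (LINT \<phi>:{0..2 * pi}|lborel. (LINT p:{-1..1}|lborel. (g p \<phi>)\<^sup>2))"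

definition disc_through_0 :: "real \<Rightarrow> real \<Rightarrow> (real \<times> real) set" where
  "disc_through_0 q \<phi> = ball (q / 2 * cos \<phi>, q / 2 * sin \<phi>) (q / 2)"

text \<open>Only the values at \<open>p > 0\<close> are meaningful.\<close>

definition disc_transform1 :: "(real \<times> real \<Rightarrow> real) \<Rightarrow> real \<Rightarrow> real \<Rightarrow> real" where
  "disc_transform1 f p \<phi> = (LINT x:disc_through_0 (1 / p) \<phi>|lborel. f x)"

definition disc_transform1_0 :: "(real \<times> real \<Rightarrow> real) \<Rightarrow> real \<Rightarrow> real" where
  "disc_transform1_0 f \<phi> = Lim (at_right 0) (\<lambda>p. disc_transform1 f p \<phi>)"

definition disc_transform2 :: "(real \<times> real \<Rightarrow> real) \<Rightarrow> real \<Rightarrow> real \<Rightarrow> real" where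
  "disc_transform2 f p \<phi> =
     (if p > 0 then disc_transform1 f p \<phi>
      else if p < 0 then disc_transform1 f (- p) (\<phi> + pi)
      else (disc_transform1_0 f \<phi> + disc_transform1_0 f (\<phi> + pi)) / 2)"

definition jump_correction :: "(real \<times> real \<Rightarrow> real) \<Rightarrow> real \<Rightarrow> real" where
  "jump_correction f \<phi> = (disc_transform1_0 f (\<phi> + pi) - disc_transform1_0 f \<phi>) / 2"

definition disc_transform :: "(real \<times> real \<Rightarrow> real) \<Rightarrow> real \<Rightarrow> real \<Rightarrow> real" where
  "disc_transform f p \<phi> = disc_transform2 f p \<phi> + jump_correction f \<phi> * sgn p"

lemma disc_transform_periodic: "disc_transform f p (\<phi> + 2 * pi) = disc_transform f p \<phi>"
proof -
  have "disc_through_0 q (\<theta> + 2 * pi) = disc_through_0 q \<theta>" for q \<theta>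
    by (simp add: disc_through_0_def)
  then have 1: "disc_transform1 f q (\<theta> + 2 * pi) = disc_transform1 f q \<theta>" for q \<theta>
    by (simp add: disc_transform1_def)
  then have 2: "disc_transform1_0 f (\<theta> + 2 * pi) = disc_transform1_0 f \<theta>" for \<theta>
    by (simp add: disc_transform1_0_def)
  have 3: "\<phi> + 2 * pi + pi = (\<phi> + pi) + 2 * pi"
    by simp
  show ?thesis
    unfolding disc_transform_def disc_transform2_def jump_correction_def 3 1 2 ..
qed

end

theory Submission
  imports Defs "HOL-Probability.Characteristic_Functions"
begin

text \<open>
  The inversion \<open>y \<mapsto> y / |y|\<^sup>2\<close> carries the disc \<open>D\<^bsub>1/p,\<phi>\<^esub>\<close>, whose boundary passes through the origin, to the
  half-plane \<open>y \<bullet> \<omega> > p\<close> with \<open>\<omega> = (cos \<phi>, sin \<phi>)\<close>. Hence the disc transform of \<open>f\<close> is made of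
  half-plane integrals of \<open>g y = f (y / |y|\<^sup>2) / |y|\<^sup>4\<close>: with \<open>M = \<integral>g\<close> and \<open>H p \<phi>\<close> the integral of \<open>g\<close> over
  \<open>y \<bullet> \<omega> < p\<close>, it equals \<open>M / 2 - sgn p (H p \<phi> - H 0 \<phi>)\<close> (\<open>disc_transform_eq\<close>). The estimate
  interpolates between two bounds on \<open>g\<close>.

  Low frequencies. Since \<open>H\<close> is an antiderivative in \<open>p\<close> of the Radon transform of \<open>g\<close>, integrating the Fourier
  slice theorem by parts over \<open>[-1, 1]\<close> expresses the Fourier transform of \<open>g\<close> at \<open>\<sigma>\<omega>\<close> by \<open>M\<close> and by \<open>\<sigma>\<close> times
  the one-dimensional transform of \<open>H\<close> cut off to \<open>[-1, 1]\<close> (\<open>fourier_slice\<close>). The two quantities that the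
  disc transform hides, \<open>M\<close> and \<open>H 0 \<phi>\<close>, are recovered from the position of the support: \<open>g\<close> lives in the disc
  with diameter from \<open>(0, 1/r)\<close> to \<open>(0, 1)\<close>, so the lines with \<open>\<phi>\<close> near \<open>\<pi>/2\<close> and small \<open>p\<close> do not meet it and
  the transform is \<open>M / 2\<close> there (\<open>mass_bound\<close>), while for \<open>sin \<phi> \<ge> 0\<close> the function \<open>H\<close> vanishes for
  \<open>p \<le> -1/2\<close> (\<open>trunc_square_bound\<close>). With the weight \<open>|\<sigma>|\<close> of polar coordinates this bounds the energy of \<open>g\<close> in
  frequencies below \<open>A \<ge> 1\<close> by a multiple of \<open>A\<^sup>3\<close> times the squared norm of the transform (\<open>low_frequency\<close>); the exponent
  \<open>3 = 2 \<cdot> 3/2\<close> is the source of the number \<open>3/2\<close> in the theorem.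

  High frequencies. Let \<open>W f t\<close> be the integral of \<open>(f x - f y)\<^sup>2\<close> over \<open>|x - y| < t\<close>. By Plancherel, \<open>W f t\<close> is at
  most a constant times \<open>t\<^bsup>2+2\<beta>\<^esup>\<close> times the squared Sobolev norm (\<open>modulus2_le_sobolev\<close>), and \<open>W g (2 t)\<close>
  controls \<open>t\<^sup>2\<close> times the energy of \<open>g\<close> in frequencies above \<open>2 / t\<close> (\<open>high_frequency_le_modulus2\<close>). A
  double integral over nearby pairs of points is stable under bi-Lipschitz changes of variables, so \<open>W g t\<close> is
  bounded by multiples of \<open>W f (4 r\<^sup>2 t)\<close> and of \<open>t\<^sup>4\<close> times the squared \<open>L\<^sup>2\<close> norm of \<open>f\<close>
  (\<open>modulus2_kelvin\<close>); this replaces the invariance of fractional Sobolev spaces under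
  diffeomorphisms.

  Together, the squared \<open>L\<^sup>2\<close> norm of \<open>f\<close> is at most \<open>K t\<^bsup>-3\<^esup> E\<^sup>2 + L t\<^bsup>2\<beta>\<^esup> \<rho>\<^sup>2\<close> for all small \<open>t\<close>, where \<open>E\<close> is the
  norm of the transform, and the best \<open>t\<close> gives the theorem (\<open>optimise_splitting\<close>). Plancherel's theorem and
  polar coordinates are proved along the way.
\<close>

section \<open>Plancherel's theorem on the line\<close>

text \<open>
  No factor in front of the integral: the identities below then carry the constant \<open>2\<pi>\<close>, and the planar
  transform, with its factor \<open>1 / (2\<pi>)\<close>, becomes an isometry.
\<close>

definition fourier1 :: "(real \<Rightarrow> complex) \<Rightarrow> real \<Rightarrow> complex" where
  "fourier1 g \<xi> = (CLBINT x. g x * iexp (- (\<xi> * x)))"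

lemma borel_measurable_cnj [measurable (raw)]:
  "f \<in> borel_measurable M \<Longrightarrow> (\<lambda>x. cnj (f x)) \<in> borel_measurable M"
  by (rule borel_measurable_continuous_on[of cnj]) (auto intro!: continuous_intros)

lemma integrable_mult_iexp:
  assumes "integrable lborel g"
  shows "integrable lborel (\<lambda>x. g x * iexp (- (\<xi> * x)))"
  by (rule Bochner_Integration.integrable_bound[OF assms]) (use assms in \<open>auto simp: norm_mult\<close>)

lemma fourier1_measurable [measurable]:
  assumes [measurable]: "g \<in> borel_measurable borel"
  shows "fourier1 g \<in> borel_measurable borel"
  unfolding fourier1_def by measurable

lemma norm_fourier1_le:
  "cmod (fourier1 g \<xi>) \<le> (LBINT x. cmod (g x))"
  unfolding fourier1_def by (rule order_trans[OF integral_norm_bound]) (simp add: norm_mult)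

text \<open>
  A rescaled characteristic function of the standard normal law. The gaussians \<open>exp (- (\<epsilon>\<xi>)\<^sup>2 / 2)\<close> are used as
  summability weights: they make the energy integral of a transform converge, and their own transforms are
  probability densities that concentrate at \<open>0\<close> as \<open>\<epsilon>\<close> tends to \<open>0\<close>.
\<close>

lemma fourier1_gaussian:
  assumes "\<epsilon> > 0"
  shows "fourier1 (\<lambda>\<xi>. of_real (exp (- (\<epsilon> * \<xi>)\<^sup>2 / 2))) u
         = of_real (2 * pi / \<epsilon> * std_normal_density (u / \<epsilon>))"
proof -
  have "of_real (exp (- (u / \<epsilon>)\<^sup>2 / 2)) = char std_normal_distribution (- u / \<epsilon>)"
    by (simp add: char_std_normal_distribution)
  also have "\<dots> = (CLBINT x. std_normal_density x *\<^sub>R iexp (- u / \<epsilon> * x))"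
    unfolding char_def by (rule integral_density) auto
  also have "\<dots> = \<epsilon> *\<^sub>R (CLBINT x. std_normal_density (0 + \<epsilon> * x) *\<^sub>R iexp (- u / \<epsilon> * (0 + \<epsilon> * x)))"
    using assms by (subst lborel_integral_real_affine[where c = \<epsilon> and t = 0]) auto
  also have "(CLBINT x. std_normal_density (0 + \<epsilon> * x) *\<^sub>R iexp (- u / \<epsilon> * (0 + \<epsilon> * x)))
      = (CLBINT x. of_real (1 / sqrt (2 * pi)) * (of_real (exp (- (\<epsilon> * x)\<^sup>2 / 2)) * iexp (- (u * x))))"
    using assms by (intro Bochner_Integration.integral_cong)
      (auto simp: normal_density_def scaleR_conv_of_real)
  also have "\<dots> = of_real (1 / sqrt (2 * pi)) * fourier1 (\<lambda>\<xi>. of_real (exp (- (\<epsilon> * \<xi>)\<^sup>2 / 2))) u"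
    unfolding fourier1_def by simp
  finally have "fourier1 (\<lambda>\<xi>. of_real (exp (- (\<epsilon> * \<xi>)\<^sup>2 / 2))) u
      = of_real (sqrt (2 * pi) / \<epsilon> * exp (- (u / \<epsilon>)\<^sup>2 / 2))"
    using assms by (simp add: scaleR_conv_of_real field_simps)
  moreover have "sqrt (2 * pi) / \<epsilon> * exp (- (u / \<epsilon>)\<^sup>2 / 2) = 2 * pi / \<epsilon> * std_normal_density (u / \<epsilon>)"
    using assms by (simp add: normal_density_def field_simps real_sqrt_mult)
  ultimately show ?thesis by (simp only:)
qed

text \<open>
  Its Fourier transform is \<open>|fourier1 g|\<^sup>2\<close>, and its value at \<open>0\<close> is \<open>\<integral>|g|\<^sup>2\<close>; Plancherel's theorem is thus
  the inversion formula for this function at the single point \<open>0\<close>.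
\<close>

definition autocorr :: "(real \<Rightarrow> complex) \<Rightarrow> real \<Rightarrow> complex" where
  "autocorr g u = (CLBINT x. g x * cnj (g (x - u)))"

lemma integrable_shift:
  fixes g :: "real \<Rightarrow> complex"
  assumes "integrable lborel g"
  shows "integrable lborel (\<lambda>u. g (x - u))"
  using lborel_integrable_real_affine[OF assms, of "-1" x] by simp

lemma integral_reflect_shift:
  fixes g :: "real \<Rightarrow> 'a :: {banach, second_countable_topology}"
  shows "(LBINT u. g (x - u)) = (LBINT u. g u)"
  using lborel_integral_real_affine[of "-1" g x] by simp

context
  fixes g :: "real \<Rightarrow> complex" and B :: real
  assumes int_g: "integrable lborel g" and bd: "\<And>x. cmod (g x) \<le> B"
begin

lemma meas_g [measurable]: "g \<in> borel_measurable borel"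
  using int_g by simp

lemma B_nonneg: "B \<ge> 0" using bd[of 0] norm_ge_zero order_trans by blast

lemma autocorr_measurable [measurable]: "autocorr g \<in> borel_measurable borel"
  unfolding autocorr_def by measurable

lemma integrable_square: "integrable lborel (\<lambda>x. (cmod (g x))\<^sup>2)"
proof (rule Bochner_Integration.integrable_bound)
  show "integrable lborel (\<lambda>x. B * cmod (g x))" using int_g by auto
  show "AE x in lborel. norm ((cmod (g x))\<^sup>2) \<le> norm (B * cmod (g x))"
    using bd B_nonneg by (auto simp: power2_eq_square intro!: mult_right_mono)
qed simp

text \<open>
  The Cauchy--Schwarz inequality, in the form \<open>a b \<le> (a\<^sup>2 + b\<^sup>2) / 2\<close> together with translation invariance.
\<close>

lemma autocorr_bound: "cmod (autocorr g u) \<le> (LBINT x. (cmod (g x))\<^sup>2)"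
proof -
  have shift: "integrable lborel (\<lambda>x. (cmod (g (x - u)))\<^sup>2)"
    using lborel_integrable_real_affine[OF integrable_square, of 1 "-u"] by simp
  have shiftI: "(LBINT x. (cmod (g (x - u)))\<^sup>2) = (LBINT x. (cmod (g x))\<^sup>2)"
    using lborel_integral_real_affine[of 1 "\<lambda>x. (cmod (g x))\<^sup>2" "-u"] by simp
  have "cmod (autocorr g u) \<le> (LBINT x. cmod (g x * cnj (g (x - u))))"
    unfolding autocorr_def by (rule integral_norm_bound)
  also have "\<dots> \<le> (LBINT x. ((cmod (g x))\<^sup>2 + (cmod (g (x - u)))\<^sup>2) / 2)"
  proof (rule integral_mono')
    show "integrable lborel (\<lambda>x. ((cmod (g x))\<^sup>2 + (cmod (g (x - u)))\<^sup>2) / 2)"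
      using integrable_square shift by auto
    fix x show "cmod (g x * cnj (g (x - u))) \<le> ((cmod (g x))\<^sup>2 + (cmod (g (x - u)))\<^sup>2) / 2"
      using sum_squares_bound[of "cmod (g x)" "cmod (g (x - u))"] by (simp add: norm_mult)
  qed simp
  also have "\<dots> = (LBINT x. (cmod (g x))\<^sup>2)"
    using integrable_square shift shiftI by simp
  finally show ?thesis .
qed

lemma integrable_autocorr_pair:
  "integrable (lborel \<Otimes>\<^sub>M lborel) (\<lambda>(x, u). g x * cnj (g (x - u)) * iexp (- (\<xi> * u)))"
proof (rule lborel_pair.Fubini_integrable)
  have "(LBINT u. norm (g x * cnj (g (x - u)) * iexp (- (\<xi> * u)))) = cmod (g x) * (LBINT u. cmod (g u))" for x
    using integral_reflect_shift[of "\<lambda>u. cmod (g u)" x] by (simp add: norm_mult)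
  then show "integrable lborel (\<lambda>x. LBINT u. norm (case (x, u) of (x, u) \<Rightarrow> g x * cnj (g (x - u)) * iexp (- (\<xi> * u))))"
    using int_g by simp
  show "AE x in lborel. integrable lborel (\<lambda>u. case (x, u) of (x, u) \<Rightarrow> g x * cnj (g (x - u)) * iexp (- (\<xi> * u)))"
  proof (rule AE_I2)
    fix x
    have "integrable lborel (\<lambda>u. g x * cnj (g (x - u)))"
      using integrable_shift[OF int_g, of x] by auto
    from integrable_mult_iexp[OF this, of \<xi>]
    show "integrable lborel (\<lambda>u. case (x, u) of (x, u) \<Rightarrow> g x * cnj (g (x - u)) * iexp (- (\<xi> * u)))" by simp
  qed
qed measurable

lemma integrable_autocorr: "integrable lborel (autocorr g)"
  using lborel_pair.integrable_snd[OF integrable_autocorr_pair[of 0]]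
  by (simp add: autocorr_def[abs_def])

lemma fourier1_autocorr: "fourier1 (autocorr g) \<xi> = of_real ((cmod (fourier1 g \<xi>))\<^sup>2)"
proof -
  have "fourier1 (autocorr g) \<xi> = (CLBINT u. CLBINT x. g x * cnj (g (x - u)) * iexp (- (\<xi> * u)))"
    unfolding fourier1_def autocorr_def by simp
  also have "\<dots> = (CLBINT x. CLBINT u. g x * cnj (g (x - u)) * iexp (- (\<xi> * u)))"
    using lborel_pair.Fubini_integral[OF integrable_autocorr_pair] by simp
  also have "\<dots> = (CLBINT x. g x * iexp (- (\<xi> * x)) * cnj (fourier1 g \<xi>))"
  proof (rule Bochner_Integration.integral_cong[OF refl])
    fix x
    have "(CLBINT u. g x * cnj (g (x - u)) * iexp (- (\<xi> * u)))
        = (CLBINT u. (g x * iexp (- (\<xi> * x))) * cnj (g (x - u) * iexp (- (\<xi> * (x - u)))))"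
      by (intro Bochner_Integration.integral_cong)
        (auto simp: exp_cnj mult_exp_exp[symmetric] algebra_simps  simp flip: exp_add)
    also have "\<dots> = (g x * iexp (- (\<xi> * x))) * cnj (CLBINT u. g (x - u) * iexp (- (\<xi> * (x - u))))"
      by (simp only: integral_mult_right_zero Bochner_Integration.integral_cnj)
    also have "(CLBINT u. g (x - u) * iexp (- (\<xi> * (x - u)))) = fourier1 g \<xi>"
      unfolding fourier1_def by (rule integral_reflect_shift)
    finally show "(CLBINT u. g x * cnj (g (x - u)) * iexp (- (\<xi> * u))) = g x * iexp (- (\<xi> * x)) * cnj (fourier1 g \<xi>)" .
  qed
  also have "\<dots> = fourier1 g \<xi> * cnj (fourier1 g \<xi>)" unfolding fourier1_def by simp
  finally show ?thesis by (simp flip: complex_norm_square)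
qed

lemma gaussian_integrable: "(\<epsilon>::real) > 0 \<Longrightarrow> integrable lborel (\<lambda>x. exp (- (\<epsilon> * x)\<^sup>2 / 2))"
proof -
  assume e: "\<epsilon> > 0"
  have "integrable lborel (\<lambda>x. sqrt (2 * pi) * std_normal_density (0 + \<epsilon> * x))"
    using e lborel_integrable_real_affine[of std_normal_density \<epsilon> 0] by auto
  then show ?thesis by (simp add: normal_density_def)
qed

text \<open>
  Both sides are the double integral of \<open>exp (- (\<epsilon>\<xi>)\<^sup>2 / 2) A u exp (- i \<xi> u)\<close> with \<open>A\<close> the autocorrelation: integrating
  over \<open>u\<close> first gives the left side, integrating over \<open>\<xi>\<close> first gives the right side after \<open>u = \<epsilon> v\<close>.
\<close>

lemma gaussian_parseval:
  assumes "\<epsilon> > 0"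
  shows "(LBINT \<xi>. (cmod (fourier1 g \<xi>))\<^sup>2 * exp (- (\<epsilon> * \<xi>)\<^sup>2 / 2))
     = 2 * pi * (LBINT v. std_normal_density v * Re (autocorr g (\<epsilon> * v)))"
proof -
  let ?w = "\<lambda>\<xi>. exp (- (\<epsilon> * \<xi>)\<^sup>2 / 2)"
  have pair: "integrable (lborel \<Otimes>\<^sub>M lborel) (\<lambda>(\<xi>, u). of_real (?w \<xi>) * autocorr g u * iexp (- (\<xi> * u)))"
  proof (rule lborel_pair.Fubini_integrable)
    show "integrable lborel (\<lambda>x. LBINT u. norm (case (x, u) of (\<xi>, u) \<Rightarrow> of_real (?w \<xi>) * autocorr g u * iexp (- (\<xi> * u))))"
      using gaussian_integrable[OF assms] by (simp add: norm_mult)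
    show "AE x in lborel. integrable lborel (\<lambda>u. case (x, u) of (\<xi>, u) \<Rightarrow> of_real (?w \<xi>) * autocorr g u * iexp (- (\<xi> * u)))"
      using integrable_mult_iexp[OF integrable_mult_right[OF integrable_autocorr]] by simp
  qed measurable
  have "of_real (LBINT \<xi>. (cmod (fourier1 g \<xi>))\<^sup>2 * ?w \<xi>) = (CLBINT \<xi>. of_real (?w \<xi>) * fourier1 (autocorr g) \<xi>)"
    unfolding fourier1_autocorr by (simp add: mult.commute flip: integral_complex_of_real)
  also have "\<dots> = (CLBINT \<xi>. CLBINT u. of_real (?w \<xi>) * autocorr g u * iexp (- (\<xi> * u)))"
    unfolding fourier1_def by (simp add: mult.assoc)
  also have "\<dots> = (CLBINT u. CLBINT \<xi>. of_real (?w \<xi>) * autocorr g u * iexp (- (\<xi> * u)))"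
    using lborel_pair.Fubini_integral[OF pair] by simp
  also have "\<dots> = (CLBINT u. autocorr g u * fourier1 (\<lambda>\<xi>. of_real (?w \<xi>)) u)"
    unfolding fourier1_def by (simp add: ac_simps flip: integral_mult_right_zero)
  also have "\<dots> = (CLBINT u. autocorr g u * of_real (2 * pi / \<epsilon> * std_normal_density (u / \<epsilon>)))"
    by (simp only: fourier1_gaussian[OF assms])
  also have "\<dots> = \<epsilon> *\<^sub>R (CLBINT v. autocorr g (0 + \<epsilon> * v) * of_real (2 * pi / \<epsilon> * std_normal_density ((0 + \<epsilon> * v) / \<epsilon>)))"
    using assms by (subst lborel_integral_real_affine[where c = \<epsilon> and t = 0]) auto
  also have "\<dots> = (CLBINT v. of_real (2 * pi) * (autocorr g (\<epsilon> * v) * of_real (std_normal_density v)))"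
    unfolding integral_scaleR_right[symmetric] using assms by (intro Bochner_Integration.integral_cong) (auto simp: scaleR_conv_of_real)
  also have "\<dots> = of_real (2 * pi) * (CLBINT v. autocorr g (\<epsilon> * v) * of_real (std_normal_density v))"
    by simp
  finally have eq: "of_real (LBINT \<xi>. (cmod (fourier1 g \<xi>))\<^sup>2 * ?w \<xi>)
     = of_real (2 * pi) * (CLBINT v. autocorr g (\<epsilon> * v) * of_real (std_normal_density v))" .
  have "(LBINT \<xi>. (cmod (fourier1 g \<xi>))\<^sup>2 * ?w \<xi>)
     = 2 * pi * Re (CLBINT v. autocorr g (\<epsilon> * v) * of_real (std_normal_density v))"
    using arg_cong[OF eq, of Re] by (simp del: of_real_mult)
  also have "Re (CLBINT v. autocorr g (\<epsilon> * v) * of_real (std_normal_density v))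
     = (LBINT v. std_normal_density v * Re (autocorr g (\<epsilon> * v)))"
  proof -
    have "integrable lborel (\<lambda>v. autocorr g (\<epsilon> * v) * of_real (std_normal_density v))"
    proof (rule Bochner_Integration.integrable_bound)
      show "integrable lborel (\<lambda>v. (LBINT x. (cmod (g x))\<^sup>2) * std_normal_density v)" by auto
      show "AE v in lborel. norm (autocorr g (\<epsilon> * v) * of_real (std_normal_density v))
           \<le> norm ((LBINT x. (cmod (g x))\<^sup>2) * std_normal_density v)"
        using autocorr_bound by (auto simp: norm_mult intro!: mult_right_mono)
    qed simp
    from integral_Re[OF this] show ?thesis by (simp add: mult.commute)
  qed
  finally show ?thesis .
qed

text \<open>
  The weights increase to \<open>1\<close> as \<open>\<epsilon> = 1 / (n + 1)\<close> decreases, so monotone convergence applies, whether or not the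
  limit is finite.
\<close>

lemma gaussian_parseval_limit:
  "(\<lambda>n. ennreal (2 * pi * (LBINT v. std_normal_density v * Re (autocorr g (1 / real (Suc n) * v)))))
     \<longlonglongrightarrow> (\<integral>\<^sup>+ \<xi>. ennreal ((cmod (fourier1 g \<xi>))\<^sup>2) \<partial>lborel)"
proof -
  define w where "w n \<xi> = exp (- (1 / real (Suc n) * \<xi>)\<^sup>2 / 2)" for n and \<xi> :: real
  have lim_w: "(\<lambda>n. w n \<xi>) \<longlonglongrightarrow> 1" for \<xi>
  proof -
    have "(\<lambda>n. exp (- (1 / real (Suc n) * \<xi>)\<^sup>2 / 2)) \<longlonglongrightarrow> exp (- (0 * \<xi>)\<^sup>2 / 2)"
      by (intro tendsto_intros LIMSEQ_inverse_real_of_nat[unfolded inverse_eq_divide]) auto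
    then show ?thesis by (simp add: w_def)
  qed
  have "incseq (\<lambda>n \<xi>. ennreal ((cmod (fourier1 g \<xi>))\<^sup>2 * w n \<xi>))"
  proof (intro incseq_SucI le_funI ennreal_leI mult_left_mono)
    fix n \<xi>
    have "\<bar>1 / real (Suc (Suc n)) * \<xi>\<bar> \<le> \<bar>1 / real (Suc n) * \<xi>\<bar>"
      by (simp add: abs_mult field_simps mult_left_mono)
    then show "w n \<xi> \<le> w (Suc n) \<xi>"
      unfolding w_def by (simp only: abs_le_square_iff) simp
  qed simp
  then have "(\<lambda>n. \<integral>\<^sup>+ \<xi>. ennreal ((cmod (fourier1 g \<xi>))\<^sup>2 * w n \<xi>) \<partial>lborel)
     \<longlonglongrightarrow> (\<integral>\<^sup>+ \<xi>. ennreal ((cmod (fourier1 g \<xi>))\<^sup>2) \<partial>lborel)"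
  proof (rule nn_integral_LIMSEQ)
    fix \<xi>
    have "(\<lambda>n. ennreal ((cmod (fourier1 g \<xi>))\<^sup>2 * w n \<xi>)) \<longlonglongrightarrow> ennreal ((cmod (fourier1 g \<xi>))\<^sup>2 * 1)"
      by (intro tendsto_ennrealI tendsto_intros lim_w)
    then show "(\<lambda>n. ennreal ((cmod (fourier1 g \<xi>))\<^sup>2 * w n \<xi>)) \<longlonglongrightarrow> ennreal ((cmod (fourier1 g \<xi>))\<^sup>2)"
      by simp
  qed (simp add: w_def)
  moreover have "(\<integral>\<^sup>+ \<xi>. ennreal ((cmod (fourier1 g \<xi>))\<^sup>2 * w n \<xi>) \<partial>lborel)
    = ennreal (2 * pi * (LBINT v. std_normal_density v * Re (autocorr g (1 / real (Suc n) * v))))" for n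
  proof -
    have "integrable lborel (\<lambda>\<xi>. (cmod (fourier1 g \<xi>))\<^sup>2 * w n \<xi>)"
    proof (rule Bochner_Integration.integrable_bound)
      show "integrable lborel (\<lambda>\<xi>. (LBINT x. cmod (g x))\<^sup>2 * w n \<xi>)"
        unfolding w_def by (intro integrable_mult_right gaussian_integrable) auto
      show "AE \<xi> in lborel. norm ((cmod (fourier1 g \<xi>))\<^sup>2 * w n \<xi>) \<le> norm ((LBINT x. cmod (g x))\<^sup>2 * w n \<xi>)"
        using norm_fourier1_le[of g] by (auto simp: w_def intro!: mult_right_mono power_mono)
    qed (simp add: w_def)
    then have "(\<integral>\<^sup>+ \<xi>. ennreal ((cmod (fourier1 g \<xi>))\<^sup>2 * w n \<xi>) \<partial>lborel)
        = ennreal (LBINT \<xi>. (cmod (fourier1 g \<xi>))\<^sup>2 * w n \<xi>)"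
      by (intro nn_integral_eq_integral) (auto simp: w_def)
    then show ?thesis unfolding w_def by (simp only: gaussian_parseval of_nat_0_less_iff zero_less_Suc zero_less_divide_1_iff)
  qed
  ultimately show ?thesis by simp
qed

lemma nn_integral_square_eq:
  "(\<integral>\<^sup>+ x. ennreal ((cmod (g x))\<^sup>2) \<partial>lborel) = ennreal (LBINT x. (cmod (g x))\<^sup>2)"
  by (rule nn_integral_eq_integral[OF integrable_square]) auto

text \<open>
  The autocorrelation never exceeds its value at \<open>0\<close>. This form serves functions with jumps, such as a
  half-plane integral cut off to an interval.
\<close>

theorem bessel_fourier1:
  "(\<integral>\<^sup>+ \<xi>. ennreal ((cmod (fourier1 g \<xi>))\<^sup>2) \<partial>lborel)
     \<le> ennreal (2 * pi) * (\<integral>\<^sup>+ x. ennreal ((cmod (g x))\<^sup>2) \<partial>lborel)"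
proof (rule LIMSEQ_le_const2[OF gaussian_parseval_limit], intro exI allI impI)
  fix n
  let ?K = "LBINT x. (cmod (g x))\<^sup>2"
  have "(LBINT v. std_normal_density v * Re (autocorr g (1 / real (Suc n) * v)))
     \<le> (LBINT v. std_normal_density v * ?K)"
  proof (rule integral_mono')
    fix v show "std_normal_density v * Re (autocorr g (1 / real (Suc n) * v)) \<le> std_normal_density v * ?K"
      by (intro mult_left_mono order_trans[OF complex_Re_le_cmod autocorr_bound]) auto
  qed auto
  also have "\<dots> = ?K" by simp
  finally show "ennreal (2 * pi * (LBINT v. std_normal_density v * Re (autocorr g (1 / real (Suc n) * v))))
     \<le> ennreal (2 * pi) * (\<integral>\<^sup>+ x. ennreal ((cmod (g x))\<^sup>2) \<partial>lborel)"
    unfolding nn_integral_square_eq by (subst ennreal_mult'[symmetric]) (auto intro!: ennreal_leI)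
qed

text \<open>
  For continuous \<open>g\<close> the autocorrelation is continuous at \<open>0\<close>, so its gaussian averages converge to the value there.
\<close>

theorem plancherel_fourier1:
  assumes cont: "continuous_on UNIV g"
  shows "(\<integral>\<^sup>+ \<xi>. ennreal ((cmod (fourier1 g \<xi>))\<^sup>2) \<partial>lborel)
     = ennreal (2 * pi) * (\<integral>\<^sup>+ x. ennreal ((cmod (g x))\<^sup>2) \<partial>lborel)"
proof -
  let ?K = "LBINT x. (cmod (g x))\<^sup>2"
  have isc: "isCont g x" for x using cont by (simp add: continuous_on_eq_continuous_at)
  have scale: "(\<lambda>n. 1 / real (Suc n) * v) \<longlonglongrightarrow> 0" for v
    using tendsto_mult[OF LIMSEQ_inverse_real_of_nat tendsto_const[of v]]
    by (simp add: inverse_eq_divide)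
  have A0: "autocorr g 0 = of_real ?K"
    unfolding autocorr_def integral_complex_of_real[symmetric]
    by (intro Bochner_Integration.integral_cong) (auto simp flip: complex_norm_square)
  have lim_A: "(\<lambda>n. autocorr g (1 / real (Suc n) * v)) \<longlonglongrightarrow> of_real ?K" for v
    unfolding A0[symmetric] autocorr_def
  proof (rule integral_dominated_convergence[where w = "\<lambda>x. B * cmod (g x)"])
    show "AE x in lborel. (\<lambda>n. g x * cnj (g (x - 1 / real (Suc n) * v))) \<longlonglongrightarrow> g x * cnj (g (x - 0))"
    proof (rule AE_I2)
      fix x
      have "(\<lambda>n. x - 1 / real (Suc n) * v) \<longlonglongrightarrow> x - 0" by (intro tendsto_intros scale)
      from isCont_tendsto_compose[OF isc this]
      show "(\<lambda>n. g x * cnj (g (x - 1 / real (Suc n) * v))) \<longlonglongrightarrow> g x * cnj (g (x - 0))"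
        by (intro tendsto_mult tendsto_const tendsto_cnj)
    qed
    show "AE x in lborel. norm (g x * cnj (g (x - 1 / real (Suc n) * v))) \<le> B * cmod (g x)" for n
      using bd by (auto simp only: norm_mult complex_mod_cnj mult.commute[of B] intro!: AE_I2 mult_left_mono norm_ge_zero)
  qed (use int_g in auto)
  have "(\<lambda>n. LBINT v. std_normal_density v * Re (autocorr g (1 / real (Suc n) * v)))
     \<longlonglongrightarrow> (LBINT v. std_normal_density v * Re (of_real ?K))"
  proof (rule integral_dominated_convergence[where w = "\<lambda>v. std_normal_density v * ?K"])
    show "AE v in lborel. (\<lambda>n. std_normal_density v * Re (autocorr g (1 / real (Suc n) * v)))
       \<longlonglongrightarrow> std_normal_density v * Re (of_real ?K)"
      by (intro AE_I2 tendsto_intros lim_A)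
    show "AE v in lborel. norm (std_normal_density v * Re (autocorr g (1 / real (Suc n) * v)))
       \<le> std_normal_density v * ?K" for n
      by (intro AE_I2) (auto simp: abs_mult intro!: mult_left_mono order_trans[OF abs_Re_le_cmod autocorr_bound])
  qed auto
  then have "(\<lambda>n. ennreal (2 * pi * (LBINT v. std_normal_density v * Re (autocorr g (1 / real (Suc n) * v)))))
     \<longlonglongrightarrow> ennreal (2 * pi * ?K)"
    by (intro tendsto_ennrealI tendsto_intros) simp
  from LIMSEQ_unique[OF gaussian_parseval_limit this] show ?thesis
    unfolding nn_integral_square_eq by (subst ennreal_mult'[symmetric]) auto
qed

end

section \<open>Plancherel's theorem on the plane\<close>

lemma continuous_compact_support:
  fixes f :: "'a::euclidean_space \<Rightarrow> 'b::{banach, second_countable_topology}"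
  assumes cont: "continuous_on UNIV f" and supp: "\<And>x. f x \<noteq> 0 \<Longrightarrow> norm x \<le> R"
  shows "integrable lborel f" and "\<exists>B. \<forall>x. norm (f x) \<le> B"
proof -
  have "integrable lborel (\<lambda>x. indicator (cball 0 R) x *\<^sub>R f x)"
    by (rule borel_integrable_compact) (auto intro: continuous_on_subset[OF cont])
  also have "(\<lambda>x. indicator (cball 0 R) x *\<^sub>R f x) = f"
    using supp by (auto simp: indicator_def fun_eq_iff)
  finally show "integrable lborel f" .
  have "compact (f ` cball 0 R)"
    by (rule compact_continuous_image) (auto intro: continuous_on_subset[OF cont])
  then obtain B where B: "\<And>y. y \<in> f ` cball 0 R \<Longrightarrow> norm y \<le> B"
    using compact_imp_bounded bounded_iff by metis
  have "norm (f x) \<le> max B 0" for x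
    using B[of "f x"] supp[of x] by (cases "f x = 0") (auto simp: le_max_iff_disj)
  then show "\<exists>B. \<forall>x. norm (f x) \<le> B" by blast
qed

lemma cmod_iexp_minus [simp]: "cmod (exp (- (\<i> * complex_of_real x))) = 1"
  by (metis norm_exp_i_times mult_minus_right of_real_minus)

lemma fourier2_measurable [measurable]:
  assumes [measurable]: "f \<in> borel_measurable borel"
  shows "fourier2 f \<in> borel_measurable borel"
proof -
  have [measurable]: "f \<in> borel_measurable (borel \<Otimes>\<^sub>M borel)" by (simp add: borel_prod)
  have "(\<lambda>\<xi>. LINT x|lborel. complex_of_real (f x) * exp (- (\<i> * complex_of_real (x \<bullet> \<xi>)))) \<in> borel_measurable borel"
    by measurable
  then show ?thesis unfolding fourier2_def[abs_def] by measurable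
qed

abbreviation power_spectrum :: "(real \<times> real \<Rightarrow> real) \<Rightarrow> real \<times> real \<Rightarrow> ennreal" where
  "power_spectrum f \<xi> \<equiv> ennreal ((cmod (fourier2 f \<xi>))\<^sup>2)"

abbreviation L2_energy :: "(real \<times> real \<Rightarrow> real) \<Rightarrow> ennreal" where
  "L2_energy f \<equiv> \<integral>\<^sup>+ x. ennreal ((f x)\<^sup>2) \<partial>lborel"

abbreviation sobolev_energy :: "real \<Rightarrow> (real \<times> real \<Rightarrow> real) \<Rightarrow> ennreal" where
  "sobolev_energy \<beta> f \<equiv> \<integral>\<^sup>+ \<xi>. ennreal ((1 + (norm \<xi>)\<^sup>2) powr \<beta> * (cmod (fourier2 f \<xi>))\<^sup>2) \<partial>lborel"

text \<open>
  The planar transform is an iterated transform on the line. The partial transform \<open>G\<close> in the first variable is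
  complex valued, continuous and compactly supported in the second one, so the theorem on the line applies to it;
  by Tonelli it then applies again in the first variable.
\<close>

theorem plancherel_fourier2:
  fixes f :: "real \<times> real \<Rightarrow> real"
  assumes cont: "continuous_on UNIV f" and supp: "\<And>x. f x \<noteq> 0 \<Longrightarrow> norm x \<le> R"
  shows "(\<integral>\<^sup>+ \<xi>. power_spectrum f \<xi> \<partial>lborel) = L2_energy f"
proof -
  note int_f = continuous_compact_support(1)[OF assms]
  obtain B where B: "\<And>x. \<bar>f x\<bar> \<le> B"
    using continuous_compact_support(2)[OF assms] by (auto simp: real_norm_def)
  have meas [measurable]: "f \<in> borel_measurable borel" using int_f by simp
  have measp [measurable]: "f \<in> borel_measurable (borel \<Otimes>\<^sub>M borel)" by (simp add: borel_prod)
  have cont_section: "continuous_on UNIV (\<lambda>x. complex_of_real (f (x, y)))" "continuous_on UNIV (\<lambda>y. f (x, y))" for x y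
    by (intro continuous_intros continuous_on_compose2[OF cont]; simp)+
  have suppx: "\<bar>x\<bar> \<le> R" "\<bar>y\<bar> \<le> R" if "f (x, y) \<noteq> 0" for x y
    using supp[OF that] norm_fst_le[of x y] norm_snd_le[of y x] by auto
  define G where "G \<xi>1 y = fourier1 (\<lambda>x. complex_of_real (f (x, y))) \<xi>1" for \<xi>1 y
  have G_meas [measurable]: "(\<lambda>(\<xi>1, y). G \<xi>1 y) \<in> borel_measurable (borel \<Otimes>\<^sub>M borel)"
    unfolding G_def fourier1_def by measurable
  have int_section: "integrable lborel (\<lambda>x. complex_of_real (f (x, y)))" for y
    by (rule continuous_compact_support(1)[OF cont_section(1), of _ R]) (use suppx in auto)
  have bd_section: "cmod (complex_of_real (f (x, y))) \<le> B" for x y using B by simp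
  have G_cont: "continuous_on UNIV (G \<xi>1)" for \<xi>1
    unfolding continuous_on_sequentially G_def fourier1_def o_def
  proof (intro ballI allI impI, elim conjE)
    fix y :: real and s assume s: "s \<longlonglongrightarrow> y"
    show "(\<lambda>n. CLBINT x. complex_of_real (f (x, s n)) * iexp (- (\<xi>1 * x)))
       \<longlonglongrightarrow> (CLBINT x. complex_of_real (f (x, y)) * iexp (- (\<xi>1 * x)))"
    proof (rule integral_dominated_convergence[where w = "\<lambda>x. B * indicator {-R..R} x"])
      show "AE x in lborel. (\<lambda>n. complex_of_real (f (x, s n)) * iexp (- (\<xi>1 * x)))
         \<longlonglongrightarrow> complex_of_real (f (x, y)) * iexp (- (\<xi>1 * x))"
      proof (rule AE_I2)
        fix x
        have "(\<lambda>n. f (x, s n)) \<longlonglongrightarrow> f (x, y)"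
          using continuous_on_tendsto_compose[OF cont_section(2) s] by simp
        then show "(\<lambda>n. complex_of_real (f (x, s n)) * iexp (- (\<xi>1 * x)))
         \<longlonglongrightarrow> complex_of_real (f (x, y)) * iexp (- (\<xi>1 * x))"
          by (intro tendsto_mult tendsto_const tendsto_of_real)
      qed
      show "AE x in lborel. norm (complex_of_real (f (x, s n)) * iexp (- (\<xi>1 * x))) \<le> B * indicator {-R..R} x" for n
      proof (rule AE_I2)
        fix x show "norm (complex_of_real (f (x, s n)) * iexp (- (\<xi>1 * x))) \<le> B * indicator {-R..R} x"
          using B[of "(x, s n)"] suppx(1)[of x "s n"]
          by (cases "f (x, s n) = 0") (auto simp: norm_mult indicator_def)
      qed
      show "integrable lborel (\<lambda>x. B * indicator {-R..R} x)"
        by (intro integrable_mult_right integrable_real_indicator) (auto intro: emeasure_lborel_Icc_eq[THEN ord_eq_less_trans])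
    qed measurable
  qed
  have G_supp: "\<bar>y\<bar> \<le> R" if "G \<xi>1 y \<noteq> 0" for \<xi>1 y
  proof (rule ccontr)
    assume "\<not> \<bar>y\<bar> \<le> R"
    then have "f (x, y) = 0" for x using suppx by blast
    then show False using that by (simp add: G_def fourier1_def)
  qed
  have pair: "integrable (lborel \<Otimes>\<^sub>M lborel) (\<lambda>(x, y). complex_of_real (f (x, y)) * exp (- (\<i> * complex_of_real ((x, y) \<bullet> \<xi>))))" for \<xi>
  proof -
    have "integrable lborel (\<lambda>x. complex_of_real (f x) * exp (- (\<i> * complex_of_real (x \<bullet> \<xi>))))"
      by (rule Bochner_Integration.integrable_bound[OF int_f]) (auto simp: norm_mult)
    then show ?thesis unfolding lborel_prod by (simp only: case_prod_unfold prod.collapse)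
  qed
  have iter: "fourier1 (G \<xi>1) \<xi>2 = of_real (2 * pi) * fourier2 f (\<xi>1, \<xi>2)" for \<xi>1 \<xi>2
  proof -
    have "of_real (2 * pi) * fourier2 f (\<xi>1, \<xi>2)
       = (CLINT x|lborel. complex_of_real (f x) * exp (- (\<i> * complex_of_real (x \<bullet> (\<xi>1, \<xi>2)))))"
      unfolding fourier2_def mult.assoc[symmetric] of_real_mult[symmetric] by simp
    also have "\<dots> = (CLBINT y. CLBINT x. complex_of_real (f (x, y)) * exp (- (\<i> * complex_of_real ((x, y) \<bullet> (\<xi>1, \<xi>2)))))"
      using lborel_pair.integral_snd[OF pair[of "(\<xi>1, \<xi>2)"]]
      by (simp only: lborel_prod case_prod_unfold prod.collapse)
    also have "\<dots> = (CLBINT y. CLBINT x. complex_of_real (f (x, y)) * iexp (- (\<xi>1 * x)) * iexp (- (\<xi>2 * y)))"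
      by (intro Bochner_Integration.integral_cong refl)
        (simp add: mult.assoc exp_add[symmetric] algebra_simps)
    also have "\<dots> = fourier1 (G \<xi>1) \<xi>2"
      unfolding fourier1_def G_def by simp
    finally show ?thesis by simp
  qed
  have f2p [measurable]: "fourier2 f \<in> borel_measurable (borel \<Otimes>\<^sub>M borel)" unfolding borel_prod by measurable
  have "ennreal ((2 * pi)\<^sup>2) * (\<integral>\<^sup>+ \<xi>. power_spectrum f \<xi> \<partial>lborel)
     = (\<integral>\<^sup>+ \<xi>. ennreal ((2 * pi)\<^sup>2) * power_spectrum f \<xi> \<partial>lborel)"
    by (rule nn_integral_cmult[symmetric]) measurable
  also have "\<dots> = (\<integral>\<^sup>+ \<xi>1. \<integral>\<^sup>+ \<xi>2. ennreal ((2 * pi)\<^sup>2) * power_spectrum f (\<xi>1, \<xi>2) \<partial>lborel \<partial>lborel)"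
    by (subst lborel_prod[symmetric], subst lborel.nn_integral_fst[symmetric]) auto
  also have "\<dots> = (\<integral>\<^sup>+ \<xi>1. \<integral>\<^sup>+ \<xi>2. ennreal ((cmod (fourier1 (G \<xi>1) \<xi>2))\<^sup>2) \<partial>lborel \<partial>lborel)"
    unfolding iter by (simp add: norm_mult power_mult_distrib ennreal_mult[symmetric])
  also have "\<dots> = (\<integral>\<^sup>+ \<xi>1. ennreal (2 * pi) * (\<integral>\<^sup>+ y. ennreal ((cmod (G \<xi>1 y))\<^sup>2) \<partial>lborel) \<partial>lborel)"
  proof (rule nn_integral_cong)
    fix \<xi>1
    obtain B' where B': "\<And>y. cmod (G \<xi>1 y) \<le> B'"
      using continuous_compact_support(2)[OF G_cont, of \<xi>1 R] G_supp by (auto simp: real_norm_def)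
    show "(\<integral>\<^sup>+ \<xi>2. ennreal ((cmod (fourier1 (G \<xi>1) \<xi>2))\<^sup>2) \<partial>lborel)
        = ennreal (2 * pi) * (\<integral>\<^sup>+ y. ennreal ((cmod (G \<xi>1 y))\<^sup>2) \<partial>lborel)"
      by (rule plancherel_fourier1[OF _ B' G_cont], rule continuous_compact_support(1)[OF G_cont, of _ R])
        (use G_supp in auto)
  qed
  also have "\<dots> = ennreal (2 * pi) * (\<integral>\<^sup>+ \<xi>1. \<integral>\<^sup>+ y. ennreal ((cmod (G \<xi>1 y))\<^sup>2) \<partial>lborel \<partial>lborel)"
    by (rule nn_integral_cmult) measurable
  also have "(\<integral>\<^sup>+ \<xi>1. \<integral>\<^sup>+ y. ennreal ((cmod (G \<xi>1 y))\<^sup>2) \<partial>lborel \<partial>lborel)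
      = (\<integral>\<^sup>+ y. \<integral>\<^sup>+ \<xi>1. ennreal ((cmod (G \<xi>1 y))\<^sup>2) \<partial>lborel \<partial>lborel)"
    by (rule lborel_pair.Fubini'[symmetric]) measurable
  also have "\<dots> = (\<integral>\<^sup>+ y. ennreal (2 * pi) * (\<integral>\<^sup>+ x. ennreal ((f (x, y))\<^sup>2) \<partial>lborel) \<partial>lborel)"
    unfolding G_def plancherel_fourier1[OF int_section bd_section cont_section(1)] by simp
  also have "\<dots> = ennreal (2 * pi) * (\<integral>\<^sup>+ y. \<integral>\<^sup>+ x. ennreal ((f (x, y))\<^sup>2) \<partial>lborel \<partial>lborel)"
    by (rule nn_integral_cmult) measurable
  also have "(\<integral>\<^sup>+ y. \<integral>\<^sup>+ x. ennreal ((f (x, y))\<^sup>2) \<partial>lborel \<partial>lborel) = L2_energy f"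
    using lborel_pair.nn_integral_snd[of "\<lambda>x. ennreal ((f x)\<^sup>2)"] by (simp add: lborel_prod)
  also have "ennreal (2 * pi) * (ennreal (2 * pi) * L2_energy f)
      = ennreal ((2 * pi)\<^sup>2) * L2_energy f"
    by (simp add: mult.assoc[symmetric] ennreal_mult[symmetric] power2_eq_square)
  finally show ?thesis by (simp add: ennreal_mult_cancel_left)
qed

section \<open>The integrated modulus of continuity\<close>

lemma integral_lborel_translation:
  fixes f :: "'a::euclidean_space \<Rightarrow> 'b::{banach, second_countable_topology}"
  assumes [measurable]: "f \<in> borel_measurable borel"
  shows "(LINT x|lborel. f (x + h)) = (LINT x|lborel. f x)"
proof -
  have "(LINT x|lborel. f x) = (LINT x|distr lborel borel ((+) h). f x)" by (simp add: lborel_distr_plus)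
  also have "\<dots> = (LINT x|lborel. f (h + x))" by (rule integral_distr) auto
  finally show ?thesis by (simp add: add.commute)
qed

lemma nn_integral_lborel_translation:
  fixes f :: "'a::euclidean_space \<Rightarrow> ennreal"
  assumes [measurable]: "f \<in> borel_measurable borel"
  shows "(\<integral>\<^sup>+ x. f (x + h) \<partial>lborel) = (\<integral>\<^sup>+ x. f x \<partial>lborel)"
proof -
  have "(\<integral>\<^sup>+ x. f x \<partial>lborel) = (\<integral>\<^sup>+ x. f x \<partial>distr lborel borel ((+) h))" by (simp add: lborel_distr_plus)
  also have "\<dots> = (\<integral>\<^sup>+ x. f (h + x) \<partial>lborel)" by (rule nn_integral_distr) auto
  finally show ?thesis by (simp add: add.commute)
qed

lemma cmod_iexp_diff_1: "(cmod (iexp \<theta> - 1))\<^sup>2 = 2 - 2 * cos \<theta>"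
proof -
  have "(cmod (iexp \<theta> - 1))\<^sup>2 = (cos \<theta> - 1)\<^sup>2 + (sin \<theta>)\<^sup>2"
    by (simp add: cmod_power2 Re_exp Im_exp)
  also have "\<dots> = 2 - 2 * cos \<theta>"
    using sin_cos_squared_add[of \<theta>] by (simp add: power2_diff)
  finally show ?thesis .
qed

lemma emeasure_square:
  assumes "t \<ge> 0"
  shows "emeasure lborel ({-t..t} \<times> {-t..t::real}) = ennreal (4 * t\<^sup>2)"
proof -
  have "emeasure lborel ({-t..t} \<times> {-t..t::real}) = emeasure (lborel \<Otimes>\<^sub>M lborel) ({-t..t} \<times> {-t..t})"
    by (simp add: lborel_prod)
  also have "\<dots> = ennreal (4 * t\<^sup>2)"
    using assms by (subst lborel.emeasure_pair_measure_Times) (auto simp: ennreal_mult[symmetric] power2_eq_square)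
  finally show ?thesis .
qed

lemma emeasure_norm_less:
  "emeasure lborel {h :: real \<times> real. norm h < t} \<le> ennreal (4 * t\<^sup>2)"
proof (cases "t \<ge> 0")
  case True
  have "{h :: real \<times> real. norm h < t} \<subseteq> {-t..t} \<times> {-t..t}"
    using norm_fst_le norm_snd_le by (force simp: abs_le_iff real_norm_def dest: order_trans[OF _ less_imp_le])
  then have "emeasure lborel {h :: real \<times> real. norm h < t} \<le> emeasure lborel ({-t..t} \<times> {-t..t::real})"
    by (rule emeasure_mono) (metis borel_closed closed_Times closed_atLeastAtMost sets_lborel)
  then show ?thesis using emeasure_square[OF True] by simp
next
  case False
  then have "{h :: real \<times> real. norm h < t} = {}"
    using norm_ge_zero order_le_less_trans less_imp_le by blast
  then show ?thesis by (simp only: emeasure_empty zero_le)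
qed

text \<open>
  The mean over shifts \<open>|h| < t\<close> of \<open>\<integral>(f (x + h) - f x)\<^sup>2\<close>, up to the factor \<open>t\<^sup>2\<close>. The symmetric form with two
  points, in contrast to the norm of a single difference, is compatible with changes of variables.
\<close>

definition modulus2 :: "(real \<times> real \<Rightarrow> real) \<Rightarrow> real \<Rightarrow> ennreal" where
  "modulus2 f t = (\<integral>\<^sup>+ y. \<integral>\<^sup>+ x. indicator {h. norm h < t} (x - y) * ennreal ((f x - f y)\<^sup>2) \<partial>lborel \<partial>lborel)"

lemma one_minus_cos_le_powr:
  fixes \<beta> \<theta> :: real
  assumes "0 < \<beta>" "\<beta> < 1"
  shows "2 - 2 * cos \<theta> \<le> 4 * \<bar>\<theta>\<bar> powr (2 * \<beta>)"
proof (cases "\<bar>\<theta>\<bar> \<le> 1")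
  case True
  have "2 - 2 * cos \<theta> = 4 * (sin (\<theta> / 2))\<^sup>2"
    using cos_double_sin[of "\<theta> / 2"] by simp
  also have "\<dots> \<le> 4 * (\<theta> / 2)\<^sup>2"
    using abs_sin_x_le_abs_x[of "\<theta> / 2"] by (simp only: abs_le_square_iff)
  also have "\<dots> = \<bar>\<theta>\<bar> powr 2"
    by (cases "\<theta> = 0") (auto simp: powr_numeral power2_eq_square)
  also have "\<dots> \<le> \<bar>\<theta>\<bar> powr (2 * \<beta>)"
    using True assms by (intro powr_mono') auto
  also have "\<dots> \<le> 4 * \<bar>\<theta>\<bar> powr (2 * \<beta>)" by simp
  finally show ?thesis .
next
  case False
  then have "1 \<le> \<bar>\<theta>\<bar> powr (2 * \<beta>)" using assms by (intro ge_one_powr_ge_zero) auto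
  then show ?thesis using cos_ge_minus_one[of \<theta>] by linarith
qed

text \<open>
  The multiplier \<open>2 - 2 cos (h \<bullet> \<xi>)\<close> of a difference vanishes for some \<open>h\<close>, but not on average: over an interval of
  length \<open>2 t\<close> a cosine of frequency \<open>k\<close> integrates to at most \<open>2 / |k|\<close>, which is half of the length once \<open>|k|\<close> reaches
  \<open>2 / t\<close>. Only the coordinate in which \<open>\<xi>\<close> is large is averaged.
\<close>

lemma square_mean_one_minus_cos:
  fixes \<xi> :: "real \<times> real"
  assumes t: "t > 0" and high: "\<bar>fst \<xi>\<bar> \<ge> 2 / t \<or> \<bar>snd \<xi>\<bar> \<ge> 2 / t"
  shows "ennreal (4 * t\<^sup>2) \<le> (\<integral>\<^sup>+ h. indicator ({-t..t} \<times> {-t..t}) h * ennreal (2 - 2 * cos (h \<bullet> \<xi>)) \<partial>lborel)"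
proof -
  have inner: "ennreal (2 * t) \<le> (\<integral>\<^sup>+ x. ennreal (2 - 2 * cos (x * k + c)) * indicator {-t..t} x \<partial>lborel)"
    if k: "\<bar>k\<bar> \<ge> 2 / t" for k c :: real
  proof -
    have k0: "k \<noteq> 0" using k t by (auto simp: field_simps)
    let ?F = "\<lambda>x. 2 * x - 2 * sin (x * k + c) / k"
    have "2 / \<bar>k\<bar> \<le> t" using k t k0 by (simp add: field_simps)
    moreover have "\<bar>2 * sin (x * k + c) / k\<bar> \<le> 2 / \<bar>k\<bar>" for x
      using abs_sin_le_one[of "x * k + c"] by (auto simp: abs_mult intro!: divide_right_mono)
    ultimately have sb: "\<bar>2 * sin (x * k + c) / k\<bar> \<le> t" for x by (meson order_trans)
    have "2 * t \<le> ?F t - ?F (- t)" using sb[of t] sb[of "-t"] by linarith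
    then have "ennreal (2 * t) \<le> ennreal (?F t - ?F (- t))" by (rule ennreal_leI)
    also have "\<dots> = (\<integral>\<^sup>+ x. ennreal (2 - 2 * cos (x * k + c)) * indicator {-t..t} x \<partial>lborel)"
      using t k0 by (intro nn_integral_FTC_Icc[symmetric]) (auto intro!: derivative_eq_intros)
    finally show ?thesis .
  qed
  have outer: "ennreal (4 * t\<^sup>2) \<le> (\<integral>\<^sup>+ y. indicator {-t..t} y * (\<integral>\<^sup>+ x. ennreal (2 - 2 * cos (x * k + y * l)) * indicator {-t..t} x \<partial>lborel) \<partial>lborel)"
    if k: "\<bar>k\<bar> \<ge> 2 / t" for k l :: real
  proof -
    have "ennreal (4 * t\<^sup>2) = (\<integral>\<^sup>+ y. ennreal (2 * t) * indicator {-t..t} y \<partial>lborel)"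
      using t by (subst nn_integral_cmult_indicator) (auto simp: ennreal_mult[symmetric] power2_eq_square)
    also have "\<dots> \<le> (\<integral>\<^sup>+ y. indicator {-t..t} y * (\<integral>\<^sup>+ x. ennreal (2 - 2 * cos (x * k + y * l)) * indicator {-t..t} x \<partial>lborel) \<partial>lborel)"
    proof (intro nn_integral_mono)
      fix y :: real
      show "ennreal (2 * t) * indicator {-t..t} y
        \<le> indicator {-t..t} y * (\<integral>\<^sup>+ x. ennreal (2 - 2 * cos (x * k + y * l)) * indicator {-t..t} x \<partial>lborel)"
        by (cases "y \<in> {-t..t}") (simp_all add: inner[OF k])
    qed
    finally show ?thesis .
  qed
  let ?f = "\<lambda>h. indicator ({-t..t} \<times> {-t..t}) h * ennreal (2 - 2 * cos (h \<bullet> \<xi>))"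
  have [measurable]: "{-t..t} \<times> {-t..t} \<in> sets (borel :: (real \<times> real) measure)"
    by (intro borel_closed closed_Times closed_atLeastAtMost)
  have "?f \<in> borel_measurable borel" by measurable
  then have [measurable]: "?f \<in> borel_measurable (lborel \<Otimes>\<^sub>M lborel)" by (simp add: lborel_prod)
  show ?thesis using high
  proof
    assume k: "\<bar>fst \<xi>\<bar> \<ge> 2 / t"
    have "(\<integral>\<^sup>+ h. ?f h \<partial>lborel) = (\<integral>\<^sup>+ y. \<integral>\<^sup>+ x. ?f (x, y) \<partial>lborel \<partial>lborel)"
      by (subst lborel_pair.nn_integral_snd) (auto simp: lborel_prod[symmetric])
    also have "\<dots> = (\<integral>\<^sup>+ y. indicator {-t..t} y * (\<integral>\<^sup>+ x. ennreal (2 - 2 * cos (x * fst \<xi> + y * snd \<xi>)) * indicator {-t..t} x \<partial>lborel) \<partial>lborel)"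
      by (subst nn_integral_cmult[symmetric]) (auto simp: indicator_times inner_prod_def mult_ac)
    finally show ?thesis using outer[OF k] by simp
  next
    assume k: "\<bar>snd \<xi>\<bar> \<ge> 2 / t"
    have "(\<integral>\<^sup>+ h. ?f h \<partial>lborel) = (\<integral>\<^sup>+ y. \<integral>\<^sup>+ x. ?f (y, x) \<partial>lborel \<partial>lborel)"
      by (subst lborel.nn_integral_fst) (auto simp: lborel_prod[symmetric])
    also have "\<dots> = (\<integral>\<^sup>+ y. indicator {-t..t} y * (\<integral>\<^sup>+ x. ennreal (2 - 2 * cos (x * snd \<xi> + y * fst \<xi>)) * indicator {-t..t} x \<partial>lborel) \<partial>lborel)"
      by (subst nn_integral_cmult[symmetric]) (auto simp: indicator_times inner_prod_def mult_ac add_ac)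
    finally show ?thesis using outer[OF k] by simp
  qed
qed

locale compactly_supported =
  fixes f :: "real \<times> real \<Rightarrow> real" and R :: real
  assumes cont: "continuous_on UNIV f" and supp: "\<And>x. f x \<noteq> 0 \<Longrightarrow> norm x \<le> R"
begin

lemma f_meas [measurable]: "f \<in> borel_measurable borel"
  using cont by (rule borel_measurable_continuous_onI)

lemma int_f: "integrable lborel f"
  by (rule continuous_compact_support(1)[OF cont supp])

lemma fourier2_difference:
  "fourier2 (\<lambda>x. f (x + h) - f x) \<xi> = (iexp (h \<bullet> \<xi>) - 1) * fourier2 f \<xi>"
proof -
  let ?e = "\<lambda>x. exp (- (\<i> * complex_of_real (x \<bullet> \<xi>)))"
  have int: "integrable lborel (\<lambda>x. complex_of_real (f x) * ?e x)"
    by (rule Bochner_Integration.integrable_bound[OF int_f]) (auto simp: norm_mult)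
  have eq: "complex_of_real (f (x + h)) * ?e x = iexp (h \<bullet> \<xi>) * (complex_of_real (f (x + h)) * ?e (x + h))" for x
  proof -
    have "?e x = iexp (h \<bullet> \<xi>) * ?e (x + h)"
      by (simp add: exp_add[symmetric] inner_add_left algebra_simps)
    then show ?thesis by simp
  qed
  have int_h: "integrable lborel (\<lambda>x. complex_of_real (f (x + h)) * ?e x)"
  proof -
    have "integrable lborel (\<lambda>x. f (x + h))"
    proof (rule continuous_compact_support(1))
      show "continuous_on UNIV (\<lambda>x. f (x + h))"
        by (intro continuous_on_compose2[OF cont] continuous_intros) auto
      show "norm x \<le> R + norm h" if "f (x + h) \<noteq> 0" for x
        using supp[OF that] norm_triangle_ineq4[of "x + h" h] by simp
    qed
    then show ?thesis
      by (rule Bochner_Integration.integrable_bound) (auto simp: norm_mult)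
  qed
  have "(LINT x|lborel. complex_of_real (f (x + h) - f x) * ?e x)
      = (LINT x|lborel. complex_of_real (f (x + h)) * ?e x) - (LINT x|lborel. complex_of_real (f x) * ?e x)"
    using int_h int by (simp add: left_diff_distrib)
  also have "(LINT x|lborel. complex_of_real (f (x + h)) * ?e x)
      = iexp (h \<bullet> \<xi>) * (LINT x|lborel. complex_of_real (f (x + h)) * ?e (x + h))"
    unfolding eq by simp
  also have "(LINT x|lborel. complex_of_real (f (x + h)) * ?e (x + h)) = (LINT x|lborel. complex_of_real (f x) * ?e x)"
    by (rule integral_lborel_translation) measurable
  finally show ?thesis unfolding fourier2_def by (simp add: algebra_simps)
qed

lemma plancherel_difference:
  "(\<integral>\<^sup>+ x. ennreal ((f (x + h) - f x)\<^sup>2) \<partial>lborel)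
     = (\<integral>\<^sup>+ \<xi>. ennreal (2 - 2 * cos (h \<bullet> \<xi>)) * power_spectrum f \<xi> \<partial>lborel)"
proof -
  have "(\<integral>\<^sup>+ x. ennreal ((f (x + h) - f x)\<^sup>2) \<partial>lborel)
     = (\<integral>\<^sup>+ \<xi>. ennreal ((cmod (fourier2 (\<lambda>x. f (x + h) - f x) \<xi>))\<^sup>2) \<partial>lborel)"
  proof (rule plancherel_fourier2[symmetric])
    show "continuous_on UNIV (\<lambda>x. f (x + h) - f x)"
      by (intro continuous_on_compose2[OF cont] continuous_intros) auto
    show "norm x \<le> \<bar>R\<bar> + norm h" if "f (x + h) - f x \<noteq> 0" for x
    proof -
      have "norm x \<le> R \<or> norm (x + h) \<le> R" using that supp[of x] supp[of "x + h"] by fastforce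
      moreover have "norm x \<le> norm (x + h) + norm h" using norm_triangle_ineq4[of "x + h" h] by simp
      ultimately show ?thesis using norm_ge_zero[of h] by linarith
    qed
  qed
  then show ?thesis
    unfolding fourier2_difference norm_mult power_mult_distrib cmod_iexp_diff_1
    by (simp add: ennreal_mult)
qed

lemma modulus2_eq:
  "modulus2 f t = (\<integral>\<^sup>+ h. indicator {h. norm h < t} h * (\<integral>\<^sup>+ x. ennreal ((f (x + h) - f x)\<^sup>2) \<partial>lborel) \<partial>lborel)"
proof -
  have [measurable]: "{h :: real \<times> real. norm h < t} \<in> sets borel" by measurable
  have "modulus2 f t = (\<integral>\<^sup>+ y. \<integral>\<^sup>+ h. indicator {h. norm h < t} h * ennreal ((f (h + y) - f y)\<^sup>2) \<partial>lborel \<partial>lborel)"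
    unfolding modulus2_def
  proof (rule nn_integral_cong)
    fix y
    show "(\<integral>\<^sup>+ x. indicator {h. norm h < t} (x - y) * ennreal ((f x - f y)\<^sup>2) \<partial>lborel)
        = (\<integral>\<^sup>+ h. indicator {h. norm h < t} h * ennreal ((f (h + y) - f y)\<^sup>2) \<partial>lborel)"
      by (subst nn_integral_lborel_translation[symmetric, where h = y]) auto
  qed
  also have "\<dots> = (\<integral>\<^sup>+ h. \<integral>\<^sup>+ y. indicator {h. norm h < t} h * ennreal ((f (h + y) - f y)\<^sup>2) \<partial>lborel \<partial>lborel)"
    by (rule lborel_pair.Fubini') measurable
  also have "\<dots> = (\<integral>\<^sup>+ h. indicator {h. norm h < t} h * (\<integral>\<^sup>+ x. ennreal ((f (x + h) - f x)\<^sup>2) \<partial>lborel) \<partial>lborel)"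
    by (simp add: nn_integral_cmult add.commute)
  finally show ?thesis .
qed

text \<open>
  In frequency space a difference with shift \<open>h\<close> multiplies the energy density by at most \<open>4 |h \<bullet> \<xi>|\<^bsup>2\<beta>\<^esup>\<close>, and the
  shifts fill a set of area at most \<open>4 t\<^sup>2\<close>.
\<close>

lemma modulus2_le_sobolev:
  assumes \<beta>: "0 < \<beta>" "\<beta> < 1" and t: "t > 0"
  shows "modulus2 f t \<le> ennreal (16 * t\<^sup>2 * t powr (2 * \<beta>)) *
           sobolev_energy \<beta> f"
proof -
  let ?S = "sobolev_energy \<beta> f"
  have [measurable]: "{h :: real \<times> real. norm h < t} \<in> sets borel" by measurable
  have ptw: "2 - 2 * cos (h \<bullet> \<xi>) \<le> 4 * t powr (2 * \<beta>) * (1 + (norm \<xi>)\<^sup>2) powr \<beta>" if "norm h < t" for h \<xi> :: "real \<times> real"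
  proof -
    have "\<bar>h \<bullet> \<xi>\<bar> \<le> t * norm \<xi>"
      using Cauchy_Schwarz_ineq2[of h \<xi>] that by (meson less_imp_le mult_right_mono norm_ge_zero order_trans)
    then have "\<bar>h \<bullet> \<xi>\<bar> powr (2 * \<beta>) \<le> (t * norm \<xi>) powr (2 * \<beta>)" using \<beta> by (intro powr_mono2) auto
    also have "\<dots> = t powr (2 * \<beta>) * ((norm \<xi>) powr 2) powr \<beta>"
      using t by (simp only: powr_mult powr_powr)
    also have "(norm \<xi>) powr 2 = (norm \<xi>)\<^sup>2" by (cases "\<xi> = 0") (auto simp: powr_numeral)
    also have "t powr (2 * \<beta>) * ((norm \<xi>)\<^sup>2) powr \<beta> \<le> t powr (2 * \<beta>) * (1 + (norm \<xi>)\<^sup>2) powr \<beta>"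
      using \<beta> by (intro mult_left_mono powr_mono2) auto
    finally show ?thesis using one_minus_cos_le_powr[OF \<beta>, of "h \<bullet> \<xi>"] by linarith
  qed
  have "modulus2 f t \<le> (\<integral>\<^sup>+ h. ennreal (4 * t powr (2 * \<beta>)) * ?S * indicator {h :: real \<times> real. norm h < t} h \<partial>lborel)"
    unfolding modulus2_eq
  proof (rule nn_integral_mono)
    fix h :: "real \<times> real"
    show "indicator {h. norm h < t} h * (\<integral>\<^sup>+ x. ennreal ((f (x + h) - f x)\<^sup>2) \<partial>lborel)
      \<le> ennreal (4 * t powr (2 * \<beta>)) * ?S * indicator {h. norm h < t} h"
    proof (cases "norm h < t")
      case True
      have "(\<integral>\<^sup>+ x. ennreal ((f (x + h) - f x)\<^sup>2) \<partial>lborel)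
         \<le> (\<integral>\<^sup>+ \<xi>. ennreal (4 * t powr (2 * \<beta>)) * ennreal ((1 + (norm \<xi>)\<^sup>2) powr \<beta> * (cmod (fourier2 f \<xi>))\<^sup>2) \<partial>lborel)"
        unfolding plancherel_difference
        by (intro nn_integral_mono)
          (use ptw[OF True] in \<open>auto simp: ennreal_mult[symmetric] mult.assoc[symmetric] intro!: ennreal_leI mult_right_mono\<close>)
      also have "\<dots> = ennreal (4 * t powr (2 * \<beta>)) * ?S" by (rule nn_integral_cmult) measurable
      finally show ?thesis using True by simp
    qed simp
  qed
  also have "\<dots> = ennreal (4 * t powr (2 * \<beta>)) * ?S * emeasure lborel {h :: real \<times> real. norm h < t}"
    by (rule nn_integral_cmult_indicator) simp
  also have "\<dots> \<le> ennreal (4 * t powr (2 * \<beta>)) * ?S * ennreal (4 * t\<^sup>2)"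
    by (intro mult_left_mono emeasure_norm_less) auto
  also have "\<dots> = ennreal (16 * t\<^sup>2 * t powr (2 * \<beta>)) * ?S"
  proof -
    have "ennreal (4 * t powr (2 * \<beta>)) * ennreal (4 * t\<^sup>2) = ennreal (16 * t\<^sup>2 * t powr (2 * \<beta>))"
      by (subst ennreal_mult[symmetric]) (simp_all add: mult_ac)
    moreover have "ennreal (4 * t powr (2 * \<beta>)) * ?S * ennreal (4 * t\<^sup>2) = ennreal (4 * t powr (2 * \<beta>)) * ennreal (4 * t\<^sup>2) * ?S"
      by (simp only: mult_ac)
    ultimately show ?thesis by (simp only:)
  qed
  finally show ?thesis .
qed

text \<open>
  The converse direction: averaged over a square of shifts, differences retain a fixed fraction of all high
  frequencies. The square has side \<open>2 t\<close>, hence the radius \<open>2 t > \<surd>2 t\<close> on the right.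
\<close>

lemma high_frequency_le_modulus2:
  assumes t: "t > 0"
  shows "ennreal (4 * t\<^sup>2) * (\<integral>\<^sup>+ \<xi>. indicator {\<xi>. \<bar>fst \<xi>\<bar> \<ge> 2 / t \<or> \<bar>snd \<xi>\<bar> \<ge> 2 / t} \<xi> * power_spectrum f \<xi> \<partial>lborel)
     \<le> modulus2 f (2 * t)"
proof -
  let ?H = "{\<xi> :: real \<times> real. \<bar>fst \<xi>\<bar> \<ge> 2 / t \<or> \<bar>snd \<xi>\<bar> \<ge> 2 / t}"
  let ?Q = "{-t..t} \<times> {-t..t}"
  have [measurable]: "?H \<in> sets borel" "?Q \<in> sets borel"
    "{h :: real \<times> real. norm h < 2 * t} \<in> sets borel"
    by (auto intro!: borel_closed closed_Times closed_Collect_disj closed_Collect_le continuous_intros)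
  have "ennreal (4 * t\<^sup>2) * (\<integral>\<^sup>+ \<xi>. indicator ?H \<xi> * power_spectrum f \<xi> \<partial>lborel)
     = (\<integral>\<^sup>+ \<xi>. ennreal (4 * t\<^sup>2) * (indicator ?H \<xi> * power_spectrum f \<xi>) \<partial>lborel)"
    by (rule nn_integral_cmult[symmetric]) measurable
  also have "\<dots> \<le> (\<integral>\<^sup>+ \<xi>. \<integral>\<^sup>+ h. indicator ?Q h * ennreal (2 - 2 * cos (h \<bullet> \<xi>)) * power_spectrum f \<xi> \<partial>lborel \<partial>lborel)"
  proof (rule nn_integral_mono)
    fix \<xi> :: "real \<times> real"
    have "ennreal (4 * t\<^sup>2) * indicator ?H \<xi> \<le> (\<integral>\<^sup>+ h. indicator ?Q h * ennreal (2 - 2 * cos (h \<bullet> \<xi>)) \<partial>lborel)"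
      using square_mean_one_minus_cos[OF t, of \<xi>] by (auto simp: indicator_def)
    then have "ennreal (4 * t\<^sup>2) * indicator ?H \<xi> * power_spectrum f \<xi>
      \<le> (\<integral>\<^sup>+ h. indicator ?Q h * ennreal (2 - 2 * cos (h \<bullet> \<xi>)) \<partial>lborel) * power_spectrum f \<xi>"
      by (rule mult_right_mono) simp
    then show "ennreal (4 * t\<^sup>2) * (indicator ?H \<xi> * power_spectrum f \<xi>)
      \<le> (\<integral>\<^sup>+ h. indicator ?Q h * ennreal (2 - 2 * cos (h \<bullet> \<xi>)) * power_spectrum f \<xi> \<partial>lborel)"
      by (subst nn_integral_multc) (auto simp: mult.assoc)
  qed
  also have "\<dots> = (\<integral>\<^sup>+ h. \<integral>\<^sup>+ \<xi>. indicator ?Q h * ennreal (2 - 2 * cos (h \<bullet> \<xi>)) * power_spectrum f \<xi> \<partial>lborel \<partial>lborel)"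
    by (rule lborel_pair.Fubini') measurable
  also have "\<dots> = (\<integral>\<^sup>+ h. indicator ?Q h * (\<integral>\<^sup>+ x. ennreal ((f (x + h) - f x)\<^sup>2) \<partial>lborel) \<partial>lborel)"
    unfolding plancherel_difference by (subst nn_integral_cmult[symmetric]) (auto simp: mult.assoc)
  also have "\<dots> \<le> modulus2 f (2 * t)"
    unfolding modulus2_eq
  proof (intro nn_integral_mono mult_right_mono)
    fix h :: "real \<times> real"
    show "indicator ?Q h \<le> (indicator {h. norm h < 2 * t} h :: ennreal)"
    proof (cases "h \<in> ?Q")
      case True
      obtain a b where h: "h = (a, b)" by (cases h)
      have "a\<^sup>2 \<le> t\<^sup>2" "b\<^sup>2 \<le> t\<^sup>2" using True h by (auto simp: abs_le_square_iff[symmetric])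
      moreover have "(2 * t)\<^sup>2 = 4 * t\<^sup>2" by (simp add: power_mult_distrib)
      ultimately have "a\<^sup>2 + b\<^sup>2 < (2 * t)\<^sup>2" using zero_less_power[OF t, of 2] by linarith
      then have "norm h < 2 * t" using t h by (simp add: norm_Pair real_less_lsqrt)
      then show ?thesis by (simp add: indicator_def)
    qed simp
  qed simp
  finally show ?thesis .
qed

end

section \<open>Finiteness of Sobolev norms of smooth functions\<close>

text \<open>
  A directional derivative is continuous with compact support, hence bounded, and the mean value theorem applies
  along lines.
\<close>

lemma smooth_directionally_lipschitz:
  fixes f :: "'a::euclidean_space \<Rightarrow> real"
  assumes sm: "smooth f" and supp: "\<And>x. f x \<noteq> 0 \<Longrightarrow> norm x \<le> R"
  shows "\<exists>L. \<forall>x s. \<bar>f (x + s *\<^sub>R v) - f x\<bar> \<le> L * \<bar>s\<bar>"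
proof -
  have "Ck 1 f" using sm by (simp add: smooth_def)
  then have diff: "\<And>x. f differentiable (at x)" and contD: "continuous_on UNIV (\<lambda>x. frechet_derivative f (at x) v)"
    by auto
  let ?D = "\<lambda>x. frechet_derivative f (at x) v"
  have D0: "?D x = 0" if "norm x > R" for x
  proof -
    let ?U = "{x :: 'a. norm x > R}"
    have "open ?U" by (intro open_Collect_less continuous_intros)
    moreover have "x \<in> ?U" using that by simp
    moreover have "0 = f y" if "y \<in> ?U" for y
    proof (rule ccontr)
      assume "0 \<noteq> f y"
      then have "norm y \<le> R" using supp[of y] by simp
      then show False using that by simp
    qed
    ultimately have "(f has_derivative (\<lambda>_. 0)) (at x)"
      by (rule has_derivative_transform_within_open[OF has_derivative_const])
    then have "frechet_derivative f (at x) = (\<lambda>_. 0)" by (rule frechet_derivative_at[symmetric])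
    then show ?thesis by simp
  qed
  have "norm x \<le> R" if "?D x \<noteq> 0" for x
    using D0[of x] that by fastforce
  from continuous_compact_support(2)[OF contD this] obtain L where L: "\<And>x. \<bar>?D x\<bar> \<le> L"
    by (auto simp: real_norm_def)
  have "\<bar>f (x + s *\<^sub>R v) - f x\<bar> \<le> L * \<bar>s\<bar>" for x s
  proof -
    let ?g = "\<lambda>t. f (x + t *\<^sub>R v)"
    have g: "(?g has_real_derivative ?D (x + t *\<^sub>R v)) (at t)" for t
    proof -
      have lin: "linear (frechet_derivative f (at (x + t *\<^sub>R v)))"
        using diff by (intro linear_frechet_derivative) auto
      have "(f has_derivative frechet_derivative f (at (x + t *\<^sub>R v))) (at (x + t *\<^sub>R v))"
        using diff frechet_derivative_works by blast
      moreover have "((\<lambda>t. x + t *\<^sub>R v) has_derivative (\<lambda>s. s *\<^sub>R v)) (at t)"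
        by (auto intro!: derivative_eq_intros)
      ultimately have "(?g has_derivative (\<lambda>s. frechet_derivative f (at (x + t *\<^sub>R v)) (s *\<^sub>R v))) (at t)"
        using has_derivative_compose[of "\<lambda>t. x + t *\<^sub>R v" "\<lambda>s. s *\<^sub>R v" t UNIV f] by simp
      moreover have "frechet_derivative f (at (x + t *\<^sub>R v)) (s *\<^sub>R v) = ?D (x + t *\<^sub>R v) * s" for s
        using linear_scale[OF lin, of s v] by simp
      ultimately show ?thesis by (simp add: has_field_derivative_def)
    qed
    have "norm (?g s - ?g 0) \<le> L * norm (s - 0)"
      by (rule field_differentiable_bound[where S = UNIV and f' = "\<lambda>t. ?D (x + t *\<^sub>R v)"])
        (use g L in \<open>auto intro: has_field_derivative_at_within\<close>)
    then show ?thesis by simp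
  qed
  then show ?thesis by blast
qed

context compactly_supported begin

text \<open>
  The difference quotients with step \<open>s\<close> have bounded energy because of the Lipschitz condition, and their multipliers
  \<open>(2 - 2 cos (s v \<bullet> \<xi>)) / s\<^sup>2\<close> converge to \<open>(v \<bullet> \<xi>)\<^sup>2\<close>; Fatou's lemma gives the claim without differentiating
  under the integral.
\<close>

lemma directional_energy_finite:
  assumes lip: "\<And>x s. \<bar>f (x + s *\<^sub>R v) - f x\<bar> \<le> L * \<bar>s\<bar>"
  shows "(\<integral>\<^sup>+ \<xi>. ennreal ((v \<bullet> \<xi>)\<^sup>2 * (cmod (fourier2 f \<xi>))\<^sup>2) \<partial>lborel) < \<infinity>"
proof -
  define s where "s n = 1 / real (Suc n)" for n
  have s: "0 < s n" "s n \<le> 1" for n by (auto simp: s_def)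
  have s_lim: "s \<longlonglongrightarrow> 0" unfolding s_def using LIMSEQ_inverse_real_of_nat by (simp add: inverse_eq_divide)
  define q where "q n \<xi> = (2 - 2 * cos ((s n *\<^sub>R v) \<bullet> \<xi>)) / (s n)\<^sup>2" for n and \<xi> :: "real \<times> real"
  have q_lim: "(\<lambda>n. q n \<xi>) \<longlonglongrightarrow> (v \<bullet> \<xi>)\<^sup>2" for \<xi>
  proof -
    let ?k = "v \<bullet> \<xi>"
    \<comment> \<open>by the half-angle formula, \<open>q n\<close> is four times the square of a difference quotient of this sine at \<open>0\<close>\<close>
    have "((\<lambda>x. sin (?k / 2 * x)) has_real_derivative ?k / 2) (at 0)"
      by (auto intro!: derivative_eq_intros)
    then have "((\<lambda>x. sin (?k / 2 * x) / x) \<longlongrightarrow> ?k / 2) (at 0)"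
      by (simp add: has_field_derivative_iff)
    moreover have "filterlim s (at 0) sequentially"
      using s_lim s(1) by (auto simp: filterlim_at intro!: always_eventually) (metis less_irrefl)
    ultimately have "(\<lambda>n. sin (?k / 2 * s n) / s n) \<longlonglongrightarrow> ?k / 2" by (rule filterlim_compose)
    then have "(\<lambda>n. 4 * (sin (?k / 2 * s n) / s n)\<^sup>2) \<longlonglongrightarrow> 4 * (?k / 2)\<^sup>2"
      by (intro tendsto_mult tendsto_const tendsto_power)
    moreover have "4 * (sin (?k / 2 * s n) / s n)\<^sup>2 = q n \<xi>" for n
      using cos_double_sin[of "?k / 2 * s n"] by (simp add: q_def power_divide mult.commute)
    ultimately show ?thesis by (simp add: power_divide)
  qed
  have q0: "q n \<xi> \<ge> 0" for n \<xi> by (simp add: q_def)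
  have q_meas [measurable]: "q n \<in> borel_measurable borel" for n
    unfolding q_def[abs_def] by measurable
  let ?B = "ennreal (L\<^sup>2) * emeasure lborel (cball (0 :: real \<times> real) (\<bar>R\<bar> + norm v))"
  have bound: "(\<integral>\<^sup>+ \<xi>. ennreal (q n \<xi> * (cmod (fourier2 f \<xi>))\<^sup>2) \<partial>lborel) \<le> ?B" for n
  proof -
    let ?h = "s n *\<^sub>R v"
    have s2: "(s n)\<^sup>2 > 0" using s(1)[of n] by simp
    have "(\<integral>\<^sup>+ \<xi>. ennreal (q n \<xi> * (cmod (fourier2 f \<xi>))\<^sup>2) \<partial>lborel)
       = (\<integral>\<^sup>+ \<xi>. ennreal (1 / (s n)\<^sup>2) * (ennreal (2 - 2 * cos (?h \<bullet> \<xi>)) * power_spectrum f \<xi>) \<partial>lborel)"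
      by (intro nn_integral_cong) (simp add: q_def ennreal_mult[symmetric])
    also have "\<dots> = ennreal (1 / (s n)\<^sup>2) * (\<integral>\<^sup>+ x. ennreal ((f (x + ?h) - f x)\<^sup>2) \<partial>lborel)"
      unfolding plancherel_difference by (rule nn_integral_cmult) measurable
    also have "\<dots> \<le> ennreal (1 / (s n)\<^sup>2) * (\<integral>\<^sup>+ x. ennreal (L\<^sup>2 * (s n)\<^sup>2) * indicator (cball (0 :: real \<times> real) (\<bar>R\<bar> + norm v)) x \<partial>lborel)"
    proof (intro mult_left_mono nn_integral_mono)
      fix x
      show "ennreal ((f (x + ?h) - f x)\<^sup>2) \<le> ennreal (L\<^sup>2 * (s n)\<^sup>2) * indicator (cball (0 :: real \<times> real) (\<bar>R\<bar> + norm v)) x"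
      proof (cases "f (x + ?h) = 0 \<and> f x = 0")
        case False
        have "norm ?h \<le> norm v" using s[of n] by (simp add: mult_left_le_one_le)
        moreover have "norm x \<le> norm (x + ?h) + norm ?h" using norm_triangle_ineq4[of "x + ?h" ?h] by simp
        moreover have "norm x \<le> R \<or> norm (x + ?h) \<le> R" using False supp[of x] supp[of "x + ?h"] by auto
        ultimately have "norm x \<le> \<bar>R\<bar> + norm v" using norm_ge_zero[of v] by linarith
        moreover have "\<bar>f (x + ?h) - f x\<bar>\<^sup>2 \<le> (L * \<bar>s n\<bar>)\<^sup>2" by (rule power_mono[OF lip]) simp
        ultimately show ?thesis by (auto simp: power_mult_distrib intro!: ennreal_leI)
      qed simp
    qed simp
    also have "\<dots> = ennreal (1 / (s n)\<^sup>2) * (ennreal (L\<^sup>2 * (s n)\<^sup>2) * emeasure lborel (cball (0 :: real \<times> real) (\<bar>R\<bar> + norm v)))"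
      by (subst nn_integral_cmult_indicator) auto
    also have "\<dots> = ?B"
      unfolding mult.assoc[symmetric] using s2 by (subst ennreal_mult[symmetric]) auto
    finally show ?thesis .
  qed
  have "(\<integral>\<^sup>+ \<xi>. ennreal ((v \<bullet> \<xi>)\<^sup>2 * (cmod (fourier2 f \<xi>))\<^sup>2) \<partial>lborel)
     = (\<integral>\<^sup>+ \<xi>. liminf (\<lambda>n. ennreal (q n \<xi> * (cmod (fourier2 f \<xi>))\<^sup>2)) \<partial>lborel)"
  proof (rule nn_integral_cong)
    fix \<xi>
    have "(\<lambda>n. ennreal (q n \<xi> * (cmod (fourier2 f \<xi>))\<^sup>2)) \<longlonglongrightarrow> ennreal ((v \<bullet> \<xi>)\<^sup>2 * (cmod (fourier2 f \<xi>))\<^sup>2)"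
      by (intro tendsto_ennrealI tendsto_mult tendsto_const q_lim)
    from lim_imp_Liminf[OF _ this] show "ennreal ((v \<bullet> \<xi>)\<^sup>2 * (cmod (fourier2 f \<xi>))\<^sup>2)
       = liminf (\<lambda>n. ennreal (q n \<xi> * (cmod (fourier2 f \<xi>))\<^sup>2))" by simp
  qed
  also have "\<dots> \<le> liminf (\<lambda>n. \<integral>\<^sup>+ \<xi>. ennreal (q n \<xi> * (cmod (fourier2 f \<xi>))\<^sup>2) \<partial>lborel)"
    by (rule nn_integral_liminf) measurable
  also have "\<dots> \<le> liminf (\<lambda>n :: nat. ?B)"
    by (intro Liminf_mono always_eventually allI bound)
  also have "\<dots> = ?B" by (simp add: Liminf_const)
  also have "\<dots> < \<infinity>"
    using emeasure_bounded_finite[of "cball (0 :: real \<times> real) (\<bar>R\<bar> + norm v)"] by (simp add: ennreal_mult_less_top)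
  finally show ?thesis .
qed

text \<open>
  The Sobolev norm is an integral that takes the value \<open>0\<close> when the integrand is not integrable, so finiteness has to
  be known before a bound on the norm says anything. For \<open>\<beta> < 1\<close> the weight is dominated by \<open>1 + |\<xi>|\<^sup>2\<close>.
\<close>

lemma sobolev_integral_finite:
  assumes sm: "smooth f" and \<beta>: "0 < \<beta>" "\<beta> < 1"
  shows "sobolev_energy \<beta> f < \<infinity>"
proof -
  have fin: "(\<integral>\<^sup>+ \<xi>. ennreal ((v \<bullet> \<xi>)\<^sup>2 * (cmod (fourier2 f \<xi>))\<^sup>2) \<partial>lborel) < \<infinity>" for v
  proof -
    obtain L where "\<forall>x s. \<bar>f (x + s *\<^sub>R v) - f x\<bar> \<le> L * \<bar>s\<bar>"
      using smooth_directionally_lipschitz[OF sm supp] by blast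
    then show ?thesis by (intro directional_energy_finite) blast
  qed
  have fin0: "(\<integral>\<^sup>+ \<xi>. power_spectrum f \<xi> \<partial>lborel) < \<infinity>"
  proof -
    obtain B where B: "\<And>x. \<bar>f x\<bar> \<le> B"
      using continuous_compact_support(2)[OF cont supp] by (auto simp: real_norm_def)
    have "L2_energy f \<le> (\<integral>\<^sup>+ x. ennreal (B\<^sup>2) * indicator (cball (0 :: real \<times> real) R) x \<partial>lborel)"
    proof (intro nn_integral_mono)
      fix x :: "real \<times> real"
      have "\<bar>f x\<bar>\<^sup>2 \<le> B\<^sup>2" by (rule power_mono[OF B]) simp
      then show "ennreal ((f x)\<^sup>2) \<le> ennreal (B\<^sup>2) * indicator (cball (0 :: real \<times> real) R) x"
        using supp[of x] by (cases "f x = 0") (auto intro!: ennreal_leI)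
    qed
    also have "\<dots> = ennreal (B\<^sup>2) * emeasure lborel (cball (0 :: real \<times> real) R)"
      by (rule nn_integral_cmult_indicator) simp
    also have "\<dots> < \<infinity>" using emeasure_bounded_finite[of "cball (0 :: real \<times> real) R"] by (simp add: ennreal_mult_less_top)
    finally have "L2_energy f < \<infinity>" .
    moreover have "(\<integral>\<^sup>+ \<xi>. power_spectrum f \<xi> \<partial>lborel) = L2_energy f"
      by (rule plancherel_fourier2[OF cont supp])
    ultimately show ?thesis by (simp only:)
  qed
  have "sobolev_energy \<beta> f
     \<le> (\<integral>\<^sup>+ \<xi>. power_spectrum f \<xi> + ennreal (((1, 0) \<bullet> \<xi>)\<^sup>2 * (cmod (fourier2 f \<xi>))\<^sup>2) + ennreal (((0, 1) \<bullet> \<xi>)\<^sup>2 * (cmod (fourier2 f \<xi>))\<^sup>2) \<partial>lborel)"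
  proof (rule nn_integral_mono)
    fix \<xi> :: "real \<times> real"
    have ns: "(norm \<xi>)\<^sup>2 = ((1, 0) \<bullet> \<xi>)\<^sup>2 + ((0, 1) \<bullet> \<xi>)\<^sup>2" by (cases \<xi>) (simp add: norm_Pair)
    have "(1 + (norm \<xi>)\<^sup>2) powr \<beta> \<le> (1 + (norm \<xi>)\<^sup>2) powr 1" using \<beta> by (intro powr_mono) auto
    also have "\<dots> = 1 + (norm \<xi>)\<^sup>2" by (rule powr_one) simp
    also have "\<dots> = 1 + ((1, 0) \<bullet> \<xi>)\<^sup>2 + ((0, 1) \<bullet> \<xi>)\<^sup>2" using ns by simp
    finally have "ennreal ((1 + (norm \<xi>)\<^sup>2) powr \<beta> * (cmod (fourier2 f \<xi>))\<^sup>2)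
      \<le> ennreal ((1 + ((1, 0) \<bullet> \<xi>)\<^sup>2 + ((0, 1) \<bullet> \<xi>)\<^sup>2) * (cmod (fourier2 f \<xi>))\<^sup>2)"
      by (intro ennreal_leI mult_right_mono) auto
    also have "\<dots> = power_spectrum f \<xi> + ennreal (((1, 0) \<bullet> \<xi>)\<^sup>2 * (cmod (fourier2 f \<xi>))\<^sup>2) + ennreal (((0, 1) \<bullet> \<xi>)\<^sup>2 * (cmod (fourier2 f \<xi>))\<^sup>2)"
      by (simp only: distrib_right mult_1_left ennreal_plus zero_le_power2 mult_nonneg_nonneg add_nonneg_nonneg)
    finally show "ennreal ((1 + (norm \<xi>)\<^sup>2) powr \<beta> * (cmod (fourier2 f \<xi>))\<^sup>2)
      \<le> power_spectrum f \<xi> + ennreal (((1, 0) \<bullet> \<xi>)\<^sup>2 * (cmod (fourier2 f \<xi>))\<^sup>2) + ennreal (((0, 1) \<bullet> \<xi>)\<^sup>2 * (cmod (fourier2 f \<xi>))\<^sup>2)" .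
  qed
  also have "\<dots> = (\<integral>\<^sup>+ \<xi>. power_spectrum f \<xi> \<partial>lborel)
      + (\<integral>\<^sup>+ \<xi>. ennreal (((1, 0) \<bullet> \<xi>)\<^sup>2 * (cmod (fourier2 f \<xi>))\<^sup>2) \<partial>lborel) + (\<integral>\<^sup>+ \<xi>. ennreal (((0, 1) \<bullet> \<xi>)\<^sup>2 * (cmod (fourier2 f \<xi>))\<^sup>2) \<partial>lborel)"
    by (simp add: nn_integral_add)
  also have "\<dots> < \<infinity>" using fin0 fin by simp
  finally show ?thesis .
qed

lemma sobolev_nn_integral_le:
  assumes sm: "smooth f" and \<beta>: "0 < \<beta>" "\<beta> < 1" and le: "sobolev_norm \<beta> f \<le> \<rho>"
  shows "sobolev_energy \<beta> f \<le> ennreal (\<rho>\<^sup>2)"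
proof -
  let ?g = "\<lambda>\<xi>. (1 + (norm \<xi>)\<^sup>2) powr \<beta> * (cmod (fourier2 f \<xi>))\<^sup>2"
  have meas: "?g \<in> borel_measurable lborel" by measurable
  have int: "integrable lborel ?g"
  proof (rule integrableI_nonneg[OF meas])
    show "AE \<xi> in lborel. 0 \<le> ?g \<xi>"
      by (intro AE_I2 mult_nonneg_nonneg powr_ge_zero zero_le_power2)
    show "(\<integral>\<^sup>+ \<xi>. ennreal (?g \<xi>) \<partial>lborel) < \<infinity>"
      by (rule sobolev_integral_finite[OF sm \<beta>])
  qed
  have ge0: "(LINT \<xi>|lborel. ?g \<xi>) \<ge> 0" 
    by (intro Bochner_Integration.integral_nonneg mult_nonneg_nonneg powr_ge_zero zero_le_power2)
  have "(LINT \<xi>|lborel. ?g \<xi>) = (sobolev_norm \<beta> f)\<^sup>2"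
    unfolding sobolev_norm_def by (rule real_sqrt_pow2[OF ge0, symmetric])
  also have "0 \<le> sobolev_norm \<beta> f" unfolding sobolev_norm_def by (rule real_sqrt_ge_zero[OF ge0])
  then have "(sobolev_norm \<beta> f)\<^sup>2 \<le> \<rho>\<^sup>2" using le by (intro power_mono)
  finally have "ennreal (LINT \<xi>|lborel. ?g \<xi>) \<le> ennreal (\<rho>\<^sup>2)" by (rule ennreal_leI)
  moreover have "(\<integral>\<^sup>+ \<xi>. ennreal (?g \<xi>) \<partial>lborel) = ennreal (LINT \<xi>|lborel. ?g \<xi>)"
    by (rule nn_integral_eq_integral[OF int]) (intro AE_I2 mult_nonneg_nonneg powr_ge_zero zero_le_power2)
  ultimately show ?thesis by (simp only:)
qed

end

section \<open>Polar coordinates and inversion\<close>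

lemma nn_integral_indicator_incseq:
  assumes [measurable]: "f \<in> borel_measurable M" "\<And>n. A n \<in> sets M" and inc: "incseq A"
  shows "(\<lambda>n. \<integral>\<^sup>+ x. f x * indicator (A n) x \<partial>M) \<longlonglongrightarrow> (\<integral>\<^sup>+ x. f x * indicator (\<Union>n. A n) x \<partial>M)"
proof (rule nn_integral_LIMSEQ)
  show "incseq (\<lambda>n x. f x * indicator (A n) x)"
  proof (rule incseq_SucI, rule le_funI)
    fix n x
    have "A n \<subseteq> A (Suc n)" using inc by (rule incseq_SucD)
    then show "f x * indicator (A n) x \<le> f x * indicator (A (Suc n)) x"
      by (intro mult_left_mono) (auto simp: indicator_def)
  qed
  fix x
  have "\<forall>\<^sub>F n in sequentially. f x * indicator (A n) x = f x * indicator (\<Union>n. A n) x"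
  proof (cases "\<exists>N. x \<in> A N")
    case True
    then obtain N where "x \<in> A N" ..
    then show ?thesis using inc
      by (intro eventually_sequentiallyI[of N]) (auto simp: incseq_def indicator_def)
  qed auto
  then show "(\<lambda>n. f x * indicator (A n) x) \<longlonglongrightarrow> f x * indicator (\<Union>n. A n) x"
    by (rule tendsto_eventually)
qed measurable

text \<open>
  Substitution on open or unbounded intervals, by exhausting them with compact ones.
\<close>

lemma nn_integral_substitution_exhaustion:
  fixes f :: "real \<Rightarrow> ennreal" and g g' :: "real \<Rightarrow> real" and a b :: "nat \<Rightarrow> real"
  assumes f [measurable]: "f \<in> borel_measurable borel"
    and g [measurable]: "g \<in> borel_measurable borel" "g' \<in> borel_measurable borel"
    and deriv: "\<And>n x. x \<in> {a n..b n} \<Longrightarrow> (g has_real_derivative g' x) (at x)"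
    and cont: "\<And>n. continuous_on {a n..b n} g'"
    and nonneg: "\<And>n x. x \<in> {a n..b n} \<Longrightarrow> g' x \<ge> 0"
    and le: "\<And>n. a n < b n"
    and inc: "incseq (\<lambda>n. {a n..b n})" "incseq (\<lambda>n. {g (a n)..g (b n)})"
  shows "(\<integral>\<^sup>+ x. f x * indicator (\<Union>n. {g (a n)..g (b n)}) x \<partial>lborel)
       = (\<integral>\<^sup>+ x. f (g x) * g' x * indicator (\<Union>n. {a n..b n}) x \<partial>lborel)"
proof (rule LIMSEQ_unique)
  show "(\<lambda>n. \<integral>\<^sup>+ x. f x * indicator {g (a n)..g (b n)} x \<partial>lborel)
      \<longlonglongrightarrow> (\<integral>\<^sup>+ x. f x * indicator (\<Union>n. {g (a n)..g (b n)}) x \<partial>lborel)"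
    by (rule nn_integral_indicator_incseq) (use inc in auto)
  have "(\<lambda>n. \<integral>\<^sup>+ x. f (g x) * g' x * indicator {a n..b n} x \<partial>lborel)
      \<longlonglongrightarrow> (\<integral>\<^sup>+ x. f (g x) * g' x * indicator (\<Union>n. {a n..b n}) x \<partial>lborel)"
    by (rule nn_integral_indicator_incseq) (use inc in auto)
  then show "(\<lambda>n. \<integral>\<^sup>+ x. f x * indicator {g (a n)..g (b n)} x \<partial>lborel)
      \<longlonglongrightarrow> (\<integral>\<^sup>+ x. f (g x) * g' x * indicator (\<Union>n. {a n..b n}) x \<partial>lborel)"
    using nn_integral_substitution_aux[OF f zero_le deriv cont nonneg le] by simp
qed

lemma nn_integral_tan:
  assumes f [measurable]: "f \<in> borel_measurable borel"
  shows "(\<integral>\<^sup>+ t. f t \<partial>lborel)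
       = (\<integral>\<^sup>+ \<psi>. f (tan \<psi>) * ennreal (1 / (cos \<psi>)\<^sup>2) * indicator {-(pi/2)<..<pi/2} \<psi> \<partial>lborel)"
proof -
  let ?b = "\<lambda>n. arctan (real (Suc n))"
  have cospos: "cos \<psi> > 0" if "\<psi> \<in> {- ?b n..?b n}" for n \<psi>
    using that arctan_bounded[of "real (Suc n)"] by (intro cos_gt_zero_pi) auto
  have img: "(\<Union>n. {tan (- ?b n)..tan (?b n)}) = UNIV"
  proof -
    have "\<exists>n. - real (Suc n) \<le> x \<and> x \<le> real (Suc n)" for x
      using real_arch_simple[of "\<bar>x\<bar>"] by (auto intro!: exI[of _ "nat \<lceil>\<bar>x\<bar>\<rceil>"]) linarith+
    then show ?thesis by (auto simp: tan_arctan)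
  qed
  have dom: "(\<Union>n. {- ?b n..?b n}) = {-(pi/2)<..<pi/2}"
  proof (intro equalityI subsetI)
    fix x assume "x \<in> (\<Union>n. {- ?b n..?b n})"
    then obtain n where "x \<in> {- ?b n..?b n}" by blast
    then show "x \<in> {-(pi/2)<..<pi/2}" using arctan_bounded[of "real (Suc n)"] by auto
  next
    fix x assume x: "x \<in> {-(pi/2)<..<pi/2}"
    obtain n where n: "\<bar>tan x\<bar> \<le> real n" using real_arch_simple by blast
    have "x = arctan (tan x)" using x by (simp add: arctan_tan)
    moreover have "arctan (tan x) \<le> ?b n" "arctan (- real (Suc n)) \<le> arctan (tan x)"
      using n by (auto simp: arctan_le_iff simp del: arctan_minus)
    ultimately have "x \<in> {- ?b n..?b n}" unfolding arctan_minus by simp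
    then show "x \<in> (\<Union>n. {- ?b n..?b n})" by blast
  qed
  have [measurable]: "(tan :: real \<Rightarrow> real) \<in> borel_measurable borel"
    unfolding tan_def[abs_def] by measurable
  have "(\<integral>\<^sup>+ t. f t * indicator (\<Union>n. {tan (- ?b n)..tan (?b n)}) t \<partial>lborel)
      = (\<integral>\<^sup>+ \<psi>. f (tan \<psi>) * ennreal (1 / (cos \<psi>)\<^sup>2) * indicator (\<Union>n. {- ?b n..?b n}) \<psi> \<partial>lborel)"
  proof (rule nn_integral_substitution_exhaustion)
    fix n x assume x: "x \<in> {- ?b n..?b n}"
    show "(tan has_real_derivative 1 / (cos x)\<^sup>2) (at x)"
      using cospos[OF x] DERIV_tan[of x] by (simp add: inverse_eq_divide)
  next
    fix n show "continuous_on {- ?b n..?b n} (\<lambda>x. 1 / (cos x)\<^sup>2)"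
      using cospos by (intro continuous_intros) force
    show "- ?b n < ?b n" by (simp add: arctan_less_iff flip: arctan_minus)
  qed (auto simp: incseq_def tan_arctan arctan_le_iff)
  then show ?thesis unfolding img dom by simp
qed

lemma AE_lborel_neq: "AE x in lborel. x \<noteq> (c::'a::euclidean_space)"
  by (rule AE_I[of _ _ "{c}"]) auto

text \<open>
  The substitution \<open>s \<mapsto> - 1 / s\<close> is increasing on each half-line and exchanges the two; a reflection turns it into
  \<open>s \<mapsto> 1 / s\<close>.
\<close>

lemma nn_integral_inverse:
  assumes f [measurable]: "f \<in> borel_measurable borel"
  shows "(\<integral>\<^sup>+ s. f s \<partial>lborel) = (\<integral>\<^sup>+ s. f (1 / s) * ennreal (1 / s\<^sup>2) \<partial>lborel)"
proof -
  \<comment> \<open>the shift by \<open>2\<close> makes all intervals \<open>[1/(n + 2), n + 2]\<close> nondegenerate\<close>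
  define a b where "a n = 1 / real (n + 2)" and "b n = real (n + 2)" for n
  have ab: "0 < a n" "a n < b n" "-1 / a n = - b n" "-1 / b n = - a n" "-1 / - a n = b n" "-1 / - b n = a n" for n
  proof -
    show "a n < b n" unfolding a_def b_def by (rule order_less_trans[of _ 1]) auto
  qed (auto simp: a_def b_def divide_simps)
  have ab_mono: "a (Suc n) \<le> a n" "b n \<le> b (Suc n)" for n
    unfolding a_def b_def by (auto intro!: divide_left_mono)
  have inc: "incseq (\<lambda>n. {a n..b n})" "incseq (\<lambda>n. {- b n..- a n})"
    by (rule incseq_SucI, use ab_mono in \<open>simp add: atLeastatMost_subset_iff\<close>)+
  have Uab: "(\<Union>n. {a n..b n}) = {0<..}"
  proof (intro equalityI subsetI)
    fix x :: real assume "x \<in> {0<..}"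
    then have x: "x > 0" by simp
    obtain n where n: "x \<le> real n" using real_arch_simple by blast
    obtain m where m: "1 / x \<le> real m" using real_arch_simple by blast
    have "1 / x \<le> real (n + m + 2)" "x \<le> real (n + m + 2)" using n m by auto
    then have "x \<in> {a (n + m)..b (n + m)}" using x by (simp add: a_def b_def field_simps)
    then show "x \<in> (\<Union>n. {a n..b n})" by blast
  qed (use ab in \<open>auto intro: less_le_trans\<close>)
  have "(\<Union>n. {- b n..- a n}) = uminus ` (\<Union>n. {a n..b n})"
    by (simp add: image_UN)
  also have "\<dots> = {..<0}" unfolding Uab by (simp add: image_uminus_greaterThan)
  finally have Uba: "(\<Union>n. {- b n..- a n}) = {..<0}" .
  have pos: "(\<integral>\<^sup>+ x. f x * indicator (\<Union>n. {-1 / (- b n)..-1 / (- a n)}) x \<partial>lborel)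
      = (\<integral>\<^sup>+ x. f (-1 / x) * ennreal (1 / x\<^sup>2) * indicator (\<Union>n. {- b n..- a n}) x \<partial>lborel)"
  proof (rule nn_integral_substitution_exhaustion)
    fix n x assume "x \<in> {- b n..- a n}"
    then have "x < 0" using ab(1)[of n] by simp
    then show "((\<lambda>x. -1 / x) has_real_derivative 1 / x\<^sup>2) (at x)"
      by (auto intro!: derivative_eq_intros simp: power2_eq_square)
  next
    fix n show "continuous_on {- b n..- a n} (\<lambda>x. 1 / x\<^sup>2)"
      using ab(1)[of n] by (intro continuous_intros) auto
  qed (use ab inc in auto)
  have neg: "(\<integral>\<^sup>+ x. f x * indicator (\<Union>n. {-1 / a n..-1 / b n}) x \<partial>lborel)
      = (\<integral>\<^sup>+ x. f (-1 / x) * ennreal (1 / x\<^sup>2) * indicator (\<Union>n. {a n..b n}) x \<partial>lborel)"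
  proof (rule nn_integral_substitution_exhaustion)
    fix n x assume "x \<in> {a n..b n}"
    then have "x > 0" using ab(1)[of n] by simp
    then show "((\<lambda>x. -1 / x) has_real_derivative 1 / x\<^sup>2) (at x)"
      by (auto intro!: derivative_eq_intros simp: power2_eq_square)
  next
    fix n show "continuous_on {a n..b n} (\<lambda>x. 1 / x\<^sup>2)"
      using ab(1)[of n] by (intro continuous_intros) auto
  qed (use ab inc in auto)
  have split: "(\<integral>\<^sup>+ x. g x \<partial>lborel) = (\<integral>\<^sup>+ x. g x * indicator {0<..} x \<partial>lborel) + (\<integral>\<^sup>+ x. g x * indicator {..<0} x \<partial>lborel)"
    if [measurable]: "g \<in> borel_measurable borel" for g :: "real \<Rightarrow> ennreal"
  proof (subst nn_integral_add[symmetric])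
    have "AE x in lborel. g x = g x * indicator {0<..} x + g x * indicator {..<0} x"
      using AE_lborel_neq[of "0::real"] by eventually_elim (auto simp: indicator_def)
    then show "(\<integral>\<^sup>+ x. g x \<partial>lborel) = (\<integral>\<^sup>+ x. g x * indicator {0<..} x + g x * indicator {..<0} x \<partial>lborel)"
      by (rule nn_integral_cong_AE)
  qed measurable
  have "(\<integral>\<^sup>+ s. f s \<partial>lborel) = (\<integral>\<^sup>+ s. f (- 1 / s) * ennreal (1 / s\<^sup>2) \<partial>lborel)"
    using pos neg unfolding ab Uab Uba
    by (subst (1 2) split) (auto simp: add.commute)
  also have "\<dots> = (\<integral>\<^sup>+ s. f (1 / s) * ennreal (1 / s\<^sup>2) \<partial>lborel)"
    by (subst nn_integral_real_affine[of _ "-1" 0]) auto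
  finally show ?thesis .
qed

definition dirv :: "real \<Rightarrow> real \<times> real" where
  "dirv \<phi> = (cos \<phi>, sin \<phi>)"

lemma norm_dirv [simp]: "norm (dirv \<phi>) = 1"
  by (simp add: dirv_def norm_Pair)

lemma dirv_measurable [measurable]: "dirv \<in> borel_measurable borel"
  unfolding dirv_def[abs_def] borel_prod[symmetric] by measurable

lemma dirv_measurable' [measurable (raw)]: 
  "f \<in> borel_measurable M \<Longrightarrow> (\<lambda>x. dirv (f x)) \<in> borel_measurable M"
  using measurable_compose[OF _ dirv_measurable] by simp

text \<open>
  Polar coordinates with a half-turn of angles and a radius of either sign: this is the parametrisation in which the
  radial variable runs over a whole line, as in the slice theorem. The proof stays one-dimensional: rows are rescaled
  by \<open>x = y t\<close>, the order of integration is exchanged, then \<open>t = tan \<psi>\<close> and \<open>y = \<sigma> cos \<psi>\<close>, and \<open>\<phi> = \<pi>/2 - \<psi>\<close>.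
\<close>

theorem nn_integral_polar:
  fixes g :: "real \<times> real \<Rightarrow> ennreal"
  assumes g [measurable]: "g \<in> borel_measurable borel"
  shows "(\<integral>\<^sup>+ x. g x \<partial>lborel)
       = (\<integral>\<^sup>+ \<phi>. indicator {0<..<pi} \<phi> * (\<integral>\<^sup>+ \<sigma>. ennreal \<bar>\<sigma>\<bar> * g (\<sigma> *\<^sub>R dirv \<phi>) \<partial>lborel) \<partial>lborel)"
proof -
  have gp [measurable]: "g \<in> borel_measurable (borel \<Otimes>\<^sub>M borel)" by (simp add: borel_prod)
  have "(\<integral>\<^sup>+ x. g x \<partial>lborel) = (\<integral>\<^sup>+ y. \<integral>\<^sup>+ x. g (x, y) \<partial>lborel \<partial>lborel)"
    by (subst lborel_pair.nn_integral_snd) (auto simp: lborel_prod)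
  also have "\<dots> = (\<integral>\<^sup>+ y. \<integral>\<^sup>+ t. ennreal \<bar>y\<bar> * g (y * t, y) \<partial>lborel \<partial>lborel)"
  proof (rule nn_integral_cong_AE)
    show "AE y in lborel. (\<integral>\<^sup>+ x. g (x, y) \<partial>lborel) = (\<integral>\<^sup>+ t. ennreal \<bar>y\<bar> * g (y * t, y) \<partial>lborel)"
      using AE_lborel_neq[of "0::real"]
    proof eventually_elim
      fix y :: real assume "y \<noteq> 0"
      then show "(\<integral>\<^sup>+ x. g (x, y) \<partial>lborel) = (\<integral>\<^sup>+ t. ennreal \<bar>y\<bar> * g (y * t, y) \<partial>lborel)"
        by (subst nn_integral_real_affine[where c = y and t = 0]) (auto simp: nn_integral_cmult)
    qed
  qed
  also have "\<dots> = (\<integral>\<^sup>+ t. \<integral>\<^sup>+ y. ennreal \<bar>y\<bar> * g (y * t, y) \<partial>lborel \<partial>lborel)"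
    by (rule lborel_pair.Fubini') measurable
  also have "\<dots> = (\<integral>\<^sup>+ \<psi>. (\<integral>\<^sup>+ y. ennreal \<bar>y\<bar> * g (y * tan \<psi>, y) \<partial>lborel) * ennreal (1 / (cos \<psi>)\<^sup>2)
                    * indicator {-(pi/2)<..<pi/2} \<psi> \<partial>lborel)"
    by (rule nn_integral_tan) measurable
  also have "\<dots> = (\<integral>\<^sup>+ \<psi>. indicator {-(pi/2)<..<pi/2} \<psi> * (\<integral>\<^sup>+ \<sigma>. ennreal \<bar>\<sigma>\<bar> * g (\<sigma> *\<^sub>R (sin \<psi>, cos \<psi>)) \<partial>lborel) \<partial>lborel)"
  proof (rule nn_integral_cong)
    fix \<psi> :: real
    show "(\<integral>\<^sup>+ y. ennreal \<bar>y\<bar> * g (y * tan \<psi>, y) \<partial>lborel) * ennreal (1 / (cos \<psi>)\<^sup>2) * indicator {-(pi/2)<..<pi/2} \<psi>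
       = indicator {-(pi/2)<..<pi/2} \<psi> * (\<integral>\<^sup>+ \<sigma>. ennreal \<bar>\<sigma>\<bar> * g (\<sigma> *\<^sub>R (sin \<psi>, cos \<psi>)) \<partial>lborel)"
    proof (cases "\<psi> \<in> {-(pi/2)<..<pi/2}")
      case True
      then have c: "cos \<psi> > 0" by (intro cos_gt_zero_pi) auto
      have "(\<integral>\<^sup>+ y. ennreal \<bar>y\<bar> * g (y * tan \<psi>, y) \<partial>lborel)
         = ennreal (cos \<psi>) * (\<integral>\<^sup>+ \<sigma>. ennreal \<bar>cos \<psi> * \<sigma>\<bar> * g (cos \<psi> * \<sigma> * tan \<psi>, cos \<psi> * \<sigma>) \<partial>lborel)"
        using c by (subst nn_integral_real_affine[where c = "cos \<psi>" and t = 0]) auto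
      also have "(\<integral>\<^sup>+ \<sigma>. ennreal \<bar>cos \<psi> * \<sigma>\<bar> * g (cos \<psi> * \<sigma> * tan \<psi>, cos \<psi> * \<sigma>) \<partial>lborel)
         = (\<integral>\<^sup>+ \<sigma>. ennreal (cos \<psi>) * (ennreal \<bar>\<sigma>\<bar> * g (\<sigma> *\<^sub>R (sin \<psi>, cos \<psi>))) \<partial>lborel)"
        using c by (intro nn_integral_cong) (auto simp: abs_mult ennreal_mult tan_def mult_ac)
      also have "\<dots> = ennreal (cos \<psi>) * (\<integral>\<^sup>+ \<sigma>. ennreal \<bar>\<sigma>\<bar> * g (\<sigma> *\<^sub>R (sin \<psi>, cos \<psi>)) \<partial>lborel)"
        by (rule nn_integral_cmult) measurable
      finally have eq: "(\<integral>\<^sup>+ y. ennreal \<bar>y\<bar> * g (y * tan \<psi>, y) \<partial>lborel)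
         = ennreal (cos \<psi>) * (ennreal (cos \<psi>) * (\<integral>\<^sup>+ \<sigma>. ennreal \<bar>\<sigma>\<bar> * g (\<sigma> *\<^sub>R (sin \<psi>, cos \<psi>)) \<partial>lborel))" .
      have one: "ennreal (cos \<psi>) * (ennreal (cos \<psi>) * ennreal (1 / (cos \<psi>)\<^sup>2)) = 1"
        using c by (simp add: ennreal_mult[symmetric] power2_eq_square)
      have "(ennreal (cos \<psi>) * (ennreal (cos \<psi>) * X)) * ennreal (1 / (cos \<psi>)\<^sup>2) = X" for X
        using arg_cong[OF one, of "\<lambda>z. z * X"] by (simp add: mult_ac)
      then show ?thesis unfolding eq using True by simp
    qed auto
  qed
  also have "\<dots> = (\<integral>\<^sup>+ \<phi>. indicator {0<..<pi} \<phi> * (\<integral>\<^sup>+ \<sigma>. ennreal \<bar>\<sigma>\<bar> * g (\<sigma> *\<^sub>R dirv \<phi>) \<partial>lborel) \<partial>lborel)"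
  proof -
    have ind: "indicator {-(pi/2)<..<pi/2} (pi/2 - \<phi>) = (indicator {0<..<pi} \<phi> :: ennreal)" for \<phi>
      by (auto simp: indicator_def)
    show ?thesis
      by (subst nn_integral_real_affine[where c = "-1" and t = "pi/2"])
        (auto simp: dirv_def sin_diff cos_diff ind)
  qed
  finally show ?thesis .
qed

definition inversion :: "real \<times> real \<Rightarrow> real \<times> real" where
  "inversion y = (1 / (norm y)\<^sup>2) *\<^sub>R y"

lemma inversion_measurable [measurable]: "inversion \<in> borel_measurable borel"
  unfolding inversion_def[abs_def] by measurable

text \<open>
  In polar coordinates the inversion is \<open>\<sigma> \<mapsto> 1 / \<sigma>\<close> on every line through the origin.
\<close>

theorem nn_integral_inversion:
  fixes g :: "real \<times> real \<Rightarrow> ennreal"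
  assumes g [measurable]: "g \<in> borel_measurable borel"
  shows "(\<integral>\<^sup>+ x. g x \<partial>lborel) = (\<integral>\<^sup>+ y. g (inversion y) * ennreal (1 / norm y ^ 4) \<partial>lborel)"
proof -
  have gp [measurable]: "g \<in> borel_measurable (borel \<Otimes>\<^sub>M borel)" by (simp add: borel_prod)
  have "(\<integral>\<^sup>+ \<sigma>. ennreal \<bar>\<sigma>\<bar> * g (\<sigma> *\<^sub>R dirv \<phi>) \<partial>lborel)
      = (\<integral>\<^sup>+ \<sigma>. ennreal \<bar>\<sigma>\<bar> * (g (inversion (\<sigma> *\<^sub>R dirv \<phi>)) * ennreal (1 / norm (\<sigma> *\<^sub>R dirv \<phi>) ^ 4)) \<partial>lborel)" for \<phi>
  proof -
    have "(\<integral>\<^sup>+ \<sigma>. ennreal \<bar>\<sigma>\<bar> * g (\<sigma> *\<^sub>R dirv \<phi>) \<partial>lborel)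
       = (\<integral>\<^sup>+ \<sigma>. ennreal \<bar>1 / \<sigma>\<bar> * g ((1 / \<sigma>) *\<^sub>R dirv \<phi>) * ennreal (1 / \<sigma>\<^sup>2) \<partial>lborel)"
      by (rule nn_integral_inverse) measurable
    also have "\<dots> = (\<integral>\<^sup>+ \<sigma>. ennreal \<bar>\<sigma>\<bar> * (g (inversion (\<sigma> *\<^sub>R dirv \<phi>)) * ennreal (1 / norm (\<sigma> *\<^sub>R dirv \<phi>) ^ 4)) \<partial>lborel)"
    proof (rule nn_integral_cong_AE)
      show "AE \<sigma> in lborel. ennreal \<bar>1 / \<sigma>\<bar> * g ((1 / \<sigma>) *\<^sub>R dirv \<phi>) * ennreal (1 / \<sigma>\<^sup>2)
         = ennreal \<bar>\<sigma>\<bar> * (g (inversion (\<sigma> *\<^sub>R dirv \<phi>)) * ennreal (1 / norm (\<sigma> *\<^sub>R dirv \<phi>) ^ 4))"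
        using AE_lborel_neq[of "0::real"]
      proof eventually_elim
        fix \<sigma> :: real assume s: "\<sigma> \<noteq> 0"
        have 1: "inversion (\<sigma> *\<^sub>R dirv \<phi>) = (1 / \<sigma>) *\<^sub>R dirv \<phi>"
          using s by (simp add: inversion_def power2_eq_square)
        have "\<bar>1 / \<sigma>\<bar> * (1 / \<sigma>\<^sup>2) = \<bar>\<sigma>\<bar> * (1 / \<bar>\<sigma>\<bar> ^ 4)"
          using s by (simp add: field_simps power2_eq_square eval_nat_numeral flip: power2_abs)
        then have 2: "ennreal \<bar>1 / \<sigma>\<bar> * ennreal (1 / \<sigma>\<^sup>2) = ennreal \<bar>\<sigma>\<bar> * ennreal (1 / norm (\<sigma> *\<^sub>R dirv \<phi>) ^ 4)"
          by (simp add: ennreal_mult[symmetric])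
        show "ennreal \<bar>1 / \<sigma>\<bar> * g ((1 / \<sigma>) *\<^sub>R dirv \<phi>) * ennreal (1 / \<sigma>\<^sup>2)
         = ennreal \<bar>\<sigma>\<bar> * (g (inversion (\<sigma> *\<^sub>R dirv \<phi>)) * ennreal (1 / norm (\<sigma> *\<^sub>R dirv \<phi>) ^ 4))"
          unfolding 1 using arg_cong[OF 2, of "\<lambda>z. z * g ((1 / \<sigma>) *\<^sub>R dirv \<phi>)"] by (simp add: mult_ac)
      qed
    qed
    finally show ?thesis .
  qed
  then show ?thesis
    by (subst (1 2) nn_integral_polar) auto
qed

lemma inversion_eq_0_iff [simp]: "inversion y = 0 \<longleftrightarrow> y = 0"
  by (auto simp: inversion_def)

lemma norm_inversion: "norm (inversion y) = 1 / norm y"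
  by (simp add: inversion_def power2_eq_square)

lemma distr_inversion:
  "distr (density lborel (\<lambda>y. ennreal (1 / norm y ^ 4))) borel inversion = (lborel :: (real \<times> real) measure)"
proof (rule measure_eqI)
  fix A assume "A \<in> sets (distr (density lborel (\<lambda>y. ennreal (1 / norm y ^ 4))) borel inversion)"
  then have A [measurable]: "A \<in> sets borel" by simp
  have [measurable]: "inversion -` A \<in> sets borel"
    using measurable_sets[OF inversion_measurable A] by simp
  have "emeasure (distr (density lborel (\<lambda>y. ennreal (1 / norm y ^ 4))) borel inversion) A
      = (\<integral>\<^sup>+ y. ennreal (1 / norm y ^ 4) * indicator (inversion -` A) y \<partial>lborel)"
    by (subst emeasure_distr) (auto simp: emeasure_density)
  also have "\<dots> = (\<integral>\<^sup>+ y. indicator A (inversion y) * ennreal (1 / norm y ^ 4) \<partial>lborel)"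
    by (intro nn_integral_cong) (auto simp: indicator_def)
  also have "\<dots> = (\<integral>\<^sup>+ x. indicator A x \<partial>lborel)"
    by (rule nn_integral_inversion[symmetric]) auto
  finally show "emeasure (distr (density lborel (\<lambda>y. ennreal (1 / norm y ^ 4))) borel inversion) A = emeasure lborel A"
    by simp
qed simp

lemma integral_inversion:
  fixes g :: "real \<times> real \<Rightarrow> real"
  assumes [measurable]: "g \<in> borel_measurable borel"
  shows "(LINT x|lborel. g x) = (LINT y|lborel. g (inversion y) / norm y ^ 4)"
proof -
  have "(LINT x|lborel. g x) = (LINT x|distr (density lborel (\<lambda>y. ennreal (1 / norm y ^ 4))) borel inversion. g x)"
    by (simp only: distr_inversion)
  also have "\<dots> = (LINT y|density lborel (\<lambda>y. ennreal (1 / norm y ^ 4)). g (inversion y))"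
    by (rule integral_distr) auto
  also have "\<dots> = (LINT y|lborel. (1 / norm y ^ 4) *\<^sub>R g (inversion y))"
    by (rule integral_density) auto
  finally show ?thesis by simp
qed

lemma norm_inversion_diff:
  assumes "y \<noteq> 0" "z \<noteq> 0"
  shows "norm (inversion y - inversion z) = norm (y - z) / (norm y * norm z)"
proof -
  have norm_sq: "(norm (a - b))\<^sup>2 = (norm a)\<^sup>2 - 2 * (a \<bullet> b) + (norm b)\<^sup>2" for a b :: "real \<times> real"
    by (simp add: power2_norm_eq_inner inner_diff_left inner_diff_right inner_commute)
  have "(norm (inversion y - inversion z))\<^sup>2 = (norm (y - z) / (norm y * norm z))\<^sup>2"
    using assms unfolding norm_sq norm_inversion power_divide
    by (simp add: inversion_def power_mult_distrib field_simps)
  then show ?thesis by (rule power2_eq_imp_eq) auto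
qed

section \<open>The disc transform as a half-plane integral\<close>

definition halfplane_integral :: "(real \<times> real \<Rightarrow> real) \<Rightarrow> real \<Rightarrow> real \<Rightarrow> real" where
  "halfplane_integral g p \<phi> = (LINT y|lborel. (if y \<bullet> dirv \<phi> < p then g y else 0))"

text \<open>
  The density of \<open>f\<close> after inversion; \<open>|y|\<^bsup>-4\<^esup>\<close> is the Jacobian. At \<open>y = 0\<close> division by zero yields \<open>0\<close>, which is the
  continuous extension when \<open>f\<close> has bounded support.
\<close>

definition kelvin :: "(real \<times> real \<Rightarrow> real) \<Rightarrow> real \<times> real \<Rightarrow> real" where
  "kelvin f y = f (inversion y) / norm y ^ 4"

lemma AE_inner_dirv_neq: "AE y in lborel. y \<bullet> dirv \<phi> \<noteq> p"
proof -
  have "dirv \<phi> \<noteq> 0" using norm_dirv[of \<phi>] by (metis norm_zero zero_neq_one)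
  then have "negligible {y. dirv \<phi> \<bullet> y = p}" by (intro negligible_hyperplane) auto
  then have n: "{y. dirv \<phi> \<bullet> y = p} \<in> null_sets lebesgue" by (simp add: negligible_iff_null_sets)
  have "{y. dirv \<phi> \<bullet> y = p} \<in> sets borel" by (intro borel_closed closed_hyperplane)
  with n have "{y. dirv \<phi> \<bullet> y = p} \<in> null_sets lborel" by (auto simp: null_sets_def)
  then show ?thesis by (rule AE_I') (auto simp: inner_commute)
qed

lemma dirv_add_pi [simp]: "dirv (\<phi> + pi) = - dirv \<phi>"
  by (simp add: dirv_def)

text \<open>
  \<open>|x - q \<omega>| < q\<close> says \<open>|x|\<^sup>2 < 2 q (x \<bullet> \<omega>)\<close>; dividing by \<open>|x|\<^sup>2\<close> leaves a linear inequality for \<open>x / |x|\<^sup>2\<close>.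
\<close>

lemma disc_through_0_inversion:
  assumes "p > 0" "y \<noteq> 0"
  shows "inversion y \<in> disc_through_0 (1 / p) \<phi> \<longleftrightarrow> p < y \<bullet> dirv \<phi>"
proof -
  define q where "q = 1 / p / 2"
  have q: "q > 0" using assms by (simp add: q_def)
  have norm_sq: "(norm (a - b))\<^sup>2 = (norm a)\<^sup>2 - 2 * (b \<bullet> a) + (norm b)\<^sup>2" for a b :: "real \<times> real"
    by (simp add: power2_norm_eq_inner inner_diff_left inner_diff_right inner_commute)
  have c: "(1 / p / 2 * cos \<phi>, 1 / p / 2 * sin \<phi>) = q *\<^sub>R dirv \<phi>" by (simp add: dirv_def q_def)
  have "inversion y \<in> disc_through_0 (1 / p) \<phi> \<longleftrightarrow> norm (q *\<^sub>R dirv \<phi> - inversion y) < q"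
    unfolding disc_through_0_def c by (simp add: dist_norm q_def)
  also have "\<dots> \<longleftrightarrow> (norm (q *\<^sub>R dirv \<phi> - inversion y))\<^sup>2 < q\<^sup>2"
    using q by (auto intro: power_strict_mono power2_less_imp_less[OF _ less_imp_le])
  also have "(norm (q *\<^sub>R dirv \<phi> - inversion y))\<^sup>2 = q\<^sup>2 - 2 * q * (inversion y \<bullet> dirv \<phi>) + (norm (inversion y))\<^sup>2"
    unfolding norm_sq by (simp add: power_mult_distrib)
  also have "\<dots> < q\<^sup>2 \<longleftrightarrow> 1 / (norm y)\<^sup>2 < 2 * q * ((y \<bullet> dirv \<phi>) / (norm y)\<^sup>2)"
    by (simp add: norm_inversion power_divide) (simp add: inversion_def)
  also have "\<dots> \<longleftrightarrow> p < y \<bullet> dirv \<phi>"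
    using assms by (simp add: q_def field_simps)
  finally show ?thesis .
qed

lemma disc_Dr_iff: "x \<in> disc_Dr r \<longleftrightarrow> (norm x)\<^sup>2 + r < (r + 1) * snd x"
proof -
  obtain a b where x: "x = (a, b)" by (cases x)
  have "(norm x)\<^sup>2 = a\<^sup>2 + b\<^sup>2" by (simp add: x norm_Pair)
  moreover have "(b - (r + 1) / 2)\<^sup>2 = b\<^sup>2 - (r + 1) * b + (r + 1)\<^sup>2 / 4" "(r - 1)\<^sup>2 / 4 = (r + 1)\<^sup>2 / 4 - r"
    by (simp_all add: power2_eq_square field_simps)
  ultimately show ?thesis unfolding disc_Dr_def x by auto
qed

locale disc_supported =
  fixes f :: "real \<times> real \<Rightarrow> real" and r :: real
  assumes r: "r > 1" and cont: "continuous_on UNIV f" and supp: "\<And>x. f x \<noteq> 0 \<Longrightarrow> x \<in> disc_Dr r"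
begin

lemma support_norm: assumes "f x \<noteq> 0" shows "1 < norm x" "norm x < r"
proof -
  have "(norm x)\<^sup>2 + r < (r + 1) * snd x" using supp[OF assms] by (simp add: disc_Dr_iff)
  also have "\<dots> \<le> (r + 1) * norm x"
    using r norm_snd_le[of "snd x" "fst x"] by (intro mult_left_mono) auto
  finally have "(norm x - 1) * (norm x - r) < 0" by (simp add: algebra_simps power2_eq_square)
  then show "1 < norm x" "norm x < r" using r by (auto simp: mult_less_0_iff)
qed

lemma f_meas': "f \<in> borel_measurable borel"
  using cont by (rule borel_measurable_continuous_onI)

lemma kelvin_measurable [measurable]: "kelvin f \<in> borel_measurable borel"
  unfolding kelvin_def[abs_def] using f_meas' by measurable

text \<open>
  The inverted disc has the segment from \<open>(0, 1/r)\<close> to \<open>(0, 1)\<close> as a diameter. The bounds say that it lies inside the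
  unit circle, above the horizontal axis, and has radius less than \<open>1/2\<close>.
\<close>

lemma kelvin_support:
  assumes "kelvin f y \<noteq> 0"
  shows "1 + r * (norm y)\<^sup>2 < (r + 1) * snd y" "1 / r < norm y" "norm y < 1" "1 / r < snd y" "\<bar>fst y\<bar> < 1 / 2"
proof -
  have nz: "f (inversion y) \<noteq> 0" "y \<noteq> 0" using assms by (auto simp: kelvin_def)
  have ny: "norm y > 0" using nz by simp
  have "1 < 1 / norm y" "1 / norm y < r" using support_norm[OF nz(1)] by (simp_all add: norm_inversion)
  then have "1 < r * norm y" and n1: "norm y < 1" using ny by (simp_all add: pos_divide_less_eq pos_less_divide_eq)
  moreover have r0: "0 < r" using r by simp
  ultimately have n0: "1 / r < norm y" by (simp add: pos_divide_less_eq[OF r0] mult.commute)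
  note n = n0 n1
  then show "1 / r < norm y" "norm y < 1" by auto
  have "(1 / norm y)\<^sup>2 + r < (r + 1) * (snd y / (norm y)\<^sup>2)"
    using supp[OF nz(1)] by (simp add: disc_Dr_iff norm_inversion) (simp add: inversion_def)
  then have "((1 / norm y)\<^sup>2 + r) * (norm y)\<^sup>2 < (r + 1) * (snd y / (norm y)\<^sup>2) * (norm y)\<^sup>2"
    using ny by (intro mult_strict_right_mono) auto
  moreover have "((1 / norm y)\<^sup>2 + r) * (norm y)\<^sup>2 = 1 + r * (norm y)\<^sup>2"
    using ny by (simp add: distrib_right power_divide)
  moreover have "(r + 1) * (snd y / (norm y)\<^sup>2) * (norm y)\<^sup>2 = (r + 1) * snd y"
    using ny by simp
  ultimately show main: "1 + r * (norm y)\<^sup>2 < (r + 1) * snd y" by (simp only:)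
  have ns: "(norm y)\<^sup>2 = (fst y)\<^sup>2 + (snd y)\<^sup>2" by (cases y) (simp add: norm_Pair)
  have "r * (snd y)\<^sup>2 \<le> r * (norm y)\<^sup>2" using r ns by (intro mult_left_mono) auto
  then have "1 + r * (snd y)\<^sup>2 < (r + 1) * snd y" using main by linarith
  then have "(r * snd y - 1) * (snd y - 1) < 0" by (simp add: algebra_simps power2_eq_square)
  moreover have "snd y < 1" using n(2) norm_snd_le[of "snd y" "fst y"] by auto
  ultimately have "1 < r * snd y" using mult_less_0_iff[of "r * snd y - 1" "snd y - 1"] by auto
  then show "1 / r < snd y" using pos_divide_less_eq[OF r0] by (simp add: mult.commute)
  have "r * (fst y)\<^sup>2 < (r + 1) * snd y - 1 - r * (snd y)\<^sup>2"
    using main unfolding ns by (simp add: algebra_simps)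
  also have "\<dots> = (r - 1)\<^sup>2 / (4 * r) - r * (snd y - (r + 1) / (2 * r))\<^sup>2"
    using r by (simp add: power2_eq_square field_simps)
  also have "\<dots> \<le> (r - 1)\<^sup>2 / (4 * r)" using r by simp
  also have "\<dots> \<le> r / 4" using r by (simp add: field_simps power2_eq_square)
  finally have "(fst y)\<^sup>2 < (1 / 2)\<^sup>2" using r by (simp add: power2_eq_square)
  then have "\<bar>fst y\<bar>\<^sup>2 < (1 / 2)\<^sup>2" by simp
  then show "\<bar>fst y\<bar> < 1 / 2" by (rule power2_less_imp_less) simp
qed

lemma snd_pos: "kelvin f y \<noteq> 0 \<Longrightarrow> 0 < snd y"
  using kelvin_support(4)[of y] r by (meson less_trans zero_less_divide_1_iff zero_less_one)

lemma kelvin_continuous: "continuous_on UNIV (kelvin f)"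
proof -
  have 1: "continuous_on (UNIV - {0}) (kelvin f)"
    unfolding kelvin_def[abs_def] inversion_def
    by (intro continuous_intros continuous_on_compose2[OF cont]) auto
  have 2: "continuous_on (ball 0 (1 / r)) (kelvin f)"
    using kelvin_support(2) by (subst continuous_on_cong[OF refl, of _ _ "\<lambda>_. 0"]) force+
  have "continuous_on ((UNIV - {0}) \<union> ball 0 (1 / r)) (kelvin f)"
    by (rule continuous_on_open_Un[OF _ _ 1 2]) auto
  also have "(UNIV - {0}) \<union> ball 0 (1 / r) = (UNIV :: (real \<times> real) set)" using r by auto
  finally show ?thesis .
qed

lemma kelvin_support1: "kelvin f y \<noteq> 0 \<Longrightarrow> norm y \<le> 1" 
  using kelvin_support(3)[of y] by simp

lemma kelvin_integrable: "integrable lborel (kelvin f)"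
  by (rule continuous_compact_support(1)[OF kelvin_continuous kelvin_support1])

abbreviation halfplane :: "real \<Rightarrow> real \<Rightarrow> real" where "halfplane \<equiv> halfplane_integral (kelvin f)"

abbreviation mass :: real where "mass \<equiv> (LINT y|lborel. kelvin f y)"

lemma int_kelvin_if: "Measurable.pred borel P \<Longrightarrow> integrable lborel (\<lambda>y. if P y then kelvin f y else 0)"
  by (rule Bochner_Integration.integrable_bound[OF kelvin_integrable]) auto

lemma halfplane_compl: "(LINT y|lborel. (if p < y \<bullet> dirv \<phi> then kelvin f y else 0)) = mass - halfplane p \<phi>"
proof -
  have "mass = (LINT y|lborel. (if p < y \<bullet> dirv \<phi> then kelvin f y else 0) + (if y \<bullet> dirv \<phi> < p then kelvin f y else 0))"
    by (rule integral_cong_AE) (use AE_inner_dirv_neq[of \<phi> p] in auto)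
  also have "\<dots> = (LINT y|lborel. (if p < y \<bullet> dirv \<phi> then kelvin f y else 0)) + halfplane p \<phi>"
    unfolding halfplane_integral_def by (rule Bochner_Integration.integral_add) (auto intro: int_kelvin_if)
  finally show ?thesis by simp
qed

lemma disc_transform1_eq:
  assumes "p > 0"
  shows "disc_transform1 f p \<phi> = (LINT y|lborel. (if p < y \<bullet> dirv \<phi> then kelvin f y else 0))"
proof -
  have [measurable]: "disc_through_0 (1 / p) \<phi> \<in> sets borel" by (simp add: disc_through_0_def)
  have [measurable]: "f \<in> borel_measurable borel" by (rule f_meas')
  have "disc_transform1 f p \<phi> = (LINT x|lborel. indicator (disc_through_0 (1 / p) \<phi>) x * f x)"
    by (simp add: disc_transform1_def set_lebesgue_integral_def)
  also have "\<dots> = (LINT y|lborel. indicator (disc_through_0 (1 / p) \<phi>) (inversion y) * f (inversion y) / norm y ^ 4)"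
    by (rule integral_inversion) measurable
  also have "\<dots> = (LINT y|lborel. (if p < y \<bullet> dirv \<phi> then kelvin f y else 0))"
  proof (rule Bochner_Integration.integral_cong[OF refl])
    fix y
    show "indicator (disc_through_0 (1 / p) \<phi>) (inversion y) * f (inversion y) / norm y ^ 4
       = (if p < y \<bullet> dirv \<phi> then kelvin f y else 0)"
      using disc_through_0_inversion[OF assms, of y \<phi>] by (cases "y = 0") (auto simp: kelvin_def)
  qed
  finally show ?thesis .
qed

lemma disc_transform1_0_eq: "disc_transform1_0 f \<phi> = (LINT y|lborel. (if 0 < y \<bullet> dirv \<phi> then kelvin f y else 0))"
  unfolding disc_transform1_0_def
proof (rule tendsto_Lim)
  show "((\<lambda>p. disc_transform1 f p \<phi>) \<longlongrightarrow> (LINT y|lborel. (if 0 < y \<bullet> dirv \<phi> then kelvin f y else 0))) (at_right 0)"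
  proof (rule tendsto_at_right_sequentially[of 0 1])
    fix S :: "nat \<Rightarrow> real" assume S: "\<And>n. 0 < S n" "S \<longlonglongrightarrow> 0"
    show "(\<lambda>n. disc_transform1 f (S n) \<phi>) \<longlonglongrightarrow> (LINT y|lborel. (if 0 < y \<bullet> dirv \<phi> then kelvin f y else 0))"
      unfolding disc_transform1_eq[OF S(1)]
    proof (rule integral_dominated_convergence[where w = "\<lambda>y. \<bar>kelvin f y\<bar>"])
      show "AE y in lborel. (\<lambda>n. if S n < y \<bullet> dirv \<phi> then kelvin f y else 0)
           \<longlonglongrightarrow> (if 0 < y \<bullet> dirv \<phi> then kelvin f y else 0)"
      proof (rule AE_I2)
        fix y
        have "\<forall>\<^sub>F n in sequentially. (if S n < y \<bullet> dirv \<phi> then kelvin f y else 0) = (if 0 < y \<bullet> dirv \<phi> then kelvin f y else 0)"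
        proof (cases "0 < y \<bullet> dirv \<phi>")
          case True
          from order_tendstoD(2)[OF S(2) True] show ?thesis by eventually_elim (use True in auto)
        next
          case False
          then have "\<not> S n < y \<bullet> dirv \<phi>" for n using S(1)[of n] by linarith
          then show ?thesis using False by simp
        qed
        then show "(\<lambda>n. if S n < y \<bullet> dirv \<phi> then kelvin f y else 0)
           \<longlonglongrightarrow> (if 0 < y \<bullet> dirv \<phi> then kelvin f y else 0)" by (rule tendsto_eventually)
      qed
    qed (use kelvin_integrable in auto)
  qed simp
qed simp

text \<open>
  For \<open>p > 0\<close> the transform is the mass beyond the line, for \<open>p < 0\<close> the mass before it; the correction term removes
  the jump between these two at \<open>p = 0\<close>. What remains is even under \<open>(p, \<phi>) \<mapsto> (-p, \<phi> + \<pi>)\<close>.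
\<close>

lemma disc_transform_eq: "disc_transform f p \<phi> = mass / 2 - sgn p * (halfplane p \<phi> - halfplane 0 \<phi>)"
proof -
  have opp: "(LINT y|lborel. (if - q < y \<bullet> dirv (\<phi> + pi) then kelvin f y else 0)) = halfplane q \<phi>" for q
    unfolding halfplane_integral_def by simp
  have j0: "disc_transform1_0 f \<phi> = mass - halfplane 0 \<phi>" "disc_transform1_0 f (\<phi> + pi) = halfplane 0 \<phi>"
    using halfplane_compl[of 0 \<phi>] opp[of 0] by (simp_all add: disc_transform1_0_eq)
  have pos: "disc_transform1 f p \<phi> = mass - halfplane p \<phi>" if "p > 0"
    using halfplane_compl[of p \<phi>] disc_transform1_eq[OF that] by simp
  have neg: "disc_transform1 f (- p) (\<phi> + pi) = halfplane p \<phi>" if "p < 0"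
    using opp[of p] disc_transform1_eq[of "- p" "\<phi> + pi"] that by simp
  show ?thesis
    unfolding disc_transform_def disc_transform2_def jump_correction_def j0
    using pos neg by (cases p "0::real" rule: linorder_cases) (auto simp: field_simps)
qed

lemma halfplane_bound: "\<bar>halfplane p \<phi>\<bar> \<le> (LINT y|lborel. \<bar>kelvin f y\<bar>)"
proof -
  have "\<bar>halfplane p \<phi>\<bar> \<le> (LINT y|lborel. \<bar>if y \<bullet> dirv \<phi> < p then kelvin f y else 0\<bar>)"
    unfolding halfplane_integral_def by (rule integral_abs_bound)
  also have "\<dots> \<le> (LINT y|lborel. \<bar>kelvin f y\<bar>)"
    using kelvin_integrable by (intro integral_mono') auto
  finally show ?thesis .
qed

lemma halfplane_eq_0: "(\<And>y. kelvin f y \<noteq> 0 \<Longrightarrow> p \<le> y \<bullet> dirv \<phi>) \<Longrightarrow> halfplane p \<phi> = 0"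
proof -
  assume "\<And>y. kelvin f y \<noteq> 0 \<Longrightarrow> p \<le> y \<bullet> dirv \<phi>"
  then have "(if y \<bullet> dirv \<phi> < p then kelvin f y else 0) = 0" for y
    by (metis not_le)
  then show ?thesis by (simp add: halfplane_integral_def)
qed

lemma halfplane_left:
  assumes "sin \<phi> \<ge> 0" "p \<le> - 1 / 2"
  shows "halfplane p \<phi> = 0"
proof (rule halfplane_eq_0)
  fix y assume y: "kelvin f y \<noteq> 0"
  have "\<bar>fst y * cos \<phi>\<bar> \<le> 1 / 2 * 1"
    unfolding abs_mult using kelvin_support(5)[OF y] by (intro mult_mono) auto
  moreover have "0 \<le> snd y * sin \<phi>"
    using snd_pos[OF y] assms(1) by simp
  ultimately show "p \<le> y \<bullet> dirv \<phi>" using assms(2) by (simp add: dirv_def inner_prod_def)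
qed

text \<open>
  The inverted disc has height more than \<open>1/r\<close> above the axis and half-width less than \<open>1/2\<close>, so a line of small slope
  close to the origin passes below it; the numbers \<open>1/(3r)\<close> and \<open>1/(2r)\<close> quantify this.
\<close>

lemma halfplane_near_vertical:
  assumes "\<bar>\<phi> - pi / 2\<bar> \<le> 1 / (3 * r)" "p \<le> 1 / (2 * r)"
  shows "halfplane p \<phi> = 0"
proof (rule halfplane_eq_0)
  fix y assume y: "kelvin f y \<noteq> 0"
  have "cos \<phi> = - sin (\<phi> - pi / 2)" by (simp add: sin_diff)
  then have c: "\<bar>cos \<phi>\<bar> \<le> 1 / (3 * r)" using abs_sin_x_le_abs_x[of "\<phi> - pi / 2"] assms(1) by simp
  have "\<bar>\<phi> - pi / 2\<bar> < pi / 2"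
  proof -
    have "1 / (3 * r) < 1" using r by (simp add: field_simps)
    then show ?thesis using assms(1) pi_gt3 by linarith
  qed
  then have s0: "sin \<phi> > 0" by (intro sin_gt_zero) (auto simp: abs_less_iff field_simps)
  have "(sin \<phi>)\<^sup>2 = 1 - (cos \<phi>)\<^sup>2" by (simp add: sin_squared_eq)
  moreover have "(cos \<phi>)\<^sup>2 \<le> \<bar>cos \<phi>\<bar>" using abs_cos_le_one[of \<phi>]
    by (metis abs_ge_zero mult_left_le power2_abs power2_eq_square)
  moreover have "(sin \<phi>)\<^sup>2 \<le> sin \<phi>" using s0 by (simp add: power2_eq_square mult_left_le)
  ultimately have s: "sin \<phi> \<ge> 1 - 1 / (3 * r)" using c by linarith
  have "\<bar>fst y * cos \<phi>\<bar> \<le> 1 / 2 * (1 / (3 * r))"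
    unfolding abs_mult using kelvin_support(5)[OF y] c by (intro mult_mono) auto
  moreover have "1 / r * (1 - 1 / (3 * r)) \<le> snd y * sin \<phi>"
    using kelvin_support(4)[OF y] snd_pos[OF y] r s by (intro mult_mono) (auto simp: field_simps)
  moreover have "1 / (2 * r) \<le> 1 / r * (1 - 1 / (3 * r)) - 1 / 2 * (1 / (3 * r))"
    using r by (simp add: field_simps)
  ultimately show "p \<le> y \<bullet> dirv \<phi>" using assms(2) by (simp add: dirv_def inner_prod_def)
qed

end

section \<open>Low frequencies of the inverted function\<close>

text \<open>
  Writing \<open>exp (- i \<sigma> s)\<close> as \<open>exp (- i \<sigma>)\<close> plus an integral over \<open>[s, 1]\<close> is the integration by parts in the slice
  theorem, carried out before any function is involved.
\<close>

lemma integral_iexp_interval: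
  assumes "s \<le> 1"
  shows "\<i> * of_real \<sigma> * (CLBINT p. indicator {s..1} p *\<^sub>R iexp (- (\<sigma> * p))) = iexp (- (\<sigma> * s)) - iexp (- \<sigma>)"
proof -
  have "(CLBINT p. indicator {s..1} p *\<^sub>R (\<i> * of_real \<sigma> * iexp (- (\<sigma> * p)))) = - iexp (- (\<sigma> * 1)) - - iexp (- (\<sigma> * s))"
  proof (rule integral_FTC_Icc[OF assms])
    fix x
    show "((\<lambda>p. - iexp (- (\<sigma> * p))) has_vector_derivative \<i> * of_real \<sigma> * iexp (- (\<sigma> * x))) (at x within {s..1})"
      by (auto intro!: derivative_eq_intros has_vector_derivative_real_field simp: exp_minus field_simps)
  qed (auto intro!: continuous_intros)
  also have "(CLBINT p. indicator {s..1} p *\<^sub>R (\<i> * of_real \<sigma> * iexp (- (\<sigma> * p)))) = (CLBINT p. (\<i> * of_real \<sigma>) * (indicator {s..1} p *\<^sub>R iexp (- (\<sigma> * p))))"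
    by (intro Bochner_Integration.integral_cong) (auto simp: scaleR_conv_of_real)
  also have "\<dots> = \<i> * of_real \<sigma> * (CLBINT p. indicator {s..1} p *\<^sub>R iexp (- (\<sigma> * p)))"
    by (rule integral_mult_right_zero)
  finally show ?thesis by simp
qed

lemma integrable_indicator_Icc: "integrable lborel (indicator {a..b::real} :: real \<Rightarrow> real)"
  by (rule integrable_real_indicator) (auto simp: emeasure_lborel_Icc_eq)

context disc_supported begin

text \<open>
  Outside \<open>[-1, 1]\<close> the half-plane integral is constant in \<open>p\<close> but need not vanish, so it has no Fourier integral
  without the cut-off.
\<close>

definition trunc :: "real \<Rightarrow> real \<Rightarrow> complex" where
  "trunc \<phi> p = of_real (indicator {-1..1} p * halfplane p \<phi>)"

lemma trunc_measurable [measurable]: "(\<lambda>(\<phi>, p). trunc \<phi> p) \<in> borel_measurable (borel \<Otimes>\<^sub>M borel)"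
  unfolding trunc_def halfplane_integral_def by measurable

lemma trunc_measurable1 [measurable]: "trunc \<phi> \<in> borel_measurable borel"
  using measurable_Pair2[OF trunc_measurable, of \<phi>] by simp

lemma trunc_bound: "cmod (trunc \<phi> p) \<le> (LINT y|lborel. \<bar>kelvin f y\<bar>)"
  using halfplane_bound[of p \<phi>] abs_ge_zero[of "halfplane p \<phi>"] order_trans[OF abs_ge_zero halfplane_bound]
  by (auto simp: trunc_def indicator_def)

lemma trunc_integrable: "integrable lborel (trunc \<phi>)"
proof (rule Bochner_Integration.integrable_bound)
  show "integrable lborel (\<lambda>p. indicator {-1..1::real} p * (LINT y|lborel. \<bar>kelvin f y\<bar>))"
    by (intro integrable_mult_left integrable_real_indicator) (auto simp: emeasure_lborel_Icc_eq)
  show "AE p in lborel. norm (trunc \<phi> p) \<le> norm (indicator {-1..1::real} p * (LINT y|lborel. \<bar>kelvin f y\<bar>))"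
    using halfplane_bound by (auto simp: trunc_def abs_mult indicator_def intro!: AE_I2 order_trans[OF halfplane_bound abs_ge_self])
qed simp

text \<open>
  Insert the identity of \<open>integral_iexp_interval\<close> at \<open>s = y \<bullet> \<omega>\<close>, which lies in \<open>[-1, 1]\<close> on the support, and
  integrate against the inverted function; exchanging the integrals makes the half-plane integral appear.
\<close>

lemma fourier_slice:
  "of_real (2 * pi) * fourier2 (kelvin f) (\<sigma> *\<^sub>R dirv \<phi>)
     = iexp (- \<sigma>) * of_real mass + \<i> * of_real \<sigma> * fourier1 (trunc \<phi>) \<sigma>"
proof -
  let ?K = "kelvin f"
  let ?h = "\<lambda>(y, p). of_real (?K y) * (of_real (indicator {-1..1} p * (if y \<bullet> dirv \<phi> < p then 1 else 0)) * iexp (- (\<sigma> * p)))"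
  have Kp [measurable]: "?K \<in> borel_measurable (borel \<Otimes>\<^sub>M borel)" unfolding borel_prod by measurable
  have pair: "integrable (lborel \<Otimes>\<^sub>M lborel) ?h"
  proof (rule lborel_pair.Fubini_integrable)
    have in_p: "integrable lborel (\<lambda>p. complex_of_real (indicator {-1..1} p * (if y \<bullet> dirv \<phi> < p then 1 else 0)) * iexp (- (\<sigma> * p)))" for y
      by (rule Bochner_Integration.integrable_bound[OF integrable_indicator_Icc[of "-1" 1]])
        (auto simp: norm_mult indicator_def)
    then show "AE y in lborel. integrable lborel (\<lambda>p. ?h (y, p))" by auto
    have bd: "(LBINT p. norm (complex_of_real (indicator {-1..1} p * (if y \<bullet> dirv \<phi> < p then 1 else 0)) * iexp (- (\<sigma> * p)))) \<le> 2" for y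
    proof -
      have "(LBINT p. norm (complex_of_real (indicator {-1..1} p * (if y \<bullet> dirv \<phi> < p then 1 else 0)) * iexp (- (\<sigma> * p))))
        \<le> (LBINT p. indicator {-1..1::real} p)"
        by (rule integral_mono'[OF integrable_indicator_Icc]) (auto simp: norm_mult indicator_def)
      also have "\<dots> = 2" by simp
      finally show ?thesis .
    qed
    show "integrable lborel (\<lambda>y. LBINT p. norm (?h (y, p)))"
    proof (rule Bochner_Integration.integrable_bound)
      show "integrable lborel (\<lambda>y. \<bar>?K y\<bar> * 2)" using kelvin_integrable by auto
      show "AE y in lborel. norm (LBINT p. norm (?h (y, p))) \<le> norm (\<bar>?K y\<bar> * 2)"
      proof (rule AE_I2)
        fix y
        have "(LBINT p. norm (?h (y, p))) = \<bar>?K y\<bar> * (LBINT p. norm (complex_of_real (indicator {-1..1} p * (if y \<bullet> dirv \<phi> < p then 1 else 0)) * iexp (- (\<sigma> * p))))"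
          by (simp only: prod.case norm_mult[of "of_real (?K y)"] norm_of_real integral_mult_right_zero)
        then show "norm (LBINT p. norm (?h (y, p))) \<le> norm (\<bar>?K y\<bar> * 2)"
          using bd[of y] by (simp add: abs_mult mult_left_mono)
      qed
    qed measurable
  qed measurable
  have ptw: "of_real (?K y) * exp (- (\<i> * complex_of_real (y \<bullet> (\<sigma> *\<^sub>R dirv \<phi>))))
     = of_real (?K y) * iexp (- \<sigma>) + \<i> * of_real \<sigma> * (CLBINT p. ?h (y, p))" for y
  proof (cases "?K y = 0")
    case False
    let ?s = "y \<bullet> dirv \<phi>"
    have "\<bar>?s\<bar> \<le> norm y * norm (dirv \<phi>)" by (rule Cauchy_Schwarz_ineq2)
    also have "\<dots> \<le> 1" using kelvin_support1[OF False] by simp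
    finally have s: "-1 \<le> ?s" "?s \<le> 1" by auto
    have "(CLBINT p. ?h (y, p)) = of_real (?K y) * (CLBINT p. of_real (indicator {-1..1} p * (if ?s < p then 1 else 0)) * iexp (- (\<sigma> * p)))"
      by (simp only: prod.case integral_mult_right_zero)
    also have "(CLBINT p. of_real (indicator {-1..1} p * (if ?s < p then 1 else 0)) * iexp (- (\<sigma> * p)))
       = (CLBINT p. indicator {?s..1} p *\<^sub>R iexp (- (\<sigma> * p)))"
    proof (rule integral_cong_AE)
      show "AE p in lborel. of_real (indicator {-1..1} p * (if ?s < p then 1 else 0)) * iexp (- (\<sigma> * p)) = indicator {?s..1} p *\<^sub>R iexp (- (\<sigma> * p))"
        using AE_lborel_neq[of ?s] by eventually_elim (use s in \<open>auto simp: indicator_def\<close>)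
    qed measurable
    finally have "\<i> * of_real \<sigma> * (CLBINT p. ?h (y, p))
        = of_real (?K y) * (\<i> * of_real \<sigma> * (CLBINT p. indicator {?s..1} p *\<^sub>R iexp (- (\<sigma> * p))))"
      by (simp only: mult_ac)
    then have "\<i> * of_real \<sigma> * (CLBINT p. ?h (y, p)) = of_real (?K y) * (iexp (- (\<sigma> * ?s)) - iexp (- \<sigma>))"
      unfolding integral_iexp_interval[OF s(2)] .
    then show ?thesis by (simp add: algebra_simps)
  qed simp
  have int_h: "integrable lborel (\<lambda>y. CLBINT p. ?h (y, p))"
    using lborel_pair.integrable_fst[OF pair] by simp
  have "of_real (2 * pi) * fourier2 ?K (\<sigma> *\<^sub>R dirv \<phi>)
     = (CLINT y|lborel. of_real (?K y) * exp (- (\<i> * complex_of_real (y \<bullet> (\<sigma> *\<^sub>R dirv \<phi>)))))"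
    unfolding fourier2_def mult.assoc[symmetric] of_real_mult[symmetric] by simp
  also have "\<dots> = (CLINT y|lborel. of_real (?K y) * iexp (- \<sigma>) + \<i> * of_real \<sigma> * (CLBINT p. ?h (y, p)))"
    by (simp only: ptw)
  also have "\<dots> = (CLINT y|lborel. of_real (?K y) * iexp (- \<sigma>)) + (CLINT y|lborel. \<i> * of_real \<sigma> * (CLBINT p. ?h (y, p)))"
    using kelvin_integrable int_h by (intro Bochner_Integration.integral_add) auto
  also have "\<dots> = of_real mass * iexp (- \<sigma>) + \<i> * of_real \<sigma> * (CLINT y|lborel. (CLBINT p. ?h (y, p)))"
    by (simp only: integral_mult_left_zero integral_mult_right_zero integral_complex_of_real)
  also have "(CLINT y|lborel. (CLBINT p. ?h (y, p))) = (CLBINT p. (CLINT y|lborel. ?h (y, p)))"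
    using lborel_pair.Fubini_integral[of "\<lambda>y p. ?h (y, p)"] pair by simp
  also have "\<dots> = fourier1 (trunc \<phi>) \<sigma>"
    unfolding fourier1_def
  proof (rule Bochner_Integration.integral_cong[OF refl])
    fix p
    have "(CLINT y|lborel. ?h (y, p)) = (CLINT y|lborel. of_real (if y \<bullet> dirv \<phi> < p then ?K y else 0) * (of_real (indicator {-1..1} p) * iexp (- (\<sigma> * p))))"
      by (intro Bochner_Integration.integral_cong) auto
    also have "\<dots> = of_real (halfplane p \<phi>) * (of_real (indicator {-1..1} p) * iexp (- (\<sigma> * p)))"
      by (simp only: integral_mult_left_zero integral_complex_of_real halfplane_integral_def)
    also have "\<dots> = trunc \<phi> p * iexp (- (\<sigma> * p))" by (simp add: trunc_def)
    finally show "(CLINT y|lborel. ?h (y, p)) = trunc \<phi> p * iexp (- (\<sigma> * p))" .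
  qed
  finally show ?thesis by (simp add: mult.commute)
qed

lemma fourier2_kelvin_bound:
  "(cmod (fourier2 (kelvin f) (\<sigma> *\<^sub>R dirv \<phi>)))\<^sup>2
     \<le> (mass\<^sup>2 + \<sigma>\<^sup>2 * (cmod (fourier1 (trunc \<phi>) \<sigma>))\<^sup>2) / (2 * pi\<^sup>2)"
proof -
  let ?a = "cmod (fourier2 (kelvin f) (\<sigma> *\<^sub>R dirv \<phi>))" and ?b = "cmod (fourier1 (trunc \<phi>) \<sigma>)"
  have "2 * pi * ?a = cmod (of_real (2 * pi) * fourier2 (kelvin f) (\<sigma> *\<^sub>R dirv \<phi>))"
    by (simp add: norm_mult)
  also have "\<dots> \<le> \<bar>mass\<bar> + \<bar>\<sigma>\<bar> * ?b"
    unfolding fourier_slice by (rule order_trans[OF norm_triangle_ineq]) (simp add: norm_mult)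
  finally have "(2 * pi * ?a)\<^sup>2 \<le> (\<bar>mass\<bar> + \<bar>\<sigma>\<bar> * ?b)\<^sup>2" by (intro power_mono) auto
  also have "\<dots> \<le> 2 * (mass\<^sup>2 + \<sigma>\<^sup>2 * ?b\<^sup>2)"
    using sum_squares_bound[of "\<bar>mass\<bar>" "\<bar>\<sigma>\<bar> * ?b"] by (simp add: power2_sum power_mult_distrib)
  finally show ?thesis by (simp add: power_mult_distrib field_simps)
qed

definition cyl_row :: "real \<Rightarrow> ennreal" where
  "cyl_row \<phi> = (\<integral>\<^sup>+ p. indicator {-1..1} p * ennreal ((disc_transform f p \<phi>)\<^sup>2) \<partial>lborel)"

lemma disc_transform_measurable [measurable]:
  "(\<lambda>(p, \<phi>). disc_transform f p \<phi>) \<in> borel_measurable (borel \<Otimes>\<^sub>M borel)"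
  unfolding disc_transform_eq halfplane_integral_def by measurable

lemma disc_transform_bound: "\<exists>B. \<forall>p \<phi>. (disc_transform f p \<phi>)\<^sup>2 \<le> B"
proof -
  let ?L = "LINT y|lborel. \<bar>kelvin f y\<bar>"
  have "\<bar>disc_transform f p \<phi>\<bar> \<le> \<bar>mass\<bar> + 2 * ?L" for p \<phi>
  proof -
    have "\<bar>sgn p * (halfplane p \<phi> - halfplane 0 \<phi>)\<bar> \<le> \<bar>halfplane p \<phi> - halfplane 0 \<phi>\<bar>"
      by (simp add: abs_mult sgn_if)
    also have "\<dots> \<le> 2 * ?L" using halfplane_bound[of p \<phi>] halfplane_bound[of 0 \<phi>] by linarith
    finally show ?thesis unfolding disc_transform_eq by linarith
  qed
  then have "(disc_transform f p \<phi>)\<^sup>2 \<le> (\<bar>mass\<bar> + 2 * ?L)\<^sup>2" for p \<phi>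
    by (metis abs_ge_zero power2_abs power_mono)
  then show ?thesis by blast
qed

lemma cyl_row_measurable [measurable]: "cyl_row \<in> borel_measurable borel"
  unfolding cyl_row_def by measurable

text \<open>
  The transform is bounded and measurable, so the iterated Bochner integrals in the norm agree with the iterated
  nonnegative ones.
\<close>

lemma cyl_norm_nn:
  "(\<integral>\<^sup>+ \<phi>. indicator {0..2 * pi} \<phi> * cyl_row \<phi> \<partial>lborel) = ennreal ((L2_norm_cyl (disc_transform f))\<^sup>2)"
proof -
  obtain B where B: "\<And>p \<phi>. (disc_transform f p \<phi>)\<^sup>2 \<le> B" using disc_transform_bound by blast
  have B0: "B \<ge> 0" using B[of 0 0] zero_le_power2 order_trans by blast
  define I where "I \<phi> = (LBINT p. indicator {-1..1} p * (disc_transform f p \<phi>)\<^sup>2)" for \<phi>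
  have I_meas [measurable]: "I \<in> borel_measurable borel" unfolding I_def by measurable
  have int_p: "integrable lborel (\<lambda>p. indicator {-1..1} p * (disc_transform f p \<phi>)\<^sup>2)" for \<phi>
    by (rule Bochner_Integration.integrable_bound[OF integrable_mult_right[OF integrable_indicator_Icc[of "-1" 1], of B]])
      (use B B0 in \<open>auto simp: indicator_def abs_mult\<close>)
  have row: "cyl_row \<phi> = ennreal (I \<phi>)" for \<phi>
    unfolding cyl_row_def I_def nn_integral_eq_integral[OF int_p[of \<phi>] AE_I2, symmetric, simplified]
    by (intro nn_integral_cong) (auto simp: indicator_def)
  have I0: "I \<phi> \<ge> 0" for \<phi> unfolding I_def by (rule Bochner_Integration.integral_nonneg) auto
  have IB: "I \<phi> \<le> 2 * B" for \<phi>
  proof -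
    have "I \<phi> \<le> (LBINT p. B * indicator {-1..1::real} p)"
      unfolding I_def by (rule integral_mono'[OF integrable_mult_right[OF integrable_indicator_Icc[of "-1" 1], of B]])
        (use B B0 in \<open>auto simp: indicator_def\<close>)
    then show ?thesis by simp
  qed
  have int_phi: "integrable lborel (\<lambda>\<phi>. indicator {0..2 * pi} \<phi> * I \<phi>)"
    by (rule Bochner_Integration.integrable_bound[OF integrable_mult_right[OF integrable_indicator_Icc[of 0 "2 * pi"], of "2 * B"]])
      (use IB I0 B0 in \<open>auto simp: indicator_def abs_mult\<close>)
  have "(L2_norm_cyl (disc_transform f))\<^sup>2 = (LBINT \<phi>. indicator {0..2 * pi} \<phi> * I \<phi>)"
    unfolding L2_norm_cyl_def set_lebesgue_integral_def I_def[symmetric] real_scaleR_def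
    by (rule real_sqrt_pow2, rule Bochner_Integration.integral_nonneg) (use I0 in simp)
  then show ?thesis
    unfolding row using I0
    by (simp add: nn_integral_eq_integral[OF int_phi AE_I2, symmetric])
      (auto intro!: nn_integral_cong simp: indicator_def)
qed

abbreviation cyl_sq :: ennreal where
  "cyl_sq \<equiv> ennreal ((L2_norm_cyl (disc_transform f))\<^sup>2)"

lemma nn_integral_const_Icc:
  "a \<le> b \<Longrightarrow> c \<ge> 0 \<Longrightarrow> (\<integral>\<^sup>+ x. indicator {a..b::real} x * ennreal c \<partial>lborel) = ennreal ((b - a) * c)"
  by (subst mult.commute, subst nn_integral_cmult_indicator) (auto simp: ennreal_mult'[symmetric] mult.commute)

text \<open>
  On the rectangle \<open>|\<phi> - \<pi>/2| \<le> 1/(3r)\<close>, \<open>0 \<le> p \<le> 1/(2r)\<close> the transform is constantly half the mass. The rectangle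
  has area \<open>1/(3r\<^sup>2)\<close>, and \<open>12 r\<^sup>2\<close> is four times the reciprocal.
\<close>

lemma mass_bound: "ennreal (mass\<^sup>2) \<le> ennreal (12 * r\<^sup>2) * cyl_sq"
proof -
  have r0: "r > 0" using r by simp
  define \<eta> \<delta> where "\<eta> = 1 / (3 * r)" and "\<delta> = 1 / (2 * r)"
  have \<eta>: "0 < \<eta>" "\<eta> < 1" and \<delta>: "0 < \<delta>" "\<delta> < 1" using r by (auto simp: \<eta>_def \<delta>_def field_simps)
  have row: "ennreal (\<delta> * (mass\<^sup>2 / 4)) \<le> cyl_row \<phi>" if \<phi>: "\<phi> \<in> {pi / 2 - \<eta>..pi / 2 + \<eta>}" for \<phi>
  proof -
    have D: "disc_transform f p \<phi> = mass / 2" if "p \<in> {0..\<delta>}" for p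
      using that \<phi> \<delta> halfplane_near_vertical[of \<phi> p] halfplane_near_vertical[of \<phi> 0]
      by (auto simp: disc_transform_eq \<eta>_def \<delta>_def abs_le_iff)
    have "ennreal (\<delta> * (mass\<^sup>2 / 4)) = (\<integral>\<^sup>+ p. indicator {0..\<delta>} p * ennreal (mass\<^sup>2 / 4) \<partial>lborel)"
      using \<delta> by (subst nn_integral_const_Icc) auto
    also have "\<dots> \<le> cyl_row \<phi>"
      unfolding cyl_row_def
    proof (intro nn_integral_mono)
      fix p
      show "indicator {0..\<delta>} p * ennreal (mass\<^sup>2 / 4) \<le> indicator {-1..1} p * ennreal ((disc_transform f p \<phi>)\<^sup>2)"
      proof (cases "p \<in> {0..\<delta>}")
        case True
        then show ?thesis unfolding D[OF True] using \<delta> by (simp add: power_divide)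
      qed simp
    qed
    finally show ?thesis .
  qed
  have "ennreal (2 * \<eta> * (\<delta> * (mass\<^sup>2 / 4))) = (\<integral>\<^sup>+ \<phi>. indicator {pi / 2 - \<eta>..pi / 2 + \<eta>} \<phi> * ennreal (\<delta> * (mass\<^sup>2 / 4)) \<partial>lborel)"
    using \<eta> \<delta> by (subst nn_integral_const_Icc) auto
  also have "\<dots> \<le> (\<integral>\<^sup>+ \<phi>. indicator {0..2 * pi} \<phi> * cyl_row \<phi> \<partial>lborel)"
  proof (intro nn_integral_mono)
    fix \<phi>
    have "\<phi> \<in> {0..2 * pi}" if "\<phi> \<in> {pi / 2 - \<eta>..pi / 2 + \<eta>}"
      using that \<eta> pi_gt3 by auto
    then show "indicator {pi / 2 - \<eta>..pi / 2 + \<eta>} \<phi> * ennreal (\<delta> * (mass\<^sup>2 / 4)) \<le> indicator {0..2 * pi} \<phi> * cyl_row \<phi>"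
      using row[of \<phi>] by (cases "\<phi> \<in> {pi / 2 - \<eta>..pi / 2 + \<eta>}") auto
  qed
  finally have "ennreal (12 * r\<^sup>2) * ennreal (2 * \<eta> * (\<delta> * (mass\<^sup>2 / 4))) \<le> ennreal (12 * r\<^sup>2) * cyl_sq"
    unfolding cyl_norm_nn by (rule mult_left_mono) simp
  moreover have "12 * r\<^sup>2 * (2 * \<eta> * (\<delta> * (mass\<^sup>2 / 4))) = mass\<^sup>2"
    using r0 by (simp add: \<eta>_def \<delta>_def power2_eq_square field_simps)
  moreover have "ennreal (12 * r\<^sup>2) * ennreal (2 * \<eta> * (\<delta> * (mass\<^sup>2 / 4))) = ennreal (12 * r\<^sup>2 * (2 * \<eta> * (\<delta> * (mass\<^sup>2 / 4))))"
    by (rule ennreal_mult'[symmetric]) simp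
  ultimately show ?thesis by (simp only:)
qed

text \<open>
  The transform determines half-plane integrals up to the value at \<open>p = 0\<close>. For \<open>sin \<phi> \<ge> 0\<close> the half-plane integral
  vanishes on \<open>[-1, -1/2]\<close>, where the transform therefore reveals that value.
\<close>

lemma trunc_square_bound:
  assumes "sin \<phi> \<ge> 0"
  shows "(\<integral>\<^sup>+ p. ennreal ((cmod (trunc \<phi> p))\<^sup>2) \<partial>lborel) \<le> ennreal (8 * mass\<^sup>2) + 27 * cyl_row \<phi>"
proof -
  let ?h = "halfplane 0 \<phi>"
  have h_sq: "?h\<^sup>2 \<le> mass\<^sup>2 / 2 + 2 * (disc_transform f p \<phi>)\<^sup>2" if "p \<le> - 1 / 2" for p
  proof -
    have "?h = mass / 2 - disc_transform f p \<phi>"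
      using halfplane_left[OF assms that] that by (simp add: disc_transform_eq)
    moreover have "(a - b)\<^sup>2 \<le> 2 * a\<^sup>2 + 2 * b\<^sup>2" for a b :: real
      using zero_le_power2[of "a + b"] by (simp add: power2_eq_square algebra_simps)
    from this[of "mass / 2" "disc_transform f p \<phi>"]
    have "(mass / 2 - disc_transform f p \<phi>)\<^sup>2 \<le> mass\<^sup>2 / 2 + 2 * (disc_transform f p \<phi>)\<^sup>2"
      by (simp add: power_divide)
    ultimately show ?thesis by (simp only:)
  qed
  have meas [measurable]: "(\<lambda>p. disc_transform f p \<phi>) \<in> borel_measurable borel"
    using measurable_Pair1[OF disc_transform_measurable, of \<phi>] by simp
  \<comment> \<open>the constant \<open>?h\<close> is estimated by its mean over \<open>[-1, -1/2]\<close>, an interval of length \<open>1/2\<close>\<close>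
  have "ennreal (1 / 2 * ?h\<^sup>2) = (\<integral>\<^sup>+ p. indicator {-1..-1/2::real} p * ennreal (?h\<^sup>2) \<partial>lborel)"
    by (subst nn_integral_const_Icc) auto
  also have "\<dots> \<le> (\<integral>\<^sup>+ p. indicator {-1..-1/2::real} p * ennreal (mass\<^sup>2 / 2) + 2 * (indicator {-1..1} p * ennreal ((disc_transform f p \<phi>)\<^sup>2)) \<partial>lborel)"
  proof (intro nn_integral_mono)
    fix p
    have "ennreal (?h\<^sup>2) \<le> ennreal (mass\<^sup>2 / 2) + 2 * ennreal ((disc_transform f p \<phi>)\<^sup>2)" if "p \<le> - 1 / 2"
      using ennreal_leI[OF h_sq[OF that]] by (simp add: ennreal_plus ennreal_mult)
    then show "indicator {-1..-1/2::real} p * ennreal (?h\<^sup>2)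
      \<le> indicator {-1..-1/2::real} p * ennreal (mass\<^sup>2 / 2) + 2 * (indicator {-1..1} p * ennreal ((disc_transform f p \<phi>)\<^sup>2))"
      by (cases "p \<in> {-1..-1/2::real}") auto
  qed
  also have "\<dots> = ennreal (1 / 2 * (mass\<^sup>2 / 2)) + 2 * cyl_row \<phi>"
    unfolding cyl_row_def
    by (subst nn_integral_add, measurable, subst nn_integral_const_Icc) (auto simp: nn_integral_cmult)
  finally have h0: "12 * ennreal (1 / 2 * ?h\<^sup>2) \<le> 12 * (ennreal (1 / 2 * (mass\<^sup>2 / 2)) + 2 * cyl_row \<phi>)"
    by (rule mult_left_mono) simp
  have h1: "ennreal (6 * ?h\<^sup>2) \<le> ennreal (3 * mass\<^sup>2) + 24 * cyl_row \<phi>"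
  proof -
    have "12 * ennreal (1 / 2 * ?h\<^sup>2) = ennreal (12 * (1 / 2 * ?h\<^sup>2))" by (simp only: ennreal_mult' ennreal_numeral zero_le_numeral)
    moreover have "12 * ennreal (1 / 2 * (mass\<^sup>2 / 2)) = ennreal (12 * (1 / 2 * (mass\<^sup>2 / 2)))"
      by (simp only: ennreal_mult' ennreal_numeral zero_le_numeral)
    moreover have "12 * (2 * cyl_row \<phi>) = 24 * cyl_row \<phi>" by (simp add: mult.assoc[symmetric])
    ultimately show ?thesis using h0 by (simp add: distrib_left)
  qed
  have t_sq: "(cmod (trunc \<phi> p))\<^sup>2 \<le> indicator {-1..1} p * (3 * ?h\<^sup>2 + 3 / 4 * mass\<^sup>2 + 3 * (disc_transform f p \<phi>)\<^sup>2)" for p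
  proof (cases "p \<in> {-1..1}")
    case True
    let ?D = "disc_transform f p \<phi>"
    have "halfplane p \<phi> = ?h + sgn p * (mass / 2 - ?D)"
      unfolding disc_transform_eq by (auto simp: sgn_if)
    then have "(halfplane p \<phi>)\<^sup>2 \<le> 3 * ?h\<^sup>2 + 3 / 4 * mass\<^sup>2 + 3 * ?D\<^sup>2"
    proof -
      have *: "(a + b + c)\<^sup>2 \<le> 3 * a\<^sup>2 + 3 * b\<^sup>2 + 3 * c\<^sup>2" for a b c :: real
        using zero_le_power2[of "a - b"] zero_le_power2[of "b - c"] zero_le_power2[of "a - c"]
        by (simp add: power2_eq_square algebra_simps)
      have "halfplane p \<phi> = ?h + sgn p * (mass / 2) + - sgn p * ?D"
        using \<open>halfplane p \<phi> = ?h + sgn p * (mass / 2 - ?D)\<close> by (simp add: right_diff_distrib)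
      then have "(halfplane p \<phi>)\<^sup>2 = (?h + sgn p * (mass / 2) + - sgn p * ?D)\<^sup>2" by (simp only:)
      also have "\<dots> \<le> 3 * ?h\<^sup>2 + 3 * (sgn p * (mass / 2))\<^sup>2 + 3 * (- sgn p * ?D)\<^sup>2" by (rule *)
      also have "\<dots> \<le> 3 * ?h\<^sup>2 + 3 / 4 * mass\<^sup>2 + 3 * ?D\<^sup>2"
        by (auto simp: sgn_if power_mult_distrib power_divide)
      finally show ?thesis .
    qed
    then show ?thesis using True by (simp add: trunc_def)
  qed (simp add: trunc_def)
  have "(\<integral>\<^sup>+ p. ennreal ((cmod (trunc \<phi> p))\<^sup>2) \<partial>lborel)
     \<le> (\<integral>\<^sup>+ p. indicator {-1..1::real} p * ennreal (3 * ?h\<^sup>2 + 3 / 4 * mass\<^sup>2) + 3 * (indicator {-1..1} p * ennreal ((disc_transform f p \<phi>)\<^sup>2)) \<partial>lborel)"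
  proof (intro nn_integral_mono)
    fix p
    show "ennreal ((cmod (trunc \<phi> p))\<^sup>2) \<le> indicator {-1..1::real} p * ennreal (3 * ?h\<^sup>2 + 3 / 4 * mass\<^sup>2) + 3 * (indicator {-1..1} p * ennreal ((disc_transform f p \<phi>)\<^sup>2))"
      using ennreal_leI[OF t_sq[of p]] by (cases "p \<in> {-1..1}") (auto simp: ennreal_plus ennreal_mult)
  qed
  also have "\<dots> = ennreal (2 * (3 * ?h\<^sup>2 + 3 / 4 * mass\<^sup>2)) + 3 * cyl_row \<phi>"
    unfolding cyl_row_def
    by (subst nn_integral_add, measurable, subst nn_integral_const_Icc) (auto simp: nn_integral_cmult)
  also have "ennreal (2 * (3 * ?h\<^sup>2 + 3 / 4 * mass\<^sup>2)) = ennreal (6 * ?h\<^sup>2) + ennreal (3 / 2 * mass\<^sup>2)"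
    by (subst ennreal_plus[symmetric]) (auto simp: algebra_simps)
  also have "ennreal (6 * ?h\<^sup>2) + ennreal (3 / 2 * mass\<^sup>2) + 3 * cyl_row \<phi>
      \<le> (ennreal (3 * mass\<^sup>2) + 24 * cyl_row \<phi>) + ennreal (3 / 2 * mass\<^sup>2) + 3 * cyl_row \<phi>"
    by (intro add_right_mono h1)
  also have "\<dots> = (ennreal (3 * mass\<^sup>2) + ennreal (3 / 2 * mass\<^sup>2)) + (24 * cyl_row \<phi> + 3 * cyl_row \<phi>)"
    by (simp only: add_ac)
  also have "24 * cyl_row \<phi> + 3 * cyl_row \<phi> = 27 * cyl_row \<phi>"
    by (simp add: distrib_right[symmetric])
  also have "ennreal (3 * mass\<^sup>2) + ennreal (3 / 2 * mass\<^sup>2) + 27 * cyl_row \<phi> \<le> ennreal (8 * mass\<^sup>2) + 27 * cyl_row \<phi>"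
    by (intro add_right_mono, subst ennreal_plus[symmetric]) (auto intro!: ennreal_leI)
  finally show ?thesis .
qed

text \<open>
  On the line in direction \<open>\<phi>\<close> the slice theorem costs a factor \<open>\<sigma>\<^sup>2\<close> and the Jacobian of polar coordinates a factor
  \<open>|\<sigma>|\<close>; both are bounded by powers of \<open>A\<close>, and Bessel's inequality returns to the variable \<open>p\<close>.
\<close>

lemma low_frequency_ray:
  assumes A: "A \<ge> 1" and \<phi>: "sin \<phi> \<ge> 0"
  shows "(\<integral>\<^sup>+ \<sigma>. ennreal \<bar>\<sigma>\<bar> * (indicator {\<xi>. norm \<xi> < A} (\<sigma> *\<^sub>R dirv \<phi>) * power_spectrum (kelvin f) (\<sigma> *\<^sub>R dirv \<phi>)) \<partial>lborel)
    \<le> ennreal (A ^ 3) * (ennreal (66 * mass\<^sup>2) + 216 * cyl_row \<phi>)"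
proof -
  let ?I = "\<lambda>\<sigma>. ennreal \<bar>\<sigma>\<bar> * (indicator {\<xi>. norm \<xi> < A} (\<sigma> *\<^sub>R dirv \<phi>) * power_spectrum (kelvin f) (\<sigma> *\<^sub>R dirv \<phi>))"
  let ?b = "\<lambda>\<sigma>. cmod (fourier1 (trunc \<phi>) \<sigma>)"
  have "(\<integral>\<^sup>+ \<sigma>. ?I \<sigma> \<partial>lborel)
    \<le> (\<integral>\<^sup>+ \<sigma>. indicator {-A..A} \<sigma> * ennreal (A * mass\<^sup>2) + ennreal (A ^ 3) * ennreal ((?b \<sigma>)\<^sup>2) \<partial>lborel)"
  proof (rule nn_integral_mono)
    fix \<sigma> :: real
    show "?I \<sigma>
      \<le> indicator {-A..A} \<sigma> * ennreal (A * mass\<^sup>2) + ennreal (A ^ 3) * ennreal ((?b \<sigma>)\<^sup>2)"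
    proof (cases "\<bar>\<sigma>\<bar> < A")
      case True
      have "\<sigma>\<^sup>2 \<le> A\<^sup>2" using True abs_le_square_iff[of \<sigma> A] by simp
      have pi2: "2 * pi\<^sup>2 \<ge> 1" using one_le_power[of pi 2] pi_gt3 by linarith
      have "(cmod (fourier2 (kelvin f) (\<sigma> *\<^sub>R dirv \<phi>)))\<^sup>2 \<le> (mass\<^sup>2 + \<sigma>\<^sup>2 * (?b \<sigma>)\<^sup>2) / (2 * pi\<^sup>2)"
        by (rule fourier2_kelvin_bound)
      also have "\<dots> \<le> (mass\<^sup>2 + \<sigma>\<^sup>2 * (?b \<sigma>)\<^sup>2) / 1"
        using pi2 by (intro divide_left_mono) auto
      also have "\<dots> \<le> mass\<^sup>2 + A\<^sup>2 * (?b \<sigma>)\<^sup>2"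
        using \<open>\<sigma>\<^sup>2 \<le> A\<^sup>2\<close> by (auto intro: mult_right_mono)
      finally have "\<bar>\<sigma>\<bar> * (cmod (fourier2 (kelvin f) (\<sigma> *\<^sub>R dirv \<phi>)))\<^sup>2 \<le> A * (mass\<^sup>2 + A\<^sup>2 * (?b \<sigma>)\<^sup>2)"
        using True A by (intro mult_mono) auto
      also have "\<dots> = A * mass\<^sup>2 + A ^ 3 * (?b \<sigma>)\<^sup>2" by (simp add: algebra_simps power3_eq_cube power2_eq_square)
      finally have "ennreal (\<bar>\<sigma>\<bar> * (cmod (fourier2 (kelvin f) (\<sigma> *\<^sub>R dirv \<phi>)))\<^sup>2) \<le> ennreal (A * mass\<^sup>2 + A ^ 3 * (?b \<sigma>)\<^sup>2)"
        by (rule ennreal_leI)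
      also have "\<dots> = ennreal (A * mass\<^sup>2) + ennreal (A ^ 3) * ennreal ((?b \<sigma>)\<^sup>2)"
        using A by (subst ennreal_plus) (auto simp: ennreal_mult)
      finally show ?thesis using True by (simp add: ennreal_mult abs_less_iff less_imp_le)
    qed simp
  qed
  also have "\<dots> = ennreal ((A - (- A)) * (A * mass\<^sup>2)) + ennreal (A ^ 3) * (\<integral>\<^sup>+ \<sigma>. ennreal ((?b \<sigma>)\<^sup>2) \<partial>lborel)"
    using A by (subst nn_integral_add, measurable, subst nn_integral_const_Icc) (auto simp: nn_integral_cmult)
  also have "\<dots> \<le> ennreal (A ^ 3) * ennreal (2 * mass\<^sup>2) + ennreal (A ^ 3) * (ennreal (64 * mass\<^sup>2) + 216 * cyl_row \<phi>)"
  proof (rule add_mono)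
    have "(A - (- A)) * (A * mass\<^sup>2) = A\<^sup>2 * (2 * mass\<^sup>2)" by (simp add: power2_eq_square)
    also have "\<dots> \<le> A ^ 3 * (2 * mass\<^sup>2)" using A by (intro mult_right_mono power_increasing) auto
    finally show "ennreal ((A - (- A)) * (A * mass\<^sup>2)) \<le> ennreal (A ^ 3) * ennreal (2 * mass\<^sup>2)"
      using A by (subst ennreal_mult'[symmetric]) (auto intro!: ennreal_leI)
    have "(\<integral>\<^sup>+ \<sigma>. ennreal ((?b \<sigma>)\<^sup>2) \<partial>lborel) \<le> ennreal (2 * pi) * (\<integral>\<^sup>+ p. ennreal ((cmod (trunc \<phi> p))\<^sup>2) \<partial>lborel)"
      by (rule bessel_fourier1[OF trunc_integrable trunc_bound])
    also have "\<dots> \<le> ennreal 8 * (ennreal (8 * mass\<^sup>2) + 27 * cyl_row \<phi>)"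
      using pi_less_4 by (intro mult_mono trunc_square_bound[OF \<phi>] ennreal_leI) auto
    also have "\<dots> = ennreal 8 * ennreal (8 * mass\<^sup>2) + 8 * 27 * cyl_row \<phi>"
      by (simp add: distrib_left mult.assoc)
    also have "\<dots> = ennreal (64 * mass\<^sup>2) + 216 * cyl_row \<phi>"
      by (subst ennreal_mult'[symmetric]) auto
    finally show "ennreal (A ^ 3) * (\<integral>\<^sup>+ \<sigma>. ennreal ((?b \<sigma>)\<^sup>2) \<partial>lborel) \<le> ennreal (A ^ 3) * (ennreal (64 * mass\<^sup>2) + 216 * cyl_row \<phi>)"
      by (rule mult_left_mono) simp
  qed
  also have "\<dots> = ennreal (A ^ 3) * ((ennreal (2 * mass\<^sup>2) + ennreal (64 * mass\<^sup>2)) + 216 * cyl_row \<phi>)"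
    by (simp only: distrib_left add.assoc)
  also have "ennreal (2 * mass\<^sup>2) + ennreal (64 * mass\<^sup>2) = ennreal (66 * mass\<^sup>2)"
    by (subst ennreal_plus[symmetric]) auto
  finally show ?thesis .
qed

lemma low_frequency:
  assumes A: "A \<ge> 1"
  shows "(\<integral>\<^sup>+ \<xi>. indicator {\<xi>. norm \<xi> < A} \<xi> * power_spectrum (kelvin f) \<xi> \<partial>lborel)
    \<le> ennreal (A ^ 3 * (3168 * r\<^sup>2 + 216)) * cyl_sq"
proof -
  let ?I = "\<lambda>\<phi> \<sigma>. ennreal \<bar>\<sigma>\<bar> * (indicator {\<xi>. norm \<xi> < A} (\<sigma> *\<^sub>R dirv \<phi>) * power_spectrum (kelvin f) (\<sigma> *\<^sub>R dirv \<phi>))"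
  have [measurable]: "{\<xi> :: real \<times> real. norm \<xi> < A} \<in> sets borel" by measurable
  have "(\<integral>\<^sup>+ \<xi>. indicator {\<xi>. norm \<xi> < A} \<xi> * power_spectrum (kelvin f) \<xi> \<partial>lborel)
     = (\<integral>\<^sup>+ \<phi>. indicator {0<..<pi} \<phi> * (\<integral>\<^sup>+ \<sigma>. ?I \<phi> \<sigma> \<partial>lborel) \<partial>lborel)"
    by (rule nn_integral_polar) measurable
  also have "\<dots> \<le> (\<integral>\<^sup>+ \<phi>. ennreal (A ^ 3) * (indicator {0..pi} \<phi> * ennreal (66 * mass\<^sup>2) + 216 * (indicator {0..2 * pi} \<phi> * cyl_row \<phi>)) \<partial>lborel)"
  proof (rule nn_integral_mono)
    fix \<phi>
    show "indicator {0<..<pi} \<phi> * (\<integral>\<^sup>+ \<sigma>. ?I \<phi> \<sigma> \<partial>lborel)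
      \<le> ennreal (A ^ 3) * (indicator {0..pi} \<phi> * ennreal (66 * mass\<^sup>2) + 216 * (indicator {0..2 * pi} \<phi> * cyl_row \<phi>))"
    proof (cases "\<phi> \<in> {0<..<pi}")
      case True
      then have "sin \<phi> \<ge> 0" by (intro sin_ge_zero) auto
      from low_frequency_ray[OF A this] True show ?thesis by simp
    qed simp
  qed
  also have "\<dots> = ennreal (A ^ 3) * (ennreal (pi * (66 * mass\<^sup>2)) + 216 * cyl_sq)"
    unfolding cyl_norm_nn[symmetric]
    by (subst nn_integral_cmult, measurable, subst nn_integral_add, measurable, subst nn_integral_const_Icc)
      (auto simp: nn_integral_cmult)
  also have "\<dots> \<le> ennreal (A ^ 3) * (ennreal (3168 * r\<^sup>2) * cyl_sq + 216 * cyl_sq)"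
  proof (intro mult_left_mono add_right_mono)
    have "pi * (66 * mass\<^sup>2) \<le> 4 * (66 * mass\<^sup>2)" using pi_less_4 by (intro mult_right_mono) auto
    then have "ennreal (pi * (66 * mass\<^sup>2)) \<le> ennreal (264 * mass\<^sup>2)" by (intro ennreal_leI) simp
    also have "\<dots> = ennreal 264 * ennreal (mass\<^sup>2)" by (rule ennreal_mult') simp
    also have "\<dots> \<le> ennreal 264 * (ennreal (12 * r\<^sup>2) * cyl_sq)" by (intro mult_left_mono mass_bound) simp
    also have "\<dots> = (ennreal 264 * ennreal (12 * r\<^sup>2)) * cyl_sq" by (simp only: mult.assoc)
    also have "ennreal 264 * ennreal (12 * r\<^sup>2) = ennreal (3168 * r\<^sup>2)" by (subst ennreal_mult'[symmetric]) auto
    finally show "ennreal (pi * (66 * mass\<^sup>2)) \<le> ennreal (3168 * r\<^sup>2) * cyl_sq" .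
  qed simp
  also have "\<dots> = ennreal (A ^ 3) * ((ennreal (3168 * r\<^sup>2) + ennreal 216) * cyl_sq)"
    by (simp add: distrib_right)
  also have "ennreal (3168 * r\<^sup>2) + ennreal 216 = ennreal (3168 * r\<^sup>2 + 216)" by (subst ennreal_plus) auto
  also have "ennreal (A ^ 3) * (ennreal (3168 * r\<^sup>2 + 216) * cyl_sq) = ennreal (A ^ 3 * (3168 * r\<^sup>2 + 216)) * cyl_sq"
    using A by (subst ennreal_mult') (auto simp: mult.assoc)
  finally show ?thesis .
qed

end

section \<open>The modulus of continuity under inversion\<close>

lemma fourth_power_lipschitz:
  fixes u v B :: real
  assumes "0 \<le> u" "u \<le> B" "0 \<le> v" "v \<le> B"
  shows "\<bar>u ^ 4 - v ^ 4\<bar> \<le> 4 * B ^ 3 * \<bar>u - v\<bar>"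
proof -
  have "u ^ 4 - v ^ 4 = (u - v) * ((u + v) * (u\<^sup>2 + v\<^sup>2))"
    by (simp add: algebra_simps power2_eq_square eval_nat_numeral)
  then have "\<bar>u ^ 4 - v ^ 4\<bar> = \<bar>u - v\<bar> * ((u + v) * (u\<^sup>2 + v\<^sup>2))"
    using assms by (simp add: abs_mult)
  also have "\<dots> \<le> \<bar>u - v\<bar> * ((B + B) * (B\<^sup>2 + B\<^sup>2))"
    using assms by (intro mult_left_mono mult_mono add_mono power_mono) auto
  finally show ?thesis by (simp add: algebra_simps power2_eq_square power3_eq_cube)
qed

text \<open>
  Constants of the estimate \<open>kelvin_diff_bound\<close>. The first bounds the squared density \<open>|x|\<^sup>8 \<le> (2r)\<^sup>8\<close> and the
  Jacobians of both points, the second contains the Lipschitz constant \<open>128 r\<^sup>5\<close> of the density \<open>|y|\<^bsup>-4\<^esup>\<close> near the support.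
\<close>

definition modulus_const :: "real \<Rightarrow> real" where
  "modulus_const r = 512 * (2 * r) ^ 8"

definition weight_const :: "real \<Rightarrow> real" where
  "weight_const r = 32 * (128 * r ^ 5)\<^sup>2"

context disc_supported begin

abbreviation C1 :: real where "C1 \<equiv> modulus_const r"
abbreviation C2 :: real where "C2 \<equiv> weight_const r"

lemma kelvin_eq: "kelvin f y = norm (inversion y) ^ 4 * f (inversion y)"
  by (simp add: kelvin_def norm_inversion power_divide)

text \<open>
  A difference of products, split into a difference of values of \<open>f\<close> and a difference of densities. If either point lies
  in the support, both have norm between \<open>1/(2r)\<close> and \<open>2\<close>, where inversion and density are Lipschitz. The bound
  carries the Jacobians \<open>|y|\<^bsup>-4\<^esup>\<close> and \<open>|z|\<^bsup>-4\<^esup>\<close>, to be ready for the change of variables.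
\<close>

lemma kelvin_diff_bound:
  assumes s: "0 < s" "s \<le> 1 / (2 * r)" and close: "norm (y - z) < s"
    and nz: "kelvin f y \<noteq> kelvin f z"
  shows "norm (inversion y - inversion z) < 4 * r\<^sup>2 * s"
    and "(kelvin f y - kelvin f z)\<^sup>2 \<le>
      C1 * (f (inversion y) - f (inversion z))\<^sup>2 / (norm y ^ 4 * norm z ^ 4) + C2 * s\<^sup>2 * (f (inversion z))\<^sup>2 / norm z ^ 4"
proof -
  have r0: "r > 0" using r by simp
  have "kelvin f y \<noteq> 0 \<or> kelvin f z \<noteq> 0" using nz by auto
  then have one: "(1 / r < norm y \<and> norm y < 1) \<or> (1 / r < norm z \<and> norm z < 1)"
    using kelvin_support(2,3) by blast
  have yz: "\<bar>norm y - norm z\<bar> < s" using close norm_triangle_ineq3[of y z] by linarith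
  have half: "1 / r = 2 * (1 / (2 * r))" by simp
  have "1 / (2 * r) < 1" using r by (simp add: field_simps)
  then have ny: "1 / (2 * r) < norm y" "norm y < 2" and nz': "1 / (2 * r) < norm z" "norm z < 2"
    using one yz s half by linarith+
  have pos: "norm y > 0" "norm z > 0" using ny nz' r0 by (auto intro: less_trans[of 0 "1 / (2 * r)"])
  then have y0: "y \<noteq> 0" "z \<noteq> 0" by auto
  let ?u = "norm (inversion y)" and ?v = "norm (inversion z)"
  have u: "1 / 2 \<le> ?u" "?u \<le> 2 * r" and v: "1 / 2 \<le> ?v" "?v \<le> 2 * r"
    using ny nz' pos r0 by (auto simp: norm_inversion field_simps)
  have "norm (inversion y - inversion z) = norm (y - z) * (?u * ?v)"
    using norm_inversion_diff[OF y0] by (simp add: norm_inversion)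
  also have "\<dots> \<le> norm (y - z) * ((2 * r) * (2 * r))"
    using u v r0 by (intro mult_left_mono mult_mono) auto
  also have "\<dots> < s * ((2 * r) * (2 * r))" using close r0 by (intro mult_strict_right_mono) auto
  finally show dist: "norm (inversion y - inversion z) < 4 * r\<^sup>2 * s" by (simp add: power2_eq_square mult_ac)
  let ?a = "f (inversion y)" and ?b = "f (inversion z)"
  have "\<bar>?u ^ 4 - ?v ^ 4\<bar> \<le> 4 * (2 * r) ^ 3 * \<bar>?u - ?v\<bar>"
    using u v by (intro fourth_power_lipschitz) auto
  also have "\<dots> \<le> 4 * (2 * r) ^ 3 * (4 * r\<^sup>2 * s)"
    using dist norm_triangle_ineq3[of "inversion y" "inversion z"] r0 by (intro mult_left_mono) auto
  also have "\<dots> = 128 * r ^ 5 * s" by (simp add: eval_nat_numeral)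
  finally have lip: "(?u ^ 4 - ?v ^ 4)\<^sup>2 \<le> (128 * r ^ 5 * s)\<^sup>2"
    by (metis abs_ge_zero power2_abs power_mono)
  have sq: "(a + b)\<^sup>2 \<le> 2 * a\<^sup>2 + 2 * b\<^sup>2" for a b :: real
    using zero_le_power2[of "a - b"] by (simp add: power2_eq_square algebra_simps)
  \<comment> \<open>since \<open>|y| < 2\<close>, each Jacobian can be inserted at the cost of a factor \<open>16\<close>\<close>
  have w: "1 \<le> 16 * ?u ^ 4" "1 \<le> 16 * ?v ^ 4"
    using power_mono[OF u(1), of 4] power_mono[OF v(1), of 4] by (auto simp: power_divide)
  have "kelvin f y - kelvin f z = ?u ^ 4 * (?a - ?b) + (?u ^ 4 - ?v ^ 4) * ?b"
    by (simp add: kelvin_eq algebra_simps)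
  then have "(kelvin f y - kelvin f z)\<^sup>2 \<le> 2 * (?u ^ 4 * (?a - ?b))\<^sup>2 + 2 * ((?u ^ 4 - ?v ^ 4) * ?b)\<^sup>2"
    using sq by simp
  also have "\<dots> = 2 * ?u ^ 8 * (?a - ?b)\<^sup>2 + 2 * (?u ^ 4 - ?v ^ 4)\<^sup>2 * ?b\<^sup>2"
    by (simp add: power_mult_distrib power_mult[symmetric])
  also have "\<dots> \<le> 2 * (2 * r) ^ 8 * (?a - ?b)\<^sup>2 * ((16 * ?u ^ 4) * (16 * ?v ^ 4)) + 2 * (128 * r ^ 5 * s)\<^sup>2 * ?b\<^sup>2 * (16 * ?v ^ 4)"
  proof (rule add_mono)
    have A: "2 * ?u ^ 8 * (?a - ?b)\<^sup>2 \<le> 2 * (2 * r) ^ 8 * (?a - ?b)\<^sup>2"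
      using u by (intro mult_right_mono mult_left_mono power_mono) auto
    have B: "1 * 1 \<le> (16 * ?u ^ 4) * (16 * ?v ^ 4)" using w by (intro mult_mono) auto
    have "2 * ?u ^ 8 * (?a - ?b)\<^sup>2 * (1 * 1) \<le> 2 * (2 * r) ^ 8 * (?a - ?b)\<^sup>2 * ((16 * ?u ^ 4) * (16 * ?v ^ 4))"
      by (rule mult_mono[OF A B]) (use r0 in auto)
    then show "2 * ?u ^ 8 * (?a - ?b)\<^sup>2 \<le> 2 * (2 * r) ^ 8 * (?a - ?b)\<^sup>2 * ((16 * ?u ^ 4) * (16 * ?v ^ 4))" by simp
    have "2 * (?u ^ 4 - ?v ^ 4)\<^sup>2 * ?b\<^sup>2 * 1 \<le> 2 * (128 * r ^ 5 * s)\<^sup>2 * ?b\<^sup>2 * (16 * ?v ^ 4)"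
      using lip w by (intro mult_mono) auto
    then show "2 * (?u ^ 4 - ?v ^ 4)\<^sup>2 * ?b\<^sup>2 \<le> 2 * (128 * r ^ 5 * s)\<^sup>2 * ?b\<^sup>2 * (16 * ?v ^ 4)" by simp
  qed
  also have "\<dots> = C1 * (?a - ?b)\<^sup>2 / (norm y ^ 4 * norm z ^ 4) + C2 * s\<^sup>2 * ?b\<^sup>2 / norm z ^ 4"
    unfolding modulus_const_def weight_const_def norm_inversion power_divide power_one power_mult_distrib by simp
  finally show "(kelvin f y - kelvin f z)\<^sup>2 \<le>
      C1 * (?a - ?b)\<^sup>2 / (norm y ^ 4 * norm z ^ 4) + C2 * s\<^sup>2 * ?b\<^sup>2 / norm z ^ 4" .
qed

lemma C_nonneg: "C1 \<ge> 0" "C2 \<ge> 0" using r by (auto simp: modulus_const_def weight_const_def)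

text \<open>
  Integrate \<open>kelvin_diff_bound\<close> and substitute the inversion in both variables; in the term with the density difference
  the first variable only contributes the area of a disc.
\<close>

lemma modulus2_kelvin:
  assumes s: "0 < s" "s \<le> 1 / (2 * r)"
  shows "modulus2 (kelvin f) s \<le> ennreal C1 * modulus2 f (4 * r\<^sup>2 * s) + ennreal (4 * C2 * s ^ 4) * L2_energy f"
proof -
  have [measurable]: "f \<in> borel_measurable borel" by (rule f_meas')
  have [measurable]: "{h :: real \<times> real. norm h < c} \<in> sets borel" for c by measurable
  let ?\<Phi> = "\<lambda>x x'. indicator {h. norm h < 4 * r\<^sup>2 * s} (x - x') * ennreal ((f x - f x')\<^sup>2)"
  let ?w = "\<lambda>y :: real \<times> real. ennreal (1 / norm y ^ 4)"
  have "modulus2 (kelvin f) s \<le>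
     (\<integral>\<^sup>+ z. \<integral>\<^sup>+ y. ennreal C1 * (?\<Phi> (inversion y) (inversion z) * ?w y * ?w z)
        + ennreal (C2 * s\<^sup>2) * (indicator {h. norm h < s} (y - z) * (ennreal ((f (inversion z))\<^sup>2) * ?w z)) \<partial>lborel \<partial>lborel)"
    unfolding modulus2_def
  proof (intro nn_integral_mono)
    fix z y :: "real \<times> real"
    show "indicator {h. norm h < s} (y - z) * ennreal ((kelvin f y - kelvin f z)\<^sup>2)
      \<le> ennreal C1 * (?\<Phi> (inversion y) (inversion z) * ?w y * ?w z)
        + ennreal (C2 * s\<^sup>2) * (indicator {h. norm h < s} (y - z) * (ennreal ((f (inversion z))\<^sup>2) * ?w z))"
    proof (cases "norm (y - z) < s \<and> kelvin f y \<noteq> kelvin f z")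
      case True
      have "ennreal ((kelvin f y - kelvin f z)\<^sup>2) \<le>
        ennreal (C1 * ((f (inversion y) - f (inversion z))\<^sup>2 * (1 / norm y ^ 4) * (1 / norm z ^ 4)) + C2 * s\<^sup>2 * ((f (inversion z))\<^sup>2 * (1 / norm z ^ 4)))"
        using kelvin_diff_bound(2)[OF s, of y z] True by (intro ennreal_leI) auto
      also have "\<dots> = ennreal C1 * (ennreal ((f (inversion y) - f (inversion z))\<^sup>2) * ?w y * ?w z)
        + ennreal (C2 * s\<^sup>2) * (ennreal ((f (inversion z))\<^sup>2) * ?w z)"
      proof -
        have split: "ennreal (C1 * (a * u * v) + D * (b * v)) = ennreal C1 * (ennreal a * ennreal u * ennreal v) + ennreal D * (ennreal b * ennreal v)"
          if "0 \<le> a" "0 \<le> b" "0 \<le> u" "0 \<le> v" "0 \<le> D" for a b u v D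
          using that C_nonneg by (simp add: ennreal_plus ennreal_mult)
        show ?thesis by (rule split) (use C_nonneg in auto)
      qed
      finally show ?thesis using True kelvin_diff_bound(1)[OF s, of y z] by simp
    qed auto
  qed
  also have "\<dots> = (\<integral>\<^sup>+ z. ennreal C1 * ((\<integral>\<^sup>+ y. ?\<Phi> (inversion y) (inversion z) * ?w y \<partial>lborel) * ?w z)
        + ennreal (C2 * s\<^sup>2) * ((\<integral>\<^sup>+ y. indicator {h. norm h < s} (y - z) \<partial>lborel) * (ennreal ((f (inversion z))\<^sup>2) * ?w z)) \<partial>lborel)"
    by (simp add: nn_integral_add nn_integral_cmult nn_integral_multc)
  also have "\<dots> \<le> (\<integral>\<^sup>+ z. ennreal C1 * ((\<integral>\<^sup>+ x. ?\<Phi> x (inversion z) \<partial>lborel) * ?w z)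
        + ennreal (C2 * s\<^sup>2) * (ennreal (4 * s\<^sup>2) * (ennreal ((f (inversion z))\<^sup>2) * ?w z)) \<partial>lborel)"
  proof (intro nn_integral_mono)
    fix z
    have 1: "(\<integral>\<^sup>+ y. ?\<Phi> (inversion y) (inversion z) * ?w y \<partial>lborel) \<le> (\<integral>\<^sup>+ x. ?\<Phi> x (inversion z) \<partial>lborel)"
      by (subst nn_integral_inversion[of "\<lambda>x. ?\<Phi> x (inversion z)"]) auto
    have "(\<integral>\<^sup>+ y. indicator {h. norm h < s} (y - z) \<partial>lborel) = (\<integral>\<^sup>+ y. indicator {h :: real \<times> real. norm h < s} y \<partial>lborel)"
      using nn_integral_lborel_translation[of "indicator {h. norm h < s}" "- z"] by simp
    also have "\<dots> \<le> ennreal (4 * s\<^sup>2)" using emeasure_norm_less by simp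
    finally have 2: "(\<integral>\<^sup>+ y. indicator {h. norm h < s} (y - z) \<partial>lborel) \<le> ennreal (4 * s\<^sup>2)" .
    show "ennreal C1 * ((\<integral>\<^sup>+ y. ?\<Phi> (inversion y) (inversion z) * ?w y \<partial>lborel) * ?w z)
        + ennreal (C2 * s\<^sup>2) * ((\<integral>\<^sup>+ y. indicator {h. norm h < s} (y - z) \<partial>lborel) * (ennreal ((f (inversion z))\<^sup>2) * ?w z))
      \<le> ennreal C1 * ((\<integral>\<^sup>+ x. ?\<Phi> x (inversion z) \<partial>lborel) * ?w z)
        + ennreal (C2 * s\<^sup>2) * (ennreal (4 * s\<^sup>2) * (ennreal ((f (inversion z))\<^sup>2) * ?w z))"
      by (intro add_mono mult_left_mono mult_right_mono 1 2) auto
  qed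
  also have "\<dots> = ennreal C1 * (\<integral>\<^sup>+ z. (\<integral>\<^sup>+ x. ?\<Phi> x (inversion z) \<partial>lborel) * ?w z \<partial>lborel)
        + ennreal (C2 * s\<^sup>2) * (ennreal (4 * s\<^sup>2) * (\<integral>\<^sup>+ z. ennreal ((f (inversion z))\<^sup>2) * ?w z \<partial>lborel))"
    by (simp add: nn_integral_add nn_integral_cmult)
  also have "(\<integral>\<^sup>+ z. (\<integral>\<^sup>+ x. ?\<Phi> x (inversion z) \<partial>lborel) * ?w z \<partial>lborel) = modulus2 f (4 * r\<^sup>2 * s)"
    unfolding modulus2_def by (rule nn_integral_inversion[symmetric]) measurable
  also have "(\<integral>\<^sup>+ z. ennreal ((f (inversion z))\<^sup>2) * ?w z \<partial>lborel) = L2_energy f"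
    by (rule nn_integral_inversion[symmetric]) measurable
  also have "ennreal (C2 * s\<^sup>2) * (ennreal (4 * s\<^sup>2) * L2_energy f)
      = ennreal (4 * C2 * s ^ 4) * L2_energy f"
  proof -
    have nn: "0 \<le> C2 * s\<^sup>2" using C_nonneg by simp
    have "ennreal (C2 * s\<^sup>2) * ennreal (4 * s\<^sup>2) = ennreal (C2 * s\<^sup>2 * (4 * s\<^sup>2))"
      by (rule ennreal_mult'[OF nn, symmetric])
    also have "C2 * s\<^sup>2 * (4 * s\<^sup>2) = 4 * C2 * s ^ 4" by (simp add: power2_eq_square eval_nat_numeral)
    finally have "ennreal (C2 * s\<^sup>2) * ennreal (4 * s\<^sup>2) = ennreal (4 * C2 * s ^ 4)" .
    then show ?thesis by (simp only: mult.assoc[symmetric])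
  qed
  finally show ?thesis .
qed

text \<open>
  The density is at least \<open>1\<close> on the support, which lies inside the unit disc.
\<close>

lemma L2_le_kelvin: "L2_energy f \<le> L2_energy (kelvin f)"
proof -
  have [measurable]: "f \<in> borel_measurable borel" by (rule f_meas')
  have "L2_energy f = (\<integral>\<^sup>+ y. ennreal ((f (inversion y))\<^sup>2) * ennreal (1 / norm y ^ 4) \<partial>lborel)"
    by (rule nn_integral_inversion) measurable
  also have "\<dots> \<le> L2_energy (kelvin f)"
  proof (rule nn_integral_mono)
    fix y
    have "(f (inversion y))\<^sup>2 * (1 / norm y ^ 4) \<le> (kelvin f y)\<^sup>2"
    proof (cases "kelvin f y = 0")
      case True
      then show ?thesis by (auto simp: kelvin_def)
    next
      case False
      from kelvin_support(2,3)[OF this] r have n: "0 < norm y" "norm y \<le> 1"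
        by (auto intro: less_trans[of 0 "1 / r"])
      then have "1 / norm y ^ 4 \<le> (1 / norm y ^ 4)\<^sup>2"
        by (intro self_le_power) (auto simp: power_le_one)
      then have "(f (inversion y))\<^sup>2 * (1 / norm y ^ 4) \<le> (f (inversion y))\<^sup>2 * (1 / norm y ^ 4)\<^sup>2"
        by (intro mult_left_mono) auto
      then show ?thesis by (simp add: kelvin_def power_divide)
    qed
    then show "ennreal ((f (inversion y))\<^sup>2) * ennreal (1 / norm y ^ 4) \<le> ennreal ((kelvin f y)\<^sup>2)"
      by (subst ennreal_mult[symmetric]) (auto intro: ennreal_leI)
  qed
  finally show ?thesis .
qed

end

section \<open>Interpolation\<close>

text \<open>
  \<open>64 = 4\<^sup>3\<close> comes from the frequency threshold \<open>4 / t\<close>; the second constant collects the Sobolev bound at the dilated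
  scale \<open>8 r\<^sup>2 t\<close> and the density term, divided by \<open>4\<close>.
\<close>

definition low_const :: "real \<Rightarrow> real" where
  "low_const r = 64 * (3168 * r\<^sup>2 + 216)"

definition high_const :: "real \<Rightarrow> real" where
  "high_const r = 4 * modulus_const r * (8 * r\<^sup>2) ^ 4 + 16 * weight_const r"

context disc_supported begin

lemma f_compactly_supported: "compactly_supported f r"
  using cont support_norm(2) by unfold_locales (auto intro: less_imp_le)

lemma kelvin_compactly_supported: "compactly_supported (kelvin f) 1"
  using kelvin_continuous kelvin_support1 by unfold_locales auto

abbreviation K1 :: real where "K1 \<equiv> low_const r"
abbreviation K2 :: real where "K2 \<equiv> high_const r"

lemma L2_nn: "L2_energy f = ennreal ((L2_norm_plane f)\<^sup>2)"
proof -
  interpret cs: compactly_supported f r by (rule f_compactly_supported)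
  have "continuous_on UNIV (\<lambda>x. (f x)\<^sup>2)" by (intro continuous_intros cont)
  then have int: "integrable lborel (\<lambda>x. (f x)\<^sup>2)"
    by (rule continuous_compact_support(1)[where R = r]) (use cs.supp in auto)
  have "L2_energy f = ennreal (LINT x|lborel. (f x)\<^sup>2)"
    by (rule nn_integral_eq_integral[OF int]) simp
  moreover have "(LINT x|lborel. (f x)\<^sup>2) = (L2_norm_plane f)\<^sup>2"
    unfolding L2_norm_plane_def by (rule real_sqrt_pow2[symmetric], rule Bochner_Integration.integral_nonneg) simp
  ultimately show ?thesis by (simp only:)
qed

context
  fixes \<beta> \<rho> :: real
  assumes \<beta>: "0 < \<beta>" "\<beta> < 1" and sm: "smooth f" and le: "sobolev_norm \<beta> f \<le> \<rho>"
begin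

lemma sobolev_nn: "sobolev_energy \<beta> f \<le> ennreal (\<rho>\<^sup>2)"
  by (rule compactly_supported.sobolev_nn_integral_le[OF f_compactly_supported sm \<beta> le])

text \<open>
  The weight in the Sobolev norm is at least \<open>1\<close>.
\<close>

lemma L2_sq_le_rho: "L2_energy f \<le> ennreal (\<rho>\<^sup>2)"
proof -
  interpret cs: compactly_supported f r by (rule f_compactly_supported)
  have "L2_energy f = (\<integral>\<^sup>+ \<xi>. power_spectrum f \<xi> \<partial>lborel)"
    by (rule plancherel_fourier2[OF cs.cont cs.supp, symmetric])
  also have "\<dots> \<le> sobolev_energy \<beta> f"
  proof (intro nn_integral_mono ennreal_leI)
    fix \<xi> :: "real \<times> real"
    have "1 \<le> (1 + (norm \<xi>)\<^sup>2) powr \<beta>" using \<beta> by (intro ge_one_powr_ge_zero) auto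
    then have "1 * (cmod (fourier2 f \<xi>))\<^sup>2 \<le> (1 + (norm \<xi>)\<^sup>2) powr \<beta> * (cmod (fourier2 f \<xi>))\<^sup>2"
      by (rule mult_right_mono) simp
    then show "(cmod (fourier2 f \<xi>))\<^sup>2 \<le> (1 + (norm \<xi>)\<^sup>2) powr \<beta> * (cmod (fourier2 f \<xi>))\<^sup>2" by simp
  qed
  also note sobolev_nn
  finally show ?thesis .
qed

lemma high_frequency:
  assumes t: "0 < t" "t \<le> 1 / (4 * r)"
  shows "(\<integral>\<^sup>+ \<xi>. indicator {\<xi>. \<bar>fst \<xi>\<bar> \<ge> 2 / t \<or> \<bar>snd \<xi>\<bar> \<ge> 2 / t} \<xi> * power_spectrum (kelvin f) \<xi> \<partial>lborel)
    \<le> ennreal (K2 * t powr (2 * \<beta>) * \<rho>\<^sup>2)"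
proof -
  let ?H = "\<integral>\<^sup>+ \<xi>. indicator {\<xi>. \<bar>fst \<xi>\<bar> \<ge> 2 / t \<or> \<bar>snd \<xi>\<bar> \<ge> 2 / t} \<xi> * power_spectrum (kelvin f) \<xi> \<partial>lborel"
  have r0: "r > 0" using r by simp
  have t1: "t \<le> 1" using t r by (auto intro: order_trans[of _ "1 / (4 * r)"] simp: field_simps)
  let ?\<tau> = "8 * r\<^sup>2 * t"
  have \<tau>0: "?\<tau> > 0" using t r0 by simp
  have "ennreal (4 * t\<^sup>2) * ?H \<le> modulus2 (kelvin f) (2 * t)"
    by (rule compactly_supported.high_frequency_le_modulus2[OF kelvin_compactly_supported t(1)])
  also have "\<dots> \<le> ennreal C1 * modulus2 f (4 * r\<^sup>2 * (2 * t)) + ennreal (4 * C2 * (2 * t) ^ 4) * L2_energy f"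
    by (rule modulus2_kelvin) (use t in auto)
  also have "\<dots> \<le> ennreal C1 * (ennreal (16 * ?\<tau>\<^sup>2 * ?\<tau> powr (2 * \<beta>)) * ennreal (\<rho>\<^sup>2)) + ennreal (4 * C2 * (2 * t) ^ 4) * ennreal (\<rho>\<^sup>2)"
  proof (intro add_mono mult_left_mono L2_sq_le_rho)
    have "modulus2 f ?\<tau> \<le> ennreal (16 * ?\<tau>\<^sup>2 * ?\<tau> powr (2 * \<beta>)) * sobolev_energy \<beta> f"
      by (rule compactly_supported.modulus2_le_sobolev[OF f_compactly_supported \<beta> \<tau>0])
    also have "\<dots> \<le> ennreal (16 * ?\<tau>\<^sup>2 * ?\<tau> powr (2 * \<beta>)) * ennreal (\<rho>\<^sup>2)"
      by (rule mult_left_mono[OF sobolev_nn]) simp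
    finally show "modulus2 f (4 * r\<^sup>2 * (2 * t)) \<le> ennreal (16 * ?\<tau>\<^sup>2 * ?\<tau> powr (2 * \<beta>)) * ennreal (\<rho>\<^sup>2)"
      by (simp add: mult.left_commute[of _ 2] mult.assoc)
  qed auto
  also have "\<dots> = ennreal (C1 * (16 * ?\<tau>\<^sup>2 * ?\<tau> powr (2 * \<beta>) * \<rho>\<^sup>2) + 4 * C2 * (2 * t) ^ 4 * \<rho>\<^sup>2)"
    using C_nonneg by (simp only: ennreal_plus ennreal_mult mult_nonneg_nonneg zero_le_power2 powr_ge_zero zero_le_numeral zero_le_even_power even_numeral)
  also have "\<dots> \<le> ennreal (4 * t\<^sup>2 * (K2 * t powr (2 * \<beta>) * \<rho>\<^sup>2))"
  proof (rule ennreal_leI)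
    have "8 * r\<^sup>2 \<ge> 1" using one_le_power[of r 2] r by linarith
    then have "(8 * r\<^sup>2) powr (2 * \<beta>) \<le> (8 * r\<^sup>2) powr 2" using \<beta> by (intro powr_mono) auto
    also have "\<dots> = (8 * r\<^sup>2)\<^sup>2" using r0 by (simp add: powr_numeral)
    finally have "?\<tau> powr (2 * \<beta>) \<le> (8 * r\<^sup>2)\<^sup>2 * t powr (2 * \<beta>)"
      using t r0 by (simp add: powr_mult mult_right_mono)
    then have "16 * ?\<tau>\<^sup>2 * ?\<tau> powr (2 * \<beta>) \<le> 16 * ?\<tau>\<^sup>2 * ((8 * r\<^sup>2)\<^sup>2 * t powr (2 * \<beta>))"
      by (rule mult_left_mono) simp
    also have "\<dots> = 16 * (8 * r\<^sup>2) ^ 4 * (t\<^sup>2 * t powr (2 * \<beta>))"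
      by (simp add: power_mult_distrib power_mult[symmetric])
    finally have 1: "C1 * (16 * ?\<tau>\<^sup>2 * ?\<tau> powr (2 * \<beta>) * \<rho>\<^sup>2) \<le> C1 * (16 * (8 * r\<^sup>2) ^ 4 * (t\<^sup>2 * t powr (2 * \<beta>)) * \<rho>\<^sup>2)"
      using C_nonneg by (intro mult_left_mono mult_right_mono) auto
    have "t\<^sup>2 = t powr 2" using t by (simp add: powr_numeral)
    also have "\<dots> \<le> t powr (2 * \<beta>)" using t t1 \<beta> by (intro powr_mono') auto
    finally have h: "t\<^sup>2 * t\<^sup>2 \<le> t\<^sup>2 * t powr (2 * \<beta>)" by (rule mult_left_mono) simp
    have "64 * C2 * (t\<^sup>2 * t\<^sup>2) * \<rho>\<^sup>2 \<le> 64 * C2 * (t\<^sup>2 * t powr (2 * \<beta>)) * \<rho>\<^sup>2"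
      by (rule mult_right_mono[OF mult_left_mono[OF h]]) (use C_nonneg in auto)
    moreover have "4 * C2 * (2 * t) ^ 4 * \<rho>\<^sup>2 = 64 * C2 * (t\<^sup>2 * t\<^sup>2) * \<rho>\<^sup>2"
      by (simp add: power_mult_distrib flip: power_add)
    ultimately have 2: "4 * C2 * (2 * t) ^ 4 * \<rho>\<^sup>2 \<le> 64 * C2 * (t\<^sup>2 * t powr (2 * \<beta>)) * \<rho>\<^sup>2" by simp
    have "4 * t\<^sup>2 * (K2 * t powr (2 * \<beta>) * \<rho>\<^sup>2)
      = C1 * (16 * (8 * r\<^sup>2) ^ 4 * (t\<^sup>2 * t powr (2 * \<beta>)) * \<rho>\<^sup>2) + 64 * C2 * (t\<^sup>2 * t powr (2 * \<beta>)) * \<rho>\<^sup>2"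
      unfolding high_const_def by (simp add: algebra_simps)
    then show "C1 * (16 * ?\<tau>\<^sup>2 * ?\<tau> powr (2 * \<beta>) * \<rho>\<^sup>2) + 4 * C2 * (2 * t) ^ 4 * \<rho>\<^sup>2 \<le> 4 * t\<^sup>2 * (K2 * t powr (2 * \<beta>) * \<rho>\<^sup>2)"
      using 1 2 by linarith
  qed
  also have "\<dots> = ennreal (4 * t\<^sup>2) * ennreal (K2 * t powr (2 * \<beta>) * \<rho>\<^sup>2)"
    by (rule ennreal_mult') simp
  finally show ?thesis
    using t by (subst (asm) ennreal_mult_le_mult_iff) auto
qed

text \<open>
  Frequencies in the square \<open>|\<xi>\<^sub>1|, |\<xi>\<^sub>2| < 2 / t\<close> lie in the disc of radius \<open>4 / t\<close> and are controlled by the transform,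
  the others by the Sobolev norm.
\<close>

lemma frequency_split:
  assumes t: "0 < t" "t \<le> 1 / (4 * r)"
  shows "(L2_norm_plane f)\<^sup>2 \<le> K1 / t ^ 3 * (L2_norm_cyl (disc_transform f))\<^sup>2 + K2 * t powr (2 * \<beta>) * \<rho>\<^sup>2"
proof -
  let ?F = "\<lambda>\<xi>. power_spectrum (kelvin f) \<xi>"
  let ?high = "{\<xi> :: real \<times> real. \<bar>fst \<xi>\<bar> \<ge> 2 / t \<or> \<bar>snd \<xi>\<bar> \<ge> 2 / t}"
  let ?low = "{\<xi> :: real \<times> real. norm \<xi> < 4 / t}"
  have t1: "t \<le> 1" using t r by (auto intro: order_trans[of _ "1 / (4 * r)"] simp: field_simps)
  have A: "4 / t \<ge> 1" using t t1 by (simp add: field_simps)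
  have K2: "K2 \<ge> 0" using C_nonneg by (simp add: high_const_def)
  have [measurable]: "?low \<in> sets borel"
    by (intro borel_open open_Collect_less continuous_intros)
  have [measurable]: "?high \<in> sets borel"
    by (intro borel_closed closed_Collect_disj closed_Collect_le continuous_intros)
  have cover: "\<xi> \<in> ?low \<or> \<xi> \<in> ?high" for \<xi>
  proof (cases "\<xi> \<in> ?high")
    case False
    then have "\<bar>fst \<xi>\<bar> < 2 / t" "\<bar>snd \<xi>\<bar> < 2 / t" by auto
    moreover have "norm \<xi> \<le> \<bar>fst \<xi>\<bar> + \<bar>snd \<xi>\<bar>" using norm_Pair_le[of "fst \<xi>" "snd \<xi>"] by simp
    ultimately have "norm \<xi> < 2 / t + 2 / t" by linarith
    then show ?thesis by simp
  qed simp
  have "ennreal ((L2_norm_plane f)\<^sup>2) \<le> L2_energy (kelvin f)"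
    unfolding L2_nn[symmetric] by (rule L2_le_kelvin)
  also have "\<dots> = (\<integral>\<^sup>+ \<xi>. ?F \<xi> \<partial>lborel)"
    by (rule plancherel_fourier2[OF kelvin_continuous kelvin_support1, symmetric])
  also have "\<dots> \<le> (\<integral>\<^sup>+ \<xi>. indicator ?low \<xi> * ?F \<xi> + indicator ?high \<xi> * ?F \<xi> \<partial>lborel)"
  proof (rule nn_integral_mono)
    fix \<xi> show "?F \<xi> \<le> indicator ?low \<xi> * ?F \<xi> + indicator ?high \<xi> * ?F \<xi>"
      using cover[of \<xi>] by (auto simp: indicator_def)
  qed
  also have "\<dots> = (\<integral>\<^sup>+ \<xi>. indicator ?low \<xi> * ?F \<xi> \<partial>lborel) + (\<integral>\<^sup>+ \<xi>. indicator ?high \<xi> * ?F \<xi> \<partial>lborel)"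
    by (rule nn_integral_add) measurable
  also have "\<dots> \<le> ennreal ((4 / t) ^ 3 * (3168 * r\<^sup>2 + 216)) * cyl_sq + ennreal (K2 * t powr (2 * \<beta>) * \<rho>\<^sup>2)"
    by (intro add_mono low_frequency[OF A] high_frequency[OF t])
  also have "\<dots> = ennreal ((4 / t) ^ 3 * (3168 * r\<^sup>2 + 216) * (L2_norm_cyl (disc_transform f))\<^sup>2 + K2 * t powr (2 * \<beta>) * \<rho>\<^sup>2)"
    using t K2 by (subst ennreal_plus) (auto simp: ennreal_mult)
  also have "(4 / t) ^ 3 * (3168 * r\<^sup>2 + 216) = K1 / t ^ 3"
    by (simp add: low_const_def power_divide)
  finally show ?thesis
    using t K2 by (subst (asm) ennreal_le_iff) (auto simp: low_const_def)
qed

end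
end

text \<open>
  The two terms balance at \<open>t\<close> proportional to \<open>(E / \<rho>)\<^bsup>\<kappa>\<^esup>\<close> with \<open>\<kappa> = 1 / (\<beta> + 3/2)\<close>. This is admissible for \<open>E < \<rho>\<close>; for
  \<open>E \<ge> \<rho>\<close> the trivial bound \<open>n \<le> \<rho>\<close> suffices, and for \<open>E = 0\<close> letting \<open>t\<close> tend to \<open>0\<close> forces \<open>n = 0\<close>.
\<close>

lemma optimise_splitting:
  fixes \<beta> \<rho> E n t0 K L :: real
  assumes \<beta>: "\<beta> > 0" and \<rho>: "\<rho> > 0" and E: "E \<ge> 0" and n: "n \<ge> 0" "n \<le> \<rho>"
    and t0: "0 < t0" "t0 \<le> 1" and KL: "K \<ge> 0" "L \<ge> 0"
    and bound: "\<And>t. 0 < t \<Longrightarrow> t \<le> t0 \<Longrightarrow> n\<^sup>2 \<le> K / t ^ 3 * E\<^sup>2 + L * t powr (2 * \<beta>) * \<rho>\<^sup>2"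
  shows "n \<le> max 1 (sqrt (K / t0 ^ 3 + L)) * \<rho> powr ((3/2) / (\<beta> + 3/2)) * E powr (\<beta> / (\<beta> + 3/2))"
proof -
  define \<kappa> where "\<kappa> = 1 / (\<beta> + 3/2)"
  let ?c = "max 1 (sqrt (K / t0 ^ 3 + L))"
  have \<kappa>: "\<kappa> > 0" using \<beta> by (simp add: \<kappa>_def)
  have exps: "(3/2) / (\<beta> + 3/2) = 3/2 * \<kappa>" "\<beta> / (\<beta> + 3/2) = \<beta> * \<kappa>" by (simp_all add: \<kappa>_def)
  have sum1: "3/2 * \<kappa> + \<beta> * \<kappa> = 1" 
  proof -
    have "(3/2 + \<beta>) * \<kappa> = 1" unfolding \<kappa>_def using \<beta> by (simp add: add.commute)
    then show ?thesis by (simp only: distrib_right)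
  qed
  have \<rho>_split: "\<rho> powr (3/2 * \<kappa>) * \<rho> powr (\<beta> * \<kappa>) = \<rho>"
    using \<rho> by (simp only: powr_add[symmetric] sum1) simp
  consider "E \<ge> \<rho>" | "0 < E" "E < \<rho>" | "E = 0" using E by linarith
  then show ?thesis unfolding exps
  proof cases
    case 1
    have "\<rho> powr (\<beta> * \<kappa>) \<le> E powr (\<beta> * \<kappa>)"
      using 1 \<rho> \<beta> \<kappa> by (intro powr_mono2) auto
    then have "\<rho> powr (3/2 * \<kappa>) * \<rho> powr (\<beta> * \<kappa>) \<le> \<rho> powr (3/2 * \<kappa>) * E powr (\<beta> * \<kappa>)"
      by (rule mult_left_mono) simp
    then have "n \<le> 1 * (\<rho> powr (3/2 * \<kappa>) * E powr (\<beta> * \<kappa>))" using n(2) unfolding \<rho>_split by linarith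
    also have "\<dots> \<le> ?c * (\<rho> powr (3/2 * \<kappa>) * E powr (\<beta> * \<kappa>))"
      by (rule mult_right_mono) auto
    finally show "n \<le> ?c * \<rho> powr (3/2 * \<kappa>) * E powr (\<beta> * \<kappa>)" by (simp add: mult.assoc)
  next
    case 2
    define q where "q = E / \<rho>"
    have q: "0 < q" "q < 1" using 2 \<rho> by (auto simp: q_def)
    have E_eq: "E = q * \<rho>" using \<rho> by (simp add: q_def)
    define t where "t = t0 * q powr \<kappa>"
    have qk: "q powr \<kappa> \<le> 1" using q \<kappa> powr_le1 by (auto intro: powr_le1)
    have t: "0 < t" "t \<le> t0" using t0 q qk by (auto simp: t_def mult_left_le)
    have "n\<^sup>2 \<le> K / t ^ 3 * E\<^sup>2 + L * t powr (2 * \<beta>) * \<rho>\<^sup>2" by (rule bound[OF t])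
    also have "K / t ^ 3 * E\<^sup>2 = K / t0 ^ 3 * q powr (2 * (\<beta> * \<kappa>)) * \<rho>\<^sup>2"
    proof -
      have "(q powr \<kappa>) ^ 3 = q powr (3 * \<kappa>)" using q by (simp add: powr_power mult.commute)
      moreover have "q\<^sup>2 = q powr 2" using q by (simp add: powr_numeral)
      moreover have "2 - 3 * \<kappa> = 2 * (\<beta> * \<kappa>)" using sum1 by linarith
      ultimately have "q\<^sup>2 / (q powr \<kappa>) ^ 3 = q powr (2 * (\<beta> * \<kappa>))"
        by (simp add: powr_diff[symmetric])
      moreover have "K / t ^ 3 * E\<^sup>2 = K / t0 ^ 3 * (q\<^sup>2 / (q powr \<kappa>) ^ 3) * \<rho>\<^sup>2"
        by (simp add: t_def E_eq power_mult_distrib)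
      ultimately show ?thesis by (simp only:)
    qed
    also have "L * t powr (2 * \<beta>) * \<rho>\<^sup>2 \<le> L * q powr (2 * (\<beta> * \<kappa>)) * \<rho>\<^sup>2"
    proof -
      have "t \<le> q powr \<kappa>" using t0 q by (simp add: t_def mult_left_le_one_le)
      then have "t powr (2 * \<beta>) \<le> (q powr \<kappa>) powr (2 * \<beta>)" using t \<beta> by (intro powr_mono2) auto
      also have "\<dots> = q powr (2 * (\<beta> * \<kappa>))" by (simp add: powr_powr mult_ac)
      finally show ?thesis using KL by (intro mult_right_mono mult_left_mono) auto
    qed
    finally have "n\<^sup>2 \<le> (K / t0 ^ 3 + L) * (q powr (2 * (\<beta> * \<kappa>)) * \<rho>\<^sup>2)"
      by (simp add: algebra_simps)
    also have "\<dots> = (sqrt (K / t0 ^ 3 + L) * (q powr (\<beta> * \<kappa>) * \<rho>))\<^sup>2"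
    proof -
      have "(q powr (\<beta> * \<kappa>))\<^sup>2 = q powr (2 * (\<beta> * \<kappa>))" using q by (simp add: powr_power mult.commute)
      then show ?thesis using KL t0 by (simp add: power_mult_distrib)
    qed
    finally have "n \<le> sqrt (K / t0 ^ 3 + L) * (q powr (\<beta> * \<kappa>) * \<rho>)"
      by (rule power2_le_imp_le) (use KL t0 \<rho> in auto)
    also have "\<dots> \<le> ?c * (q powr (\<beta> * \<kappa>) * \<rho>)"
      using \<rho> by (intro mult_right_mono) auto
    also have "q powr (\<beta> * \<kappa>) * \<rho> = \<rho> powr (3/2 * \<kappa>) * E powr (\<beta> * \<kappa>)"
    proof -
      have "q powr (\<beta> * \<kappa>) * (\<rho> powr (3/2 * \<kappa>) * \<rho> powr (\<beta> * \<kappa>)) = \<rho> powr (3/2 * \<kappa>) * (q * \<rho>) powr (\<beta> * \<kappa>)"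
        using q \<rho> by (simp add: powr_mult)
      then show ?thesis unfolding \<rho>_split E_eq .
    qed
    finally show "n \<le> ?c * \<rho> powr (3/2 * \<kappa>) * E powr (\<beta> * \<kappa>)" by (simp add: mult.assoc)
  next
    case 3
    have "n = 0"
    proof (rule ccontr)
      assume "n \<noteq> 0"
      then have n2: "n\<^sup>2 > 0" by simp
      \<comment> \<open>the value of \<open>t\<^bsup>2\<beta>\<^esup>\<close> at which the right side would be at most \<open>n\<^sup>2 / 2\<close>\<close>
      define x where "x = n\<^sup>2 / (2 * (L + 1) * \<rho>\<^sup>2)"
      have x: "x > 0" using n2 KL \<rho> by (simp add: x_def)
      define t where "t = min t0 (x powr (1 / (2 * \<beta>)))"
      have t: "0 < t" "t \<le> t0" using t0 x by (auto simp: t_def)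
      have "t powr (2 * \<beta>) \<le> (x powr (1 / (2 * \<beta>))) powr (2 * \<beta>)"
        using t \<beta> by (intro powr_mono2) (auto simp: t_def)
      also have "\<dots> = x" using x \<beta> by (simp add: powr_powr)
      finally have "t powr (2 * \<beta>) \<le> x" .
      then have "L * t powr (2 * \<beta>) * \<rho>\<^sup>2 \<le> (L + 1) * x * \<rho>\<^sup>2"
        using KL x by (intro mult_right_mono mult_mono) auto
      also have "\<dots> = x * (2 * (L + 1) * \<rho>\<^sup>2) / 2" by simp
      also have "x * (2 * (L + 1) * \<rho>\<^sup>2) = n\<^sup>2" unfolding x_def using KL \<rho> by simp
      finally show False using bound[OF t] 3 n2 by simp
    qed
    then show "n \<le> ?c * \<rho> powr (3/2 * \<kappa>) * E powr (\<beta> * \<kappa>)" by simp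
  qed
qed

theorem theorem5:
  fixes r :: real
  assumes "r > 1"
  shows "\<forall>\<beta>::real. 0 < \<beta> \<and> \<beta> < 1 \<longrightarrow>
    (\<exists>c::real. \<forall>\<rho>::real. \<rho> > 0 \<longrightarrow>
      (\<forall>f \<in> C0_infty (disc_Dr r). sobolev_norm \<beta> f \<le> \<rho> \<longrightarrow>
        L2_norm_plane f \<le>
          c * \<rho> powr ((3/2) / (\<beta> + 3/2)) * L2_norm_cyl (disc_transform f) powr (\<beta> / (\<beta> + 3/2))))"
proof (intro allI impI, elim conjE, intro exI allI impI ballI)
  fix \<beta> \<rho> :: real and f
  assume \<beta>: "0 < \<beta>" "\<beta> < 1" and \<rho>: "\<rho> > 0" and f: "f \<in> C0_infty (disc_Dr r)" and le: "sobolev_norm \<beta> f \<le> \<rho>"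
  have sm: "smooth f" and sub: "closure {x. f x \<noteq> 0} \<subseteq> disc_Dr r" using f by (auto simp: C0_infty_def)
  interpret disc_supported f r
  proof
    have "Ck 0 f" using sm by (simp add: smooth_def)
    then show "continuous_on UNIV f" by simp
    show "x \<in> disc_Dr r" if "f x \<noteq> 0" for x
      using subsetD[OF closure_subset, of x "{x. f x \<noteq> 0}"] subsetD[OF sub, of x] that by simp
  qed (rule assms)
  show "L2_norm_plane f \<le> max 1 (sqrt (low_const r / (1 / (4 * r)) ^ 3 + high_const r))
     * \<rho> powr ((3/2) / (\<beta> + 3/2)) * L2_norm_cyl (disc_transform f) powr (\<beta> / (\<beta> + 3/2))"
  proof (rule optimise_splitting)
    have "ennreal ((L2_norm_plane f)\<^sup>2) \<le> ennreal (\<rho>\<^sup>2)"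
      using L2_sq_le_rho[OF \<beta> sm le] unfolding L2_nn .
    then have "(L2_norm_plane f)\<^sup>2 \<le> \<rho>\<^sup>2" by simp
    then show "L2_norm_plane f \<le> \<rho>" 
      by (rule power2_le_imp_le) (use \<rho> in simp)
    show "0 \<le> L2_norm_plane f" unfolding L2_norm_plane_def
      by (intro real_sqrt_ge_zero Bochner_Integration.integral_nonneg) simp
    show "0 \<le> L2_norm_cyl (disc_transform f)" unfolding L2_norm_cyl_def set_lebesgue_integral_def
      by (intro real_sqrt_ge_zero Bochner_Integration.integral_nonneg scaleR_nonneg_nonneg) auto
    show "0 \<le> low_const r" "0 \<le> high_const r" using C_nonneg by (auto simp: low_const_def high_const_def)
    \<comment> \<open>for \<open>t \<le> 1 / (4 r)\<close> the scale \<open>2 t\<close> is small enough for the support to stay away from \<open>0\<close>\<close>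
    show "0 < 1 / (4 * r)" "1 / (4 * r) \<le> 1" using assms by auto
    show "(L2_norm_plane f)\<^sup>2 \<le> low_const r / t ^ 3 * (L2_norm_cyl (disc_transform f))\<^sup>2
        + high_const r * t powr (2 * \<beta>) * \<rho>\<^sup>2" if "0 < t" "t \<le> 1 / (4 * r)" for t
      by (rule frequency_split[OF \<beta> sm le that])
  qed (rule \<beta> \<rho>)+
qed

end
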